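(* Let $D$ be a weakly locally finite division ring with center $F$, and let $G$ be an ascendant subgroup of $D^*$. If $G$ is radical over $F$, then $G$ is central, i.e. $G\subseteq F$.
   Context: $D^*=D\setminus\{0\}$. A division ring is centrally finite if it is finite-dimensional over its center. A division ring $D$ is weakly locally finite if for every finite subset $S$ of $D$ the division subring of $D$ generated by $S$ is centrally finite. A subgroup $H$ of a group $X$ is ascendant in $X$ if there is an ordinal $\gamma$ and a family of subgroups $(H_\alpha)_{\alpha\le\gamma}$ with $H_0=H$, $H_\gamma=X$, $H_\alpha\trianglelefteq H_{\alpha+1}$ for all $\alpha<\gamma$, and $H_\lambda=\bigcup_{\alpha<\lambda}H_\alpha$ for every limit ordinal $\lambda\le\gamma$. $G$ is radical over $F$ if for every $x\in G$ there is a positive integer $m(x)$ with $x^{m(x)}\in F$. *)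

theory Defs
  imports "HOL-Algebra.Embedded_Algebras" "HOL-Algebra.Multiplicative_Group"
begin

section \<open>Division rings\<close>

text \<open>Division rings, not necessarily commutative; the name \<open>division_ring\<close> is taken by the
  type class. Since \<open>\<one>\<close> is a unit, the axiom includes \<open>\<one> \<noteq> \<zero>\<close>.\<close>

locale skew_field = ring R for R (structure) +
  assumes skew_field_Units: "Units R = carrier R - {\<zero>}"

locale division_subring = subring K R for K and R (structure) +
  assumes division_subring_Units: "Units (R\<lparr>carrier := K\<rparr>) = K - {\<zero>}"

definition generated_division_subring :: "('a, 'b) ring_scheme \<Rightarrow> 'a set \<Rightarrow> 'a set"
  where "generated_division_subring R S = \<Inter>{K. division_subring K R \<and> S \<subseteq> K}"

definition ring_center :: "('a, 'b) ring_scheme \<Rightarrow> 'a set"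
  where "ring_center R =
    {z \<in> carrier R. \<forall>x \<in> carrier R. z \<otimes>\<^bsub>R\<^esub> x = x \<otimes>\<^bsub>R\<^esub> z}"

definition centrally_finite :: "('a, 'b) ring_scheme \<Rightarrow> bool"
  where "centrally_finite R \<longleftrightarrow> ring.finite_dimension R (ring_center R) (carrier R)"

definition weakly_locally_finite :: "('a, 'b) ring_scheme \<Rightarrow> bool"
  where "weakly_locally_finite R \<longleftrightarrow>
    (\<forall>S. finite S \<and> S \<subseteq> carrier R \<longrightarrow>
      centrally_finite (R\<lparr>carrier := generated_division_subring R S\<rparr>))"

definition radical_over :: "('a, 'b) monoid_scheme \<Rightarrow> 'a set \<Rightarrow> 'a set \<Rightarrow> bool"
  where "radical_over R G F \<longleftrightarrow> (\<forall>x \<in> G. \<exists>m::nat. m > 0 \<and> x [^]\<^bsub>R\<^esub> m \<in> F)"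


section \<open>Ascendant subgroups\<close>

definition wo_successor :: "'i rel \<Rightarrow> 'i \<Rightarrow> 'i \<Rightarrow> bool"
  where "wo_successor r \<alpha> \<beta> \<longleftrightarrow>
    \<alpha> \<in> underS r \<beta> \<and> (\<forall>\<xi> \<in> underS r \<beta>. (\<xi>, \<alpha>) \<in> r)"

definition wo_limit :: "'i rel \<Rightarrow> 'i \<Rightarrow> bool"
  where "wo_limit r \<mu> \<longleftrightarrow> underS r \<mu> \<noteq> {} \<and> \<not> (\<exists>\<alpha>. wo_successor r \<alpha> \<mu>)"

text \<open>The ordinals \<open>\<alpha> \<le> \<gamma>\<close> are represented by the elements of the field of a well-order \<open>r\<close> with
  least element \<open>z\<close> and greatest element \<open>\<gamma>\<close>.\<close>

definition ascendant_series ::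
    "'i rel \<Rightarrow> 'i \<Rightarrow> 'i \<Rightarrow> ('i \<Rightarrow> 'a set) \<Rightarrow> 'a set \<Rightarrow> ('a, 'b) monoid_scheme \<Rightarrow> bool"
  where "ascendant_series r z \<gamma> Hs H X \<longleftrightarrow>
    Well_order r \<and>
    z \<in> Field r \<and> (\<forall>\<alpha> \<in> Field r. (z, \<alpha>) \<in> r) \<and>
    \<gamma> \<in> Field r \<and> (\<forall>\<alpha> \<in> Field r. (\<alpha>, \<gamma>) \<in> r) \<and>
    (\<forall>\<alpha> \<in> Field r. subgroup (Hs \<alpha>) X) \<and>
    Hs z = H \<and> Hs \<gamma> = carrier X \<and>
    (\<forall>\<alpha> \<beta>. wo_successor r \<alpha> \<beta> \<longrightarrow> Hs \<alpha> \<lhd> X\<lparr>carrier := Hs \<beta>\<rparr>) \<and>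
    (\<forall>\<mu>. wo_limit r \<mu> \<longrightarrow> Hs \<mu> = (\<Union>\<alpha> \<in> underS r \<mu>. Hs \<alpha>))"

text \<open>HOL cannot quantify over all ordinals at once, so the type carrying the index ordinal is a
  parameter. In a theorem assuming \<open>ascendant TYPE('i) H X\<close> with \<open>'i\<close> a type variable, the index
  ordinal is an arbitrary ordinal representable on an arbitrary type.\<close>

definition ascendant :: "'i itself \<Rightarrow> 'a set \<Rightarrow> ('a, 'b) monoid_scheme \<Rightarrow> bool"
  where "ascendant _ H X \<longleftrightarrow>
    (\<exists>(r :: 'i rel) z \<gamma> Hs. ascendant_series r z \<gamma> Hs H X)"

end

theory Submission
  imports Defs "Jordan_Normal_Form.Determinant"
begin

text \<open>Let \<open>a \<in> G\<close> and suppose that \<open>b\<close> does not commute with \<open>a\<close>; replace \<open>D\<close> by the centrally finite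
  division subring generated by \<open>a\<close> and \<open>b\<close>. For \<open>x \<noteq> 0\<close> put \<open>x\<^sub>0 = x\<close> and
  \<open>x\<^sub>k\<^sub>+\<^sub>1 = a x\<^sub>k a\<^sup>-\<^sup>1 x\<^sub>k\<^sup>-\<^sup>1\<close>. Each step strictly lowers the least index of a member of the ascendant
  series that contains the element, so \<open>x\<^sub>k \<in> G\<close> for large \<open>k\<close>, and a power of \<open>x\<^sub>k\<close> is central.
  As \<open>x\<^sub>k\<close> is a commutator, the norm of \<open>D\<close> over its center \<open>F\<close> is \<open>1\<close> on it, and so \<open>x\<^sub>k\<close> is torsion.

  Choose \<open>s \<in> F\<close> with \<open>s\<^sup>-\<^sup>1 \<notin> \<int>[s]\<close>, namely \<open>s = 2\<close> in characteristic \<open>0\<close>, and a subring \<open>R\<close> of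
  \<open>F\<close> maximal subject to \<open>s \<in> R\<close>, \<open>s\<^sup>-\<^sup>1 \<notin> R\<close>. It is a valuation ring, so there is a finitely
  generated \<open>R\<close>-module \<open>L\<close> that spans \<open>D\<close>, is closed under multiplication and is stable under
  conjugation by \<open>a\<close> (which has finite order). By Nakayama's lemma \<open>U = 1 + s\<^sup>2 L\<close> is a group, and it
  is torsion-free. For \<open>x \<in> U\<close> all \<open>x\<^sub>k\<close> lie in \<open>U\<close>, hence \<open>x\<^sub>k = 1\<close> for some \<open>k > 0\<close>. If \<open>c = x\<^sub>k\<^sub>+\<^sub>1\<close>
  commutes with \<open>a\<close>, then \<open>a x\<^sub>k a\<^sup>-\<^sup>1 = c x\<^sub>k\<close> gives \<open>c\<^sup>m = 1\<close> where \<open>a\<^sup>m \<in> F\<close>; therefore \<open>c = 1\<close>, and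
  \<open>x\<^sub>k\<close> commutes with \<open>a\<close>. Descending to \<open>x\<^sub>0\<close> shows that \<open>a\<close> centralizes \<open>U\<close>, which spans \<open>D\<close>.

  If there is no such \<open>s\<close>, then \<open>F\<close> is algebraic over a finite field, \<open>D\<close> is locally finite, and
  Wedderburn's little theorem applies.\<close>

section \<open>Division rings inside a ring type\<close>

text \<open>The unit \<open>e\<close> may differ from \<open>1\<close>: the embedding \<open>emb\<close> below of a division ring into a type of
  class \<open>ring_1\<close> is not unital. In particular \<open>x ^ 0 = 1\<close> need not lie in the subset.\<close>

locale rng_subset =
  fixes R :: "'r::ring_1 set" and e :: 'r
  assumes add_mem: "x \<in> R \<Longrightarrow> y \<in> R \<Longrightarrow> x + y \<in> R"
    and uminus_mem: "x \<in> R \<Longrightarrow> - x \<in> R"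
    and mult_mem: "x \<in> R \<Longrightarrow> y \<in> R \<Longrightarrow> x * y \<in> R"
    and unit_mem: "e \<in> R"
    and unit_left: "x \<in> R \<Longrightarrow> e * x = x"
    and unit_right: "x \<in> R \<Longrightarrow> x * e = x"
begin

lemma diff_mem: "x \<in> R \<Longrightarrow> y \<in> R \<Longrightarrow> x - y \<in> R"
  using add_mem[of x "- y"] uminus_mem by simp

lemma zero_mem: "0 \<in> R"
  using diff_mem[OF unit_mem unit_mem] by simp

lemma mult_power_mem: "y \<in> R \<Longrightarrow> x \<in> R \<Longrightarrow> y * x ^ n \<in> R"
  by (induction n) (auto simp: mult_mem power_Suc2 mult.assoc[symmetric] simp del: power_Suc)

lemma power_mem: "x \<in> R \<Longrightarrow> 0 < n \<Longrightarrow> x ^ n \<in> R"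
  using mult_power_mem[of x x "n - 1"] by (cases n) auto

lemma sum_mem: "(\<And>i. i \<in> I \<Longrightarrow> f i \<in> R) \<Longrightarrow> sum f I \<in> R"
  by (induction I rule: infinite_finite_induct) (auto simp: zero_mem add_mem)

lemma of_nat_mem: "x \<in> R \<Longrightarrow> of_nat n * x \<in> R"
  by (induction n) (auto simp: zero_mem add_mem algebra_simps)

lemma of_int_mem: "x \<in> R \<Longrightarrow> of_int z * x \<in> R"
  by (cases z rule: int_cases2) (auto simp: of_nat_mem uminus_mem)

lemma unit_power: "0 < n \<Longrightarrow> e ^ n = e"
  by (induction n rule: nat_induct_non_zero) (auto simp: unit_left unit_mem)

end

section \<open>Inverses, cancellation and a Vandermonde argument\<close>

locale division_subset = rng_subset D e for D :: "'r::ring_1 set" and e +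
  assumes unit_nonzero: "e \<noteq> 0"
    and ex_inverse: "x \<in> D \<Longrightarrow> x \<noteq> 0 \<Longrightarrow> \<exists>y\<in>D. x * y = e \<and> y * x = e"
begin

definition minv :: "'r \<Rightarrow> 'r"
  where "minv x = (SOME y. y \<in> D \<and> x * y = e \<and> y * x = e)"

lemma minv:
  assumes "x \<in> D" "x \<noteq> 0"
  shows minv_mem: "minv x \<in> D" and minv_right: "x * minv x = e" and minv_left: "minv x * x = e"
proof -
  have "minv x \<in> D \<and> x * minv x = e \<and> minv x * x = e"
    unfolding minv_def by (rule someI_ex) (use ex_inverse[OF assms] in blast)
  then show "minv x \<in> D" "x * minv x = e" "minv x * x = e" by auto
qed

lemma minv_nonzero: "x \<in> D \<Longrightarrow> x \<noteq> 0 \<Longrightarrow> minv x \<noteq> 0"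
  using minv_right unit_nonzero by force

lemma no_zero_divisors:
  assumes "x \<in> D" "y \<in> D" "x * y = 0"
  shows "x = 0 \<or> y = 0"
proof (rule disjCI)
  assume "y \<noteq> 0"
  then have "x * y * minv y = x"
    unfolding mult.assoc using assms \<open>y \<noteq> 0\<close> by (simp add: minv_right unit_right)
  then show "x = 0" using assms by simp
qed

lemma mult_nonzero: "x \<in> D \<Longrightarrow> y \<in> D \<Longrightarrow> x \<noteq> 0 \<Longrightarrow> y \<noteq> 0 \<Longrightarrow> x * y \<noteq> 0"
  using no_zero_divisors by blast

lemma left_cancel: "x \<in> D \<Longrightarrow> y \<in> D \<Longrightarrow> z \<in> D \<Longrightarrow> x \<noteq> 0 \<Longrightarrow> x * y = x * z \<Longrightarrow> y = z"
  using no_zero_divisors[of x "y - z"] by (auto simp: diff_mem algebra_simps)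

lemma right_cancel: "x \<in> D \<Longrightarrow> y \<in> D \<Longrightarrow> z \<in> D \<Longrightarrow> x \<noteq> 0 \<Longrightarrow> y * x = z * x \<Longrightarrow> y = z"
  using no_zero_divisors[of "y - z" x] by (auto simp: diff_mem algebra_simps)

lemma power_nonzero: "x \<in> D \<Longrightarrow> x \<noteq> 0 \<Longrightarrow> x ^ n \<noteq> 0"
proof (induction n)
  case (Suc n)
  then show ?case
    by (cases "n = 0") (use mult_nonzero[of x "x ^ n"] power_mem[of x n] in auto)
qed (use unit_nonzero in auto)

lemma minv_unique: "x \<in> D \<Longrightarrow> y \<in> D \<Longrightarrow> x * y = e \<Longrightarrow> y = minv x"
  by (metis left_cancel minv_mem minv_right mult_zero_left unit_nonzero)

lemma minv_minv: "x \<in> D \<Longrightarrow> x \<noteq> 0 \<Longrightarrow> minv (minv x) = x"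
  using minv_unique[of "minv x" x] minv by simp

lemma minv_mult:
  assumes "x \<in> D" "y \<in> D" "x \<noteq> 0" "y \<noteq> 0"
  shows "minv (x * y) = minv y * minv x"
proof (rule minv_unique[symmetric])
  have "x * y * (minv y * minv x) = x * (y * minv y) * minv x"
    by (simp add: mult.assoc)
  then show "x * y * (minv y * minv x) = e"
    using assms by (simp add: minv unit_right)
qed (use assms in \<open>simp_all add: mult_mem minv\<close>)

lemma minv_commute:
  assumes "x \<in> D" "y \<in> D" "x \<noteq> 0" "x * y = y * x"
  shows "minv x * y = y * minv x"
proof -
  have "minv x * y = minv x * (y * x) * minv x"
    using assms by (simp add: mult.assoc minv unit_right)
  also have "\<dots> = (minv x * x) * y * minv x"
    by (simp add: mult.assoc flip: assms(4))
  finally show ?thesis using assms by (simp add: minv unit_left)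
qed

text \<open>Subtracting \<open>l j\<close> times relation \<open>k\<close> from relation
  \<open>k + 1\<close> removes the summand \<open>j\<close> and replaces \<open>h i\<close> by
  \<open>(l i - l j) * h i\<close>. The \<open>l i\<close> commute with one another, while the
  \<open>h i\<close> may be arbitrary elements of the noncommutative \<open>D\<close>.\<close>

lemma vandermonde:
  assumes "finite I"
    and "\<And>i. i \<in> I \<Longrightarrow> l i \<in> D" "\<And>i. i \<in> I \<Longrightarrow> h i \<in> D"
    and "\<And>i j. i \<in> I \<Longrightarrow> j \<in> I \<Longrightarrow> l i * l j = l j * l i"
    and "inj_on l I"
    and "\<And>k. (\<Sum>i\<in>I. l i ^ k * h i) = 0"
  shows "\<forall>i\<in>I. h i = 0"
  using assms
proof (induction I arbitrary: h rule: finite_induct)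
  case (insert j I)
  have "(\<Sum>i\<in>I. l i ^ k * ((l i - l j) * h i)) = 0" for k
  proof -
    have "(\<Sum>i\<in>I. l i ^ k * ((l i - l j) * h i)) = (\<Sum>i\<in>insert j I. l i ^ k * ((l i - l j) * h i))"
      using insert.hyps by simp
    also have "\<dots> = (\<Sum>i\<in>insert j I. l i ^ Suc k * h i - l j * (l i ^ k * h i))"
    proof (rule sum.cong)
      fix i assume "i \<in> insert j I"
      then have "l j * l i ^ k = l i ^ k * l j"
        using insert.prems(3)[of j i] by (metis insertI1 power_commuting_commutes)
      then show "l i ^ k * ((l i - l j) * h i) = l i ^ Suc k * h i - l j * (l i ^ k * h i)"
        by (simp only: left_diff_distrib right_diff_distrib power_Suc2 mult.assoc[symmetric])
    qed simp
    also have "\<dots> = 0"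
      using insert.prems(5)[of "Suc k"] insert.prems(5)[of k]
      by (simp add: sum_subtractf del: power_Suc sum.insert flip: sum_distrib_left)
    finally show ?thesis .
  qed
  then have *: "\<forall>i\<in>I. (l i - l j) * h i = 0"
    using insert.prems by (intro insert.IH) (auto simp: mult_mem diff_mem inj_on_def)
  have 0: "h i = 0" if "i \<in> I" for i
  proof -
    have "l i - l j \<noteq> 0"
      using insert.prems(4) insert.hyps that by (auto simp: inj_on_def)
    then show ?thesis
      using * that no_zero_divisors[of "l i - l j" "h i"] insert.prems by (auto simp: diff_mem)
  qed
  moreover have "h j = 0"
    using insert.prems(5)[of 0] insert.hyps 0 by simp
  ultimately show ?case by simp
qed simp

end

section \<open>Wedderburn's little theorem\<close>

text \<open>Reindexing cycles the summands. The sum starts at 1 because \<open>x ^ 0\<close> is the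
  unit of the type, which may lie outside \<open>D\<close>.\<close>

lemma sum_shift_periodic:
  fixes f :: "nat \<Rightarrow> 'a::cancel_comm_monoid_add"
  assumes "f (Suc d) = f 1"
  shows "(\<Sum>i=1..d. f (Suc i)) = (\<Sum>i=1..d. f i)"
proof -
  have "(\<Sum>i=1..k. f (Suc i)) + f 1 = (\<Sum>i=1..k. f i) + f (Suc k)" for k
  proof (induction k)
    case (Suc k)
    have "(\<Sum>i=1..Suc k. f (Suc i)) + f 1 = (\<Sum>i=1..k. f (Suc i)) + f 1 + f (Suc (Suc k))"
      by (simp add: add_ac)
    then show ?case unfolding Suc by simp
  qed simp
  from this[of d] assms show ?thesis by simp
qed

context division_subset
begin

lemma card_minus_one_pos:
  assumes "finite D"
  shows "0 < card D - 1"
proof -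
  have "card {0, e} \<le> card D"
    using assms zero_mem unit_mem by (intro card_mono) auto
  then show ?thesis using unit_nonzero by auto
qed

text \<open>Lagrange's theorem for the multiplicative group of \<open>D\<close>, packaged as a
  record with unit \<open>e\<close>.\<close>

lemma finite_power_card:
  assumes "finite D" "x \<in> D" "x \<noteq> 0"
  shows "x ^ (card D - 1) = e"
proof -
  define G where "G = \<lparr>carrier = D - {0}, monoid.mult = (*), one = e\<rparr>"
  have "group G"
  proof (rule groupI)
    fix x assume "x \<in> carrier G"
    then have "minv x \<in> carrier G \<and> minv x \<otimes>\<^bsub>G\<^esub> x = \<one>\<^bsub>G\<^esub>"
      by (simp add: G_def minv minv_nonzero)
    then show "\<exists>y\<in>carrier G. y \<otimes>\<^bsub>G\<^esub> x = \<one>\<^bsub>G\<^esub>" by blast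
  qed (auto simp: G_def mult_mem unit_mem unit_nonzero mult_nonzero mult.assoc unit_left)
  then interpret G: group G .
  have fin: "finite (carrier G)" using assms by (simp add: G_def)
  have "x [^]\<^bsub>G\<^esub> n = (if n = 0 then e else x ^ n)" for n :: nat
    by (induction n) (use assms in \<open>auto simp: G_def unit_left power_Suc2 simp del: power_Suc\<close>)
  moreover have "Coset.order G = card D - 1"
    using assms zero_mem by (simp add: G_def Coset.order_def card_Diff_singleton)
  moreover have "card D - 1 > 0"
    by (rule card_minus_one_pos[OF assms(1)])
  ultimately show ?thesis
    using G.pow_order_eq_1[of x] assms by (auto simp: G_def)
qed

lemma finite_of_nat_card:
  assumes "finite D"
  shows "of_nat (card D) * e = 0"
proof -
  define G where "G = \<lparr>carrier = D, monoid.mult = (+), one = 0 :: 'r\<rparr>"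
  have "group G"
    by (rule groupI)
      (auto simp: G_def add_mem zero_mem add.assoc intro!: bexI[where x = "- _"] uminus_mem)
  then interpret G: group G .
  have "e [^]\<^bsub>G\<^esub> n = of_nat n * e" for n :: nat
    by (induction n) (auto simp: G_def algebra_simps)
  then show ?thesis
    using G.pow_order_eq_1[of e] by (simp add: unit_mem) (simp add: G_def Coset.order_def unit_mem)
qed

text \<open>The order \<open>d\<close> of \<open>a\<close> is nonzero in \<open>D\<close>, so
  \<open>of_nat d * y\<close> splits into eigenvectors of right multiplication by \<open>a\<close>,
  with powers of \<open>a\<close> acting from the left as eigenvalues. If every nonzero component
  had eigenvalue \<open>a\<close>, then \<open>y\<close> would commute with
  \<open>a\<close>.\<close>

lemma finite_eigenvector:
  assumes fin: "finite D" and a: "a \<in> D" and y: "y \<in> D" and nc: "a * y \<noteq> y * a"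
  obtains x j where "x \<in> D" "x \<noteq> 0" "0 < j" "x * a = a ^ j * x" "a ^ j \<noteq> a"
proof -
  have a0: "a \<noteq> 0" using nc by auto
  have c2: "card D - 1 > 0"
    by (rule card_minus_one_pos[OF fin])
  define d where "d = (LEAST d. 0 < d \<and> a ^ d = e)"
  have d: "0 < d" "a ^ d = e"
    unfolding d_def using LeastI[of "\<lambda>d. 0 < d \<and> a ^ d = e", OF conjI[OF c2 finite_power_card[OF fin a a0]]]
    by blast+
  have d_least: "a ^ i \<noteq> e" if "0 < i" "i < d" for i
    using not_less_Least[of i "\<lambda>d. 0 < d \<and> a ^ d = e"] that unfolding d_def by auto
  have mult_e: "a ^ (d * k + i) = a ^ i" if "0 < i" for k i
    using d power_mem[OF a that] unit_power[of k]
    by (cases "k = 0") (auto simp: power_add power_mult unit_left)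
  have "d dvd card D - 1"
  proof (rule ccontr)
    assume "\<not> d dvd card D - 1"
    then have m: "0 < (card D - 1) mod d" by (simp add: mod_greater_zero_iff_not_dvd)
    have "a ^ (d * ((card D - 1) div d) + (card D - 1) mod d) = e"
      unfolding mult_div_mod_eq by (rule finite_power_card[OF fin a a0])
    then have "a ^ ((card D - 1) mod d) = e"
      unfolding mult_e[OF m] .
    then show False using d_least[OF m] d(1) by simp
  qed
  then obtain q where q: "card D - 1 = d * q" by (auto simp: dvd_def)
  \<comment> \<open>Since \<open>d\<close> divides \<open>card D - 1\<close>, the vanishing of
    \<open>d\<close> in \<open>D\<close> would turn \<open>card D\<close> times \<open>e\<close>
    into \<open>e\<close>, whereas it is 0 by Lagrange's theorem for the additive group.\<close>
  have d_nz: "of_nat d * e \<noteq> 0"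
  proof
    assume 0: "of_nat d * e = 0"
    have "of_nat (card D) * e = of_nat (Suc (d * q)) * e"
      using q c2 by (metis Suc_diff_1 Suc_eq_plus1 add.commute less_imp_Suc_add zero_less_diff plus_1_eq_Suc add_diff_cancel_left' zero_less_Suc)
    also have "\<dots> = of_nat q * (of_nat d * e) + e"
      by (simp add: algebra_simps) (metis mult.assoc mult_of_nat_commute)
    finally show False using 0 finite_of_nat_card[OF fin] unit_nonzero by simp
  qed
  define b where "b = minv a"
  have b: "b \<in> D" "a * b = e" "b * a = e" "b \<noteq> 0"
    unfolding b_def using minv[OF a a0] minv_nonzero[OF a a0] by auto
  have ab: "a ^ k * b ^ k = e" if "0 < k" for k
    using that
  proof (induction k rule: nat_induct_non_zero)
    case (Suc k)
    have "a ^ Suc k * b ^ Suc k = a * (a ^ k * b ^ k) * b"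
      by (simp add: mult.assoc power_commutes)
    then show ?case using Suc b a by (simp add: unit_right)
  qed (use b in auto)
  have bd: "b ^ d = e"
    using ab[OF d(1)] d power_mem[OF b(1) d(1)] by (simp add: unit_left)
  have b_least: "b ^ i \<noteq> e" if "0 < i" "i < d" for i
    using ab[OF that(1)] d_least[OF that] unit_right[OF power_mem[OF a that(1)]] by metis
  define f where "f j i = b ^ (i * j) * y * a ^ i" for i j
  \<comment> \<open>Since \<open>a ^ d = e\<close>, right multiplication by \<open>a\<close> is diagonalizable over left multiplication by
    powers of \<open>a\<close>, and \<open>P j\<close> is \<open>d\<close> times the projection of \<open>y\<close> to the eigenspace of \<open>a ^ j\<close>.\<close>
  define P where "P j = (\<Sum>i=1..d. f j i)" for j
  have f_mem: "f j i \<in> D" if "0 < i" "0 < j" for i j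
    unfolding f_def using that by (intro mult_mem power_mem a b y) auto
  have P_mem: "P j \<in> D" if "0 < j" for j
    unfolding P_def using that by (intro sum_mem f_mem) auto
  have eig: "P j * a = a ^ j * P j" if j: "0 < j" for j
  proof -
    have "f j i * a = a ^ j * f j (Suc i)" if i: "0 < i" for i
    proof -
      have "a ^ j * f j (Suc i) = (a ^ j * b ^ j) * b ^ (i * j) * y * a ^ Suc i"
        unfolding f_def by (simp add: power_add mult.assoc)
      also have "\<dots> = f j i * a"
        using ab[OF j] power_mem[OF b(1), of "i * j"] i j
        by (simp add: f_def unit_left mult.assoc power_commutes)
      finally show ?thesis by simp
    qed
    then have "P j * a = a ^ j * (\<Sum>i=1..d. f j (Suc i))"
      unfolding P_def sum_distrib_left sum_distrib_right by (intro sum.cong) auto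
    also have "(\<Sum>i=1..d. f j (Suc i)) = P j"
      unfolding P_def
    proof (rule sum_shift_periodic)
      have "b ^ (Suc d * j) = b ^ j"
        using bd unit_power[OF j] power_mem[OF b(1) j]
        by (simp add: power_add power_mult unit_right)
      moreover have "a ^ Suc d = a" using d a by (simp add: unit_right)
      ultimately show "f j (Suc d) = f j 1"
        unfolding f_def by simp
    qed
    finally show ?thesis .
  qed
  have sum_P: "(\<Sum>j=1..d. P j) = of_nat d * y"
  proof -
    \<comment> \<open>For \<open>i < d\<close> the sum is unchanged by multiplication with
      \<open>b ^ i\<close>, which differs from \<open>e\<close>; hence it vanishes.\<close>
    have geo: "(\<Sum>j=1..d. (b ^ i) ^ j) = (if i = d then of_nat d * e else 0)" if i: "0 < i" "i \<le> d" for i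
    proof (cases "i = d")
      case True
      then show ?thesis using bd unit_power by simp
    next
      case False
      let ?w = "b ^ i"
      have w: "?w \<in> D" "?w \<noteq> e" using power_mem[OF b(1)] b_least False i by auto
      have "?w ^ Suc d = ?w"
        using bd unit_power[OF i(1)] w(1) by (metis mult.commute power_Suc power_mult unit_right)
      then have "(\<Sum>j=1..d. ?w ^ Suc j) = (\<Sum>j=1..d. ?w ^ j)"
        by (intro sum_shift_periodic) simp
      then have "?w * (\<Sum>j=1..d. ?w ^ j) = (\<Sum>j=1..d. ?w ^ j)"
        by (simp add: sum_distrib_left)
      moreover have S: "(\<Sum>j=1..d. ?w ^ j) \<in> D"
        using w(1) by (intro sum_mem) (simp add: power_mem)
      ultimately have "(?w - e) * (\<Sum>j=1..d. ?w ^ j) = 0"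
        by (simp add: algebra_simps unit_left)
      then show ?thesis
        using no_zero_divisors[of "?w - e", OF _ S] w unit_mem False by (auto simp: diff_mem)
    qed
    have "(\<Sum>j=1..d. P j) = (\<Sum>i=1..d. \<Sum>j=1..d. f j i)"
      unfolding P_def by (rule sum.swap)
    also have "\<dots> = (\<Sum>i=1..d. (\<Sum>j=1..d. (b ^ i) ^ j) * y * a ^ i)"
      by (simp add: f_def sum_distrib_right power_mult)
    also have "\<dots> = (\<Sum>i=1..d. if i = d then of_nat d * y else 0)"
    proof (rule sum.cong)
      fix i assume "i \<in> {1..d}"
      then show "(\<Sum>j=1..d. (b ^ i) ^ j) * y * a ^ i = (if i = d then of_nat d * y else 0)"
        using geo[of i] d y by (simp add: mult.assoc unit_left unit_right del: sum.cl_ivl_Suc)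
    qed simp
    also have "\<dots> = of_nat d * y" using d by simp
    finally show ?thesis .
  qed
  have "\<exists>j\<in>{1..d}. P j \<noteq> 0 \<and> a ^ j \<noteq> a"
  proof (rule ccontr)
    assume "\<not> ?thesis"
    then have "P j * a = a * P j" if "j \<in> {1..d}" for j
      using eig[of j] that by (cases "P j = 0") auto
    then have "(\<Sum>j=1..d. P j) * a = a * (\<Sum>j=1..d. P j)"
      unfolding sum_distrib_left sum_distrib_right by (intro sum.cong) auto
    then have "of_nat d * (y * a - a * y) = 0"
      unfolding sum_P by (simp add: algebra_simps) (metis mult.assoc mult_of_nat_commute)
    then have "(of_nat d * e) * (y * a - a * y) = 0"
      using a y by (simp add: mult.assoc unit_left diff_mem mult_mem)
    then show False
      using no_zero_divisors[of "of_nat d * e" "y * a - a * y"] d_nz nc a y unit_mem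
      by (auto simp: of_nat_mem diff_mem mult_mem)
  qed
  then obtain j where "j \<in> {1..d}" "P j \<noteq> 0" "a ^ j \<noteq> a" by blast
  then show thesis
    by (intro that[of "P j" j] P_mem eig) auto
qed

section \<open>Conjugation and centralizers\<close>

abbreviation conj_by :: "'r \<Rightarrow> 'r \<Rightarrow> 'r"
  where "conj_by x t \<equiv> x * t * minv x"

lemma conj_mem: "x \<in> D \<Longrightarrow> x \<noteq> 0 \<Longrightarrow> t \<in> D \<Longrightarrow> conj_by x t \<in> D"
  by (simp add: mult_mem minv)

lemma conj_mult:
  assumes "x \<in> D" "x \<noteq> 0" "s \<in> D" "t \<in> D"
  shows "conj_by x (s * t) = conj_by x s * conj_by x t"
proof -
  have "conj_by x s * conj_by x t = x * s * (minv x * x) * t * minv x"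
    by (simp add: mult.assoc)
  then show ?thesis using assms by (simp add: minv unit_right mult_mem mult.assoc)
qed

lemma conj_power:
  assumes "x \<in> D" "x \<noteq> 0" "t \<in> D" "0 < n"
  shows "conj_by x (t ^ n) = conj_by x t ^ n"
  using assms(4)
proof (induction n rule: nat_induct_non_zero)
  case (Suc n)
  then show ?case
    using conj_mult[OF assms(1,2,3), of "t ^ n"] assms power_mem by simp
qed simp

lemma conj_conj:
  assumes "x \<in> D" "x \<noteq> 0" "y \<in> D" "y \<noteq> 0"
  shows "conj_by x (conj_by y t) = conj_by (x * y) t"
  using assms by (simp add: minv_mult mult.assoc)

lemma conj_minv:
  assumes "x \<in> D" "x \<noteq> 0" "t \<in> D" "t \<noteq> 0"
  shows "conj_by x (minv t) = minv (conj_by x t)"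
proof (rule minv_unique)
  have "conj_by x t * conj_by x (minv t) = conj_by x (t * minv t)"
    using conj_mult[OF assms(1,2,3), of "minv t"] assms by (simp add: minv)
  then show "conj_by x t * conj_by x (minv t) = e"
    using assms by (simp add: minv unit_right)
qed (use assms in \<open>auto simp: conj_mem minv\<close>)

lemma conj_nonzero: "x \<in> D \<Longrightarrow> x \<noteq> 0 \<Longrightarrow> t \<in> D \<Longrightarrow> t \<noteq> 0 \<Longrightarrow> conj_by x t \<noteq> 0"
  by (simp add: mult_mem mult_nonzero minv minv_nonzero)

lemma conj_eq_self_iff:
  assumes "x \<in> D" "x \<noteq> 0" "t \<in> D"
  shows "conj_by x t = t \<longleftrightarrow> x * t = t * x"
proof
  assume "conj_by x t = t"
  then have "t * x = conj_by x t * x" by simp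
  then show "x * t = t * x" using assms by (simp add: mult.assoc minv unit_right)
qed (use assms in \<open>simp add: minv unit_right mult.assoc\<close>)

definition cent :: "'r set \<Rightarrow> 'r set"
  where "cent S = {z \<in> D. \<forall>s\<in>S. z * s = s * z}"

lemma cent_rng_subset: "S \<subseteq> D \<Longrightarrow> rng_subset (cent S) e"
  by unfold_locales
    (auto simp: cent_def add_mem uminus_mem mult_mem unit_mem unit_left unit_right algebra_simps,
      metis mult.assoc)

lemma cent_subset: "cent S \<subseteq> D"
  by (auto simp: cent_def)

lemma cent_minv: "S \<subseteq> D \<Longrightarrow> x \<in> cent S \<Longrightarrow> x \<noteq> 0 \<Longrightarrow> minv x \<in> cent S"
  by (auto simp: cent_def minv intro!: minv_commute)

lemma cent_conj_image:
  assumes "x \<in> D" "x \<noteq> 0" "S \<subseteq> D" "t \<in> cent S"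
  shows "conj_by x t \<in> cent (conj_by x ` S)"
  using assms
  by (auto simp: cent_def conj_mem simp flip: conj_mult)

text \<open>Conjugation by \<open>minv x\<close> stabilizes \<open>S\<close> as well, and this
  yields the reverse inclusion.\<close>

lemma cent_stable:
  assumes x: "x \<in> D" "x \<noteq> 0" and S: "S \<subseteq> D" and st: "conj_by x ` S = S"
  shows "conj_by x ` cent S = cent S"
proof
  show "conj_by x ` cent S \<subseteq> cent S"
    using cent_conj_image[OF x S] st by auto
  have x': "minv x \<in> D" "minv x \<noteq> 0" using x minv minv_nonzero by auto
  have id: "conj_by x (conj_by (minv x) t) = t" "conj_by (minv x) (conj_by x t) = t" if "t \<in> D" for t
    using conj_conj[OF x x'] conj_conj[OF x' x] x that minv_unique[OF unit_mem unit_mem]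
    by (simp_all add: minv unit_left unit_mem unit_right)
  have "conj_by (minv x) ` S = conj_by (minv x) ` conj_by x ` S" by (simp add: st)
  also have "\<dots> = S" unfolding image_image using id S by force
  finally have "conj_by (minv x) ` cent S \<subseteq> cent S"
    using cent_conj_image[OF x' S] by auto
  then have "conj_by x ` conj_by (minv x) ` cent S \<subseteq> conj_by x ` cent S" by (rule image_mono)
  also have "conj_by x ` conj_by (minv x) ` cent S = cent S"
    unfolding image_image using id cent_subset[of S] by force
  finally show "cent S \<subseteq> conj_by x ` cent S" .
qed

end

text \<open>The fibre of a homomorphism through \<open>w\<close> is the coset of the kernel by
  \<open>w\<close>. Assuming these bijections avoids setting up a group structure on
  \<open>A\<close>.\<close>

lemma card_eq_kernel_times_image:
  fixes A :: "'a::times set"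
  assumes "finite A"
    and "\<And>w. w \<in> A \<Longrightarrow> bij_betw (\<lambda>k. k * w) {k \<in> A. f k = e} {k \<in> A. f k = f w}"
  shows "card A = card {k \<in> A. f k = e} * card (f ` A)"
proof -
  have "card A = (\<Sum>c\<in>f ` A. card {k \<in> A. f k = c})"
    using sum.image_gen[OF assms(1), of "\<lambda>_. 1::nat" f] by simp
  also have "\<dots> = (\<Sum>c\<in>f ` A. card {k \<in> A. f k = e})"
    using bij_betw_same_card[OF assms(2)] by (intro sum.cong) auto
  finally show ?thesis by simp
qed

context division_subset
begin

theorem finite_commutative:
  assumes fin: "finite D" and ay: "a \<in> D" "y \<in> D"
  shows "a * y = y * a"
proof (rule ccontr)
  assume "a * y \<noteq> y * a"
  then obtain x j where x: "x \<in> D" "x \<noteq> 0" and j: "0 < j" and xa: "x * a = a ^ j * x" "a ^ j \<noteq> a"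
    using finite_eigenvector[OF fin ay] by metis
  note a = ay(1)
  have a0: "a \<noteq> 0" using xa(2) j by (auto simp: power_0_left)
  have N0: "0 < card D - 1"
    by (rule card_minus_one_pos[OF fin])
  define r where "r = (LEAST r. 0 < r \<and> x ^ r * a = a * x ^ r)"
  have "0 < card D - 1 \<and> x ^ (card D - 1) * a = a * x ^ (card D - 1)"
    using N0 finite_power_card[OF fin x] a by (simp add: unit_left unit_right)
  then have r: "0 < r" "x ^ r * a = a * x ^ r"
    unfolding r_def using LeastI[of "\<lambda>r. 0 < r \<and> x ^ r * a = a * x ^ r"] by blast+
  have r_least: "x ^ i * a \<noteq> a * x ^ i" if "0 < i" "i < r" for i
    using not_less_Least[of i "\<lambda>r. 0 < r \<and> x ^ r * a = a * x ^ r"] that unfolding r_def by auto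
  define \<sigma> where "\<sigma> = conj_by x"
  define \<beta> where "\<beta> = x ^ r"
  have \<beta>: "\<beta> \<in> D" "\<beta> \<noteq> 0" unfolding \<beta>_def using power_mem power_nonzero x r by auto
  have \<sigma>_mem: "t \<in> D \<Longrightarrow> \<sigma> t \<in> D" for t unfolding \<sigma>_def using conj_mem x by auto
  have \<sigma>x: "\<sigma> t * x = x * t" if "t \<in> D" for t
    unfolding \<sigma>_def using that x by (simp add: mult.assoc minv unit_right)
  have \<sigma>k_mem: "t \<in> D \<Longrightarrow> (\<sigma> ^^ k) t \<in> D" for t k
    by (induction k) (auto simp: \<sigma>_mem)
  have \<sigma>xk: "(\<sigma> ^^ k) t * x ^ k = x ^ k * t" if "t \<in> D" for t k
  proof (induction k)
    case (Suc k)
    have "(\<sigma> ^^ Suc k) t * x ^ Suc k = \<sigma> ((\<sigma> ^^ k) t) * x * x ^ k"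
      by (simp add: mult.assoc)
    also have "\<dots> = x * ((\<sigma> ^^ k) t * x ^ k)"
      using \<sigma>x[OF \<sigma>k_mem[OF that]] by (simp add: mult.assoc)
    finally show ?case by (simp add: Suc mult.assoc)
  qed simp
  define l where "l i = (\<sigma> ^^ i) a" for i
  have l_mem: "l i \<in> D" for i unfolding l_def using \<sigma>k_mem a by auto
  have l_0: "l 0 = a" by (simp add: l_def)
  have \<sigma>_l: "\<sigma> (l i) = l (Suc i)" for i by (simp add: l_def)
  have \<sigma>_a: "\<sigma> a = a ^ j"
    unfolding \<sigma>_def using xa x a power_mem[OF a j] by (simp add: mult.assoc minv unit_right)
  have l_power: "l i = a ^ (j ^ i)" for i
  proof (induction i)
    case (Suc i)
    have "\<sigma> (a ^ (j ^ i)) = \<sigma> a ^ (j ^ i)"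
      unfolding \<sigma>_def using j by (intro conj_power x a) simp
    then show ?case by (simp add: Suc \<sigma>_l[symmetric] \<sigma>_a power_mult mult.commute)
  qed (simp add: l_0)
  have l_comm: "l i * l k = l k * l i" for i k
    unfolding l_power by (metis power_add add.commute)
  have l_r: "l r = a"
  proof -
    have "l r * \<beta> = a * \<beta>"
      unfolding l_def \<beta>_def using \<sigma>xk[OF a] r by simp
    then show ?thesis using right_cancel[OF \<beta>(1) l_mem a \<beta>(2)] by simp
  qed
  have \<sigma>_inj: "s = t" if "s \<in> D" "t \<in> D" "\<sigma> s = \<sigma> t" for s t
    using \<sigma>x that x left_cancel by metis
  have l_inj: "inj_on l {..<r}"
  proof -
    have *: False if "i < k" "k < r" "l i = l k" for i k
    proof -
      have "l 0 = l (k - i)"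
        using that(1,3)
      proof (induction i arbitrary: k)
        case (Suc i)
        then obtain k' where k': "k = Suc k'" by (cases k) auto
        then have "l i = l k'" using Suc.prems \<sigma>_inj l_mem by (simp add: \<sigma>_l[symmetric])
        then show ?case using Suc k' by auto
      qed simp
      then have "x ^ (k - i) * a = a * x ^ (k - i)"
        using \<sigma>xk[OF a, of "k - i"] by (simp add: l_def)
      then show False using r_least[of "k - i"] that by auto
    qed
    show ?thesis by (rule linorder_inj_onI) (use * in auto)
  qed
  define S where "S = insert \<beta> (l ` {..<r})"
  have S: "S \<subseteq> D" unfolding S_def using \<beta> l_mem by auto
  have \<sigma>_\<beta>: "\<sigma> \<beta> = \<beta>"
    unfolding \<sigma>_def \<beta>_def using conj_eq_self_iff x power_mem r by (simp add: power_commutes)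
  have \<sigma>_S: "\<sigma> ` S = S"
  proof -
    have "Suc ` {..<r} = {1..r}" by (auto simp: lessThan_atLeast0 image_Suc_atLeastLessThan)
    then have "l ` Suc ` {..<r} = l ` {1..r}" by simp
    also have "\<dots> = l ` {..<r}"
    proof -
      have "{1..r} = insert r ({..<r} - {0})" "{..<r} = insert 0 ({..<r} - {0})" using r by auto
      then show ?thesis using l_r l_0 by (metis image_insert)
    qed
    finally show ?thesis unfolding S_def using \<sigma>_\<beta> \<sigma>_l by (simp add: image_image)
  qed
  have \<beta>_l: "\<beta> * l i = l i * \<beta>" for i
    unfolding l_power \<beta>_def using r power_commuting_commutes by metis
  \<comment> \<open>The elements of \<open>S\<close> commute with one another, so the double
    centralizer \<open>K\<close> of \<open>S\<close> is commutative. It contains \<open>S\<close>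
    and inverses, and it is stable under \<sigma> because \<sigma> maps \<open>S\<close> onto
    itself.\<close>
  define C where "C = cent S"
  define K where "K = cent C"
  have C_sub: "C \<subseteq> D" unfolding C_def by (rule cent_subset)
  interpret K: rng_subset K e unfolding K_def by (rule cent_rng_subset[OF C_sub])
  have K_sub: "K \<subseteq> D" unfolding K_def by (rule cent_subset)
  have S_C: "S \<subseteq> C"
    using S unfolding C_def cent_def S_def by (auto simp: \<beta>_l l_comm)
  have K_C: "K \<subseteq> C"
    using S_C unfolding K_def C_def cent_def by auto
  have S_K: "S \<subseteq> K"
    using S unfolding K_def C_def cent_def by auto
  have K_comm: "s * t = t * s" if "s \<in> K" "t \<in> K" for s t
    using that K_C unfolding K_def cent_def by auto
  have \<sigma>_C: "\<sigma> ` C = C" unfolding C_def \<sigma>_def by (rule cent_stable[OF x S]) (use \<sigma>_S \<sigma>_def in auto)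
  have \<sigma>_K: "\<sigma> ` K = K" unfolding K_def \<sigma>_def by (rule cent_stable[OF x C_sub]) (use \<sigma>_C \<sigma>_def in auto)
  have \<sigma>_K_mem: "t \<in> K \<Longrightarrow> \<sigma> t \<in> K" for t using \<sigma>_K by auto
  have \<sigma>k_K: "t \<in> K \<Longrightarrow> (\<sigma> ^^ k) t \<in> K" for k t by (induction k) (auto simp: \<sigma>_K_mem)
  have K_minv: "t \<in> K \<Longrightarrow> t \<noteq> 0 \<Longrightarrow> minv t \<in> K" for t
    unfolding K_def by (rule cent_minv[OF C_sub])
  have \<beta>_K: "\<beta> \<in> K" and a_K: "a \<in> K" using S_K l_0 r(1) unfolding S_def by auto
  have l_K: "l i \<in> K" for i unfolding l_def by (rule \<sigma>k_K[OF a_K])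
  have \<sigma>_mult: "\<sigma> (s * t) = \<sigma> s * \<sigma> t" if "s \<in> K" "t \<in> K" for s t
    unfolding \<sigma>_def using that K_sub x by (intro conj_mult) auto
  have \<sigma>_r: "(\<sigma> ^^ r) t = t" if "t \<in> K" for t
  proof -
    have t: "t \<in> D" using that K_sub by auto
    have "(\<sigma> ^^ r) t * \<beta> = t * \<beta>"
      unfolding \<beta>_def \<sigma>xk[OF t] using K_comm[OF that \<beta>_K] by (simp add: \<beta>_def)
    then show ?thesis using right_cancel[OF \<beta>(1) \<sigma>k_mem[OF t] t \<beta>(2)] by simp
  qed
  have \<sigma>_nz: "\<sigma> t \<noteq> 0" if "t \<in> D" "t \<noteq> 0" for t
    unfolding \<sigma>_def by (rule conj_nonzero[OF x that])
  have \<sigma>_e: "\<sigma> e = e" unfolding \<sigma>_def using x by (simp add: unit_right minv)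
  \<comment> \<open>\<open>n y k = y * \<sigma> y * \<dots> * (\<sigma> ^^ (k - 1)) y\<close>, so \<open>n y r\<close> is the norm from \<open>K\<close> to its fixed field.\<close>
  define n where "n y = rec_nat e (\<lambda>k c. y * \<sigma> c)" for y
  have n_0: "n y 0 = e" and n_Suc: "n y (Suc k) = y * \<sigma> (n y k)" for y k
    by (simp_all add: n_def)
  have n_K: "n y k \<in> K" if "y \<in> K" for y k
    by (induction k) (auto simp: n_0 n_Suc that K.unit_mem K.mult_mem \<sigma>_K_mem)
  have n_nz: "n y k \<noteq> 0" if "y \<in> K" "y \<noteq> 0" for y k
  proof (induction k)
    case (Suc k)
    then show ?case unfolding n_Suc
      using that n_K K_sub by (intro mult_nonzero \<sigma>_nz \<sigma>_mem) auto
  qed (simp add: n_0 unit_nonzero)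
  have n_Suc2: "n y (Suc k) = n y k * (\<sigma> ^^ k) y" if "y \<in> K" for y k
  proof (induction k)
    case (Suc k)
    have "n y (Suc (Suc k)) = y * \<sigma> (n y k * (\<sigma> ^^ k) y)"
      using Suc n_Suc[of y "Suc k"] by simp
    also have "\<dots> = n y (Suc k) * (\<sigma> ^^ Suc k) y"
      by (simp add: \<sigma>_mult n_K that \<sigma>k_K n_Suc mult.assoc)
    finally show ?case .
  qed (use that K_sub in \<open>simp add: n_0 n_Suc \<sigma>_e K.unit_left K.unit_right\<close>)
  have n_mult: "n (y * z) k = n y k * n z k" if "y \<in> K" "z \<in> K" for y z k
  proof (induction k)
    case (Suc k)
    have "n (y * z) (Suc k) = y * (z * \<sigma> (n y k)) * \<sigma> (n z k)"
      by (simp add: n_Suc Suc \<sigma>_mult n_K that mult.assoc)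
    also have "\<dots> = n y (Suc k) * n z (Suc k)"
      unfolding K_comm[OF that(2) \<sigma>_K_mem[OF n_K[OF that(1)]]] by (simp add: n_Suc mult.assoc)
    finally show ?case .
  qed (simp add: n_0 K.unit_left K.unit_mem)
  have power_yx: "(y * x) ^ k = n y k * x ^ k" if y: "y \<in> K" and k: "0 < k" for y k
    using k
  proof (induction k rule: nat_induct_non_zero)
    case 1
    show ?case using y by (simp add: n_Suc[of _ 0] n_0 \<sigma>_e K.unit_right)
  next
    case (Suc k)
    have "(y * x) ^ Suc k = y * (x * n y k) * x ^ k" by (simp add: Suc mult.assoc)
    also have "x * n y k = \<sigma> (n y k) * x" using \<sigma>x[OF subsetD[OF K_sub n_K[OF y]]] by simp
    finally show ?case by (simp add: n_Suc mult.assoc)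
  qed
  define K1 where "K1 = K - {0}"
  define K0 where "K0 = {t \<in> K1. \<sigma> t = t}"
  define \<psi> where "\<psi> w = w * minv (\<sigma> w)" for w
  have finK: "finite K1" "finite K0" unfolding K0_def K1_def using finite_subset[OF K_sub fin] by auto
  have K1_D: "t \<in> D" "t \<noteq> 0" "t \<in> K" if "t \<in> K1" for t using that K_sub by (auto simp: K1_def)
  have K1_mult: "s * t \<in> K1" if "s \<in> K1" "t \<in> K1" for s t
    using K1_D[OF that(1)] K1_D[OF that(2)] K.mult_mem mult_nonzero by (auto simp: K1_def)
  have K1_minv: "minv t \<in> K1" if "t \<in> K1" for t
    using K1_D[OF that] K_minv minv_nonzero by (auto simp: K1_def)
  have K1_\<sigma>: "\<sigma> t \<in> K1" if "t \<in> K1" for t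
    using K1_D[OF that] \<sigma>_K_mem \<sigma>_nz by (auto simp: K1_def)
  have K1_comm: "s * t = t * s" if "s \<in> K1" "t \<in> K1" for s t
    using that K_comm by (auto simp: K1_def)
  have e_K1: "e \<in> K1" using K.unit_mem unit_nonzero by (simp add: K1_def)
  have counting: "card K1 = card {k \<in> K1. f k = e} * card (f ` K1)"
    if f: "\<And>s t. s \<in> K1 \<Longrightarrow> t \<in> K1 \<Longrightarrow> f (s * t) = f s * f t" "\<And>s. s \<in> K1 \<Longrightarrow> f s \<in> K1" for f
  proof (rule card_eq_kernel_times_image[OF finK(1)])
    fix w assume w: "w \<in> K1"
    show "bij_betw (\<lambda>k. k * w) {k \<in> K1. f k = e} {k \<in> K1. f k = f w}"
    proof (rule bij_betwI[where g = "\<lambda>k. k * minv w"])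
      show "(\<lambda>k. k * w) \<in> {k \<in> K1. f k = e} \<rightarrow> {k \<in> K1. f k = f w}"
        using w by (auto simp: f K1_mult unit_left K1_D)
      show "(\<lambda>k. k * minv w) \<in> {k \<in> K1. f k = f w} \<rightarrow> {k \<in> K1. f k = e}"
      proof safe
        fix k assume k: "k \<in> K1" "f k = f w"
        show "k * minv w \<in> K1" by (intro K1_mult K1_minv k w)
        have "f (k * minv w) = f (w * minv w)"
          by (simp add: k w K1_minv f)
        moreover have "w * minv w = e" by (intro minv K1_D w)
        moreover have "f e * f w = e * f w"
          using f(1)[OF e_K1 w] by (simp add: unit_left K1_D(1) f(2) w)
        ultimately show "f (k * minv w) = e"
          using right_cancel[OF K1_D(1) K1_D(1) unit_mem K1_D(2), OF f(2) f(2) f(2), OF w e_K1 w]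
          by simp
      qed
    qed (use w K1_D K1_minv in \<open>auto simp: mult.assoc minv unit_right\<close>)
  qed
  have "card K1 = card {k \<in> K1. \<psi> k = e} * card (\<psi> ` K1)"
  proof (rule counting)
    fix s t assume st: "s \<in> K1" "t \<in> K1"
    have "\<psi> (s * t) = s * (t * minv (\<sigma> t)) * minv (\<sigma> s)"
      unfolding \<psi>_def using \<sigma>_mult st K1_D K1_\<sigma> by (simp add: minv_mult mult.assoc)
    also have "\<dots> = s * minv (\<sigma> s) * (t * minv (\<sigma> t))"
      using K1_comm[of "t * minv (\<sigma> t)" "minv (\<sigma> s)"] st K1_minv K1_\<sigma> K1_mult
      by (simp add: mult.assoc)
    finally show "\<psi> (s * t) = \<psi> s * \<psi> t" by (simp add: \<psi>_def)
  qed (use K1_mult K1_minv K1_\<sigma> in \<open>auto simp: \<psi>_def\<close>)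
  moreover have "{k \<in> K1. \<psi> k = e} = K0"
  proof -
    have "\<psi> k = e \<longleftrightarrow> \<sigma> k = k" if k: "k \<in> K1" for k
    proof
      assume "\<psi> k = e"
      then have "k * minv (\<sigma> k) * \<sigma> k = \<sigma> k"
        unfolding \<psi>_def using K1_D K1_\<sigma>[OF k] unit_left by auto
      then show "\<sigma> k = k"
        using K1_D[OF k] K1_D[OF K1_\<sigma>[OF k]] by (simp add: mult.assoc minv unit_right)
    qed (use K1_D[OF k] in \<open>simp add: \<psi>_def minv\<close>)
    then show ?thesis by (auto simp: K0_def)
  qed
  ultimately have card1: "card K1 = card K0 * card (\<psi> ` K1)" by simp
  define N where "N y = n y r" for y
  have card2: "card K1 = card {k \<in> K1. N k = e} * card (N ` K1)"
    by (rule counting) (auto simp: N_def K1_def n_mult n_K n_nz)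
  have hilbert90: "{k \<in> K1. N k = e} \<subseteq> \<psi> ` K1"
  proof
    fix y assume "y \<in> {k \<in> K1. N k = e}"
    then have y: "y \<in> K1" and Ny: "N y = e" by auto
    \<comment> \<open>This is the Lagrange resolvent of \<open>a ^ k\<close>, with partial norms of
      \<open>y\<close> as coefficients. By the Vandermonde argument some resolvent is nonzero, and
      \<open>y * \<sigma> (w k) = w k\<close> because the extra term at \<open>r\<close> equals the
      one at 0 when \<open>N y = e\<close>.\<close>
    define w where "w k = (\<Sum>i<r. l i ^ k * n y i)" for k
    have "\<exists>k. w k \<noteq> 0"
    proof (rule ccontr)
      assume "\<nexists>k. w k \<noteq> 0"
      then have "\<forall>i\<in>{..<r}. n y i = 0"
        unfolding w_def using l_mem l_comm l_inj n_K[OF K1_D(3)[OF y]] K_sub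
        by (intro vandermonde[where l = l]) auto
      then show False using r n_nz K1_D[OF y] by auto
    qed
    then obtain k where wk: "w k \<noteq> 0" by auto
    have term_K: "l i ^ k * n y i \<in> K" for i
      by (cases "k = 0") (use n_K[OF K1_D(3)[OF y]] K.mult_mem K.power_mem l_K in auto)
    have w_K: "w k \<in> K1" unfolding K1_def using wk by (simp add: w_def K.sum_mem term_K)
    have step: "y * \<sigma> (l i ^ k * n y i) = l (Suc i) ^ k * n y (Suc i)" for i
    proof (cases "k = 0")
      case False
      have "\<sigma> (l i ^ k) = l (Suc i) ^ k"
        using False conj_power[OF x l_mem[of i], of k] \<sigma>_l[of i] unfolding \<sigma>_def by simp
      then have "\<sigma> (l i ^ k * n y i) = l (Suc i) ^ k * \<sigma> (n y i)"
        using \<sigma>_mult[of "l i ^ k" "n y i"] K.power_mem l_K n_K K1_D[OF y] False by simp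
      moreover have "y * l (Suc i) ^ k = l (Suc i) ^ k * y"
        using K_comm K1_D[OF y] K.power_mem l_K False by simp
      ultimately show ?thesis by (simp add: n_Suc mult.assoc[symmetric])
    qed (simp add: n_Suc)
    have \<sigma>_sum: "\<sigma> (sum f I) = (\<Sum>i\<in>I. \<sigma> (f i))" for f and I :: "nat set"
      unfolding \<sigma>_def by (simp add: sum_distrib_left sum_distrib_right)
    have "y * \<sigma> (w k) = (\<Sum>i<r. l (Suc i) ^ k * n y (Suc i))"
      unfolding w_def \<sigma>_sum sum_distrib_left step ..
    also have "\<dots> = w k"
    proof -
      have "(\<Sum>i<r. l (Suc i) ^ k * n y (Suc i)) + l 0 ^ k * n y 0
          = (\<Sum>i<r. l i ^ k * n y i) + l r ^ k * n y r"
        using sum.lessThan_Suc_shift[of "\<lambda>i. l i ^ k * n y i" r] by (simp add: algebra_simps)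
      then show ?thesis using Ny by (simp add: w_def N_def l_r l_0 n_0)
    qed
    finally have "\<psi> (w k) = y * (\<sigma> (w k) * minv (\<sigma> (w k)))"
      unfolding \<psi>_def by (metis mult.assoc)
    then have "y = \<psi> (w k)"
      using K1_D[OF K1_\<sigma>[OF w_K]] K1_D[OF y] by (simp add: minv unit_right)
    then show "y \<in> \<psi> ` K1" using w_K by blast
  qed
  have N_K0: "N ` K1 \<subseteq> K0"
  proof safe
    fix y assume y: "y \<in> K1"
    have "y * \<sigma> (N y) = y * N y"
      using n_Suc2[OF K1_D(3)[OF y], of r] \<sigma>_r[OF K1_D(3)[OF y]] K_comm[OF n_K K1_D(3)[OF y], of y r] K1_D[OF y]
      unfolding N_def n_Suc by simp
    moreover have NK: "N y \<in> K1" unfolding N_def K1_def using n_K n_nz K1_D[OF y] by auto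
    ultimately have "\<sigma> (N y) = N y"
      using left_cancel[of y] K1_D[OF y] K1_D[OF K1_\<sigma>[OF NK]] K1_D[OF NK] by auto
    then show "N y \<in> K0" using NK by (simp add: K0_def)
  qed
  \<comment> \<open>The product of \<open>card K0\<close> and the size of the image of \<psi> equals
    the product of the sizes of the kernel and the image of \<open>N\<close>. The kernel of
    \<open>N\<close> is no larger than the image of \<psi>, so the image of \<open>N\<close> has at
    least \<open>card K0\<close> elements.\<close>
  have "N ` K1 = K0"
  proof (rule card_seteq[OF finK(2) N_K0])
    have "card {k \<in> K1. N k = e} \<le> card (\<psi> ` K1)"
      using hilbert90 finK by (intro card_mono) auto
    moreover have "0 < card K1" using finK e_K1 by (auto simp: card_gt_0_iff)
    moreover have "card (\<psi> ` K1) * card K0 \<le> card (\<psi> ` K1) * card (N ` K1)"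
      using card1 card2 mult_le_mono1[OF calculation(1), of "card (N ` K1)"] by (simp add: mult.commute)
    ultimately show "card K0 \<le> card (N ` K1)"
      using card1 by simp
  qed
  moreover have "minv \<beta> \<in> K0"
  proof -
    have "\<sigma> (minv \<beta>) = minv \<beta>"
      using conj_minv[OF x \<beta>] \<sigma>_\<beta> unfolding \<sigma>_def by simp
    then show ?thesis using K_minv[OF \<beta>_K \<beta>(2)] minv_nonzero[OF \<beta>] by (simp add: K0_def K1_def)
  qed
  ultimately obtain y where y: "y \<in> K1" "N y = minv \<beta>" by (metis imageE)
  \<comment> \<open>A suitable multiple \<open>z\<close> of \<open>x\<close> satisfies \<open>z ^ r = e\<close>, so \<open>e + z + \<dots> + z ^ (r - 1) = 0\<close>, although the
    powers of \<open>z\<close> belong to distinct characters of \<open>K\<close> and are therefore independent.\<close>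
  define z where "z = y * x"
  have zD: "z \<in> D" "z \<noteq> 0" unfolding z_def using K1_D[OF y(1)] x mult_mem mult_nonzero by auto
  have zr: "z ^ r = e"
    using power_yx[OF K1_D(3)[OF y(1)] r(1)] y(2) minv[OF \<beta>] by (simp add: z_def N_def \<beta>_def)
  have zt: "z * t = \<sigma> t * z" if "t \<in> K" for t
  proof -
    have "z * t = y * \<sigma> t * x" using \<sigma>x[of t] that K_sub by (auto simp: z_def mult.assoc)
    then show ?thesis using K_comm[OF K1_D(3)[OF y(1)] \<sigma>_K_mem[OF that]] by (simp add: z_def mult.assoc)
  qed
  have zkt: "z ^ i * t = (\<sigma> ^^ i) t * z ^ i" if "t \<in> K" for t i
  proof (induction i)
    case (Suc i)
    have "z ^ Suc i * t = z * (\<sigma> ^^ i) t * z ^ i" by (simp add: mult.assoc Suc)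
    then show ?case using zt[OF \<sigma>k_K[OF that]] by (simp add: mult.assoc)
  qed simp
  \<comment> \<open>These are the powers of \<open>z\<close> with \<open>e\<close> in place of
    \<open>z ^ 0\<close>, so that all of them lie in \<open>D\<close>.\<close>
  define h where "h i = (if i = 0 then e else z ^ i)" for i
  have h_mem: "h i \<in> D" for i unfolding h_def using unit_mem power_mem zD by auto
  have h_t: "h i * t = (\<sigma> ^^ i) t * h i" if "t \<in> K" for t i
    using zkt[OF that, of i] that by (auto simp: h_def K.unit_left K.unit_right)
  have z_h: "z * h i = h (Suc i)" for i using zD by (auto simp: h_def unit_right)
  define s where "s = (\<Sum>i<r. h i)"
  have "z * s = s"
  proof -
    have "z * s = (\<Sum>i<r. h (Suc i))" unfolding s_def sum_distrib_left z_h ..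
    moreover have "(\<Sum>i<r. h (Suc i)) + h 0 = s + h r"
      using sum.lessThan_Suc_shift[of h r] by (simp add: s_def algebra_simps)
    moreover have "h r = h 0" using zr r by (simp add: h_def)
    ultimately show ?thesis by simp
  qed
  moreover have sD: "s \<in> D" unfolding s_def by (intro sum_mem h_mem)
  moreover have "z \<noteq> e"
  proof
    assume "z = e"
    then have "\<sigma> a = a" using zt[OF a_K] a \<sigma>_mem[OF a] by (simp add: unit_left unit_right)
    then show False using \<sigma>_a xa by simp
  qed
  ultimately have s0: "s = 0"
    using right_cancel[of s z e] zD unit_mem by (auto simp: unit_left)
  \<comment> \<open>Multiply \<open>s = 0\<close> on the right by \<open>a ^ k\<close> and move this
    power to the left past each \<open>h i\<close>, where it becomes \<open>l i ^ k\<close>.\<close>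
  have "(\<Sum>i<r. l i ^ k * h i) = 0" for k
  proof (cases "k = 0")
    case True
    then show ?thesis using s0 by (simp add: s_def)
  next
    case False
    have ak: "a ^ k \<in> K" using False K.power_mem a_K by auto
    have "(\<sigma> ^^ i) (a ^ k) = l i ^ k" for i
    proof (induction i)
      case (Suc i)
      then show ?case using conj_power[OF x l_mem[of i], of k] \<sigma>_l[of i] False
        unfolding \<sigma>_def by simp
    qed (simp add: l_0)
    then have "s * a ^ k = (\<Sum>i<r. l i ^ k * h i)"
      unfolding s_def sum_distrib_right using h_t[OF ak] by simp
    then show ?thesis using s0 by simp
  qed
  then have "\<forall>i\<in>{..<r}. h i = 0"
    using l_mem l_comm l_inj h_mem by (intro vandermonde[where l = l]) auto
  then have "h 0 = 0" using r(1) by blast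
  then show False using unit_nonzero by (simp add: h_def)
qed

end

section \<open>The norm of a centrally finite division ring\<close>

text \<open>Determinants need entries from a type of class \<open>comm_ring_1\<close>. The center of a division ring is only a
  set, but it embeds into the center of the surrounding ring type, which is such a type.\<close>

typedef (overloaded) 'r center = "{z :: 'r::ring_1. \<forall>x. z * x = x * z}"
  by (rule exI[of _ 0]) simp

setup_lifting type_definition_center

instantiation center :: (ring_1) comm_ring_1
begin

lift_definition zero_center :: "'a center" is 0 by simp
lift_definition one_center :: "'a center" is 1 by simp
lift_definition plus_center :: "'a center \<Rightarrow> 'a center \<Rightarrow> 'a center" is "(+)"
  by (metis distrib_left distrib_right)
lift_definition minus_center :: "'a center \<Rightarrow> 'a center \<Rightarrow> 'a center" is "(-)"
  by (metis left_diff_distrib right_diff_distrib)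
lift_definition uminus_center :: "'a center \<Rightarrow> 'a center" is uminus
  by (metis mult_minus_left mult_minus_right)
lift_definition times_center :: "'a center \<Rightarrow> 'a center \<Rightarrow> 'a center" is "(*)"
  by (metis mult.assoc)

instance
  by (standard; transfer)
    (erule spec | rule mult.assoc mult_1_left add.assoc add.commute add_0_left left_minus
        diff_conv_add_uminus distrib_right zero_neq_one)+

end

lemma Rep_center_sum: "Rep_center (sum f I) = (\<Sum>i\<in>I. Rep_center (f i))"
  by (induction I rule: infinite_finite_induct) (auto simp: zero_center.rep_eq plus_center.rep_eq)

lemma Rep_center_power: "Rep_center (x ^ n) = Rep_center x ^ n"
  by (induction n) (auto simp: one_center.rep_eq times_center.rep_eq)

context division_subset
begin

abbreviation F :: "'r set" where "F \<equiv> cent D"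

definition spans :: "'r set \<Rightarrow> bool"
  where "spans B \<longleftrightarrow> finite B \<and> B \<subseteq> D \<and>
    (\<forall>x\<in>D. \<exists>c. (\<forall>b\<in>B. c b \<in> F) \<and> x = (\<Sum>b\<in>B. c b * b))"

lemma F_rng: "rng_subset F e"
  by (rule cent_rng_subset) simp

lemma F_D: "c \<in> F \<Longrightarrow> c \<in> D"
  by (simp add: cent_def)

lemma F_minv: "c \<in> F \<Longrightarrow> c \<noteq> 0 \<Longrightarrow> minv c \<in> F"
  by (rule cent_minv) auto

lemma F_commute: "c \<in> F \<Longrightarrow> x \<in> D \<Longrightarrow> c * x = x * c"
  by (simp add: cent_def)

lemma spans_remove:
  assumes B: "spans B" and c: "\<And>b. b \<in> B \<Longrightarrow> c b \<in> F" and 0: "(\<Sum>b\<in>B. c b * b) = 0"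
    and b0: "b0 \<in> B" "c b0 \<noteq> 0"
  shows "spans (B - {b0})"
proof -
  interpret F: rng_subset F e by (rule F_rng)
  have fin: "finite B" and BD: "B \<subseteq> D" using B by (auto simp: spans_def)
  define k where "k b = - minv (c b0) * c b" for b
  have k: "k b \<in> F" if "b \<in> B" for b
    unfolding k_def using F_minv[OF c[OF b0(1)] b0(2)] c[OF that] by (intro F.mult_mem F.uminus_mem)
  have b0_eq: "b0 = (\<Sum>b\<in>B - {b0}. k b * b)"
  proof -
    have "c b0 * b0 = - (\<Sum>b\<in>B - {b0}. c b * b)"
      using 0 sum.remove[OF fin b0(1), of "\<lambda>b. c b * b"] by (simp add: add_eq_0_iff)
    then have "minv (c b0) * c b0 * b0 = (\<Sum>b\<in>B - {b0}. k b * b)"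
      by (simp add: k_def mult.assoc sum_negf flip: sum_distrib_left)
    then show ?thesis using minv[OF F_D[OF c[OF b0(1)]] b0(2)] b0 BD by (auto simp: unit_left)
  qed
  have "\<exists>d. (\<forall>b\<in>B - {b0}. d b \<in> F) \<and> x = (\<Sum>b\<in>B - {b0}. d b * b)" if "x \<in> D" for x
  proof -
    obtain d where d: "\<And>b. b \<in> B \<Longrightarrow> d b \<in> F" "x = (\<Sum>b\<in>B. d b * b)"
      using B \<open>x \<in> D\<close> unfolding spans_def by metis
    have "x = d b0 * b0 + (\<Sum>b\<in>B - {b0}. d b * b)"
      using d(2) sum.remove[OF fin b0(1), of "\<lambda>b. d b * b"] by simp
    also have "d b0 * b0 = (\<Sum>b\<in>B - {b0}. d b0 * k b * b)"
      by (subst b0_eq) (simp add: sum_distrib_left mult.assoc)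
    finally have "x = (\<Sum>b\<in>B - {b0}. (d b0 * k b + d b) * b)"
      by (simp add: algebra_simps sum.distrib)
    moreover have "d b0 * k b + d b \<in> F" if "b \<in> B" for b
      using d(1) b0 k that by (intro F.add_mem F.mult_mem) auto
    ultimately show ?thesis by (intro exI[of _ "\<lambda>b. d b0 * k b + d b"]) simp
  qed
  then show ?thesis using fin BD by (auto simp: spans_def)
qed

text \<open>A spanning set of least cardinality is independent, since a nontrivial relation would
  allow \<open>spans_remove\<close> to delete an element.\<close>

lemma ex_basis:
  assumes "spans B"
  obtains C where "spans C"
    "\<And>c b. (\<And>b. b \<in> C \<Longrightarrow> c b \<in> F) \<Longrightarrow> (\<Sum>b\<in>C. c b * b) = 0 \<Longrightarrow> b \<in> C \<Longrightarrow> c b = 0"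
proof -
  obtain C where C: "spans C" "\<And>C'. spans C' \<Longrightarrow> card C \<le> card C'"
    using ex_has_least_nat[of spans B card] assms by blast
  have "c b = 0" if c: "\<And>b. b \<in> C \<Longrightarrow> c b \<in> F" "(\<Sum>b\<in>C. c b * b) = 0" "b \<in> C" for c b
  proof (rule ccontr)
    assume "c b \<noteq> 0"
    then have "card C \<le> card (C - {b})" using C(2) spans_remove[OF C(1)] c by blast
    then show False using c(3) C(1) card_Diff1_less[of C b] by (auto simp: spans_def)
  qed
  then show thesis using that C(1) by blast
qed

text \<open>The regular norm, the determinant of left multiplication, is multiplicative with
  commutative values. It therefore sends a commutator to the norm of \<open>e\<close>, whereas it
  sends a central \<open>c\<close> to \<open>c ^ n\<close>; so \<open>(x ^ m) ^ n = e\<close>. The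
  assumption \<open>central\<close> lets elements of \<open>F\<close> be regarded as elements of the
  type \<open>center\<close>.\<close>

theorem commutator_power_central:
  assumes central: "\<And>z w. z \<in> F \<Longrightarrow> z * w = w * z"
    and B: "spans B"
    and uv: "u \<in> D" "u \<noteq> 0" "v \<in> D" "v \<noteq> 0"
    and x: "x = u * v * minv u * minv v" and m: "0 < m" and xm: "x ^ m \<in> F"
  shows "\<exists>k>0. x ^ k = e"
proof -
  interpret F: rng_subset F e by (rule F_rng)
  obtain C where C: "spans C"
    "\<And>c b. (\<And>b. b \<in> C \<Longrightarrow> c b \<in> F) \<Longrightarrow> (\<Sum>b\<in>C. c b * b) = 0 \<Longrightarrow> b \<in> C \<Longrightarrow> c b = 0"
    using ex_basis[OF B] by blast
  define n where "n = card C"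
  obtain g where g: "bij_betw g {..<n} C"
    using ex_bij_betw_nat_finite[of C] C(1) by (auto simp: spans_def n_def lessThan_atLeast0)
  have gD: "g i \<in> D" if "i < n" for i
    using g C(1) that by (auto simp: spans_def bij_betw_def)
  have "\<exists>c. (\<forall>i<n. c i \<in> F) \<and> x = (\<Sum>i<n. c i * g i)" if "x \<in> D" for x
  proof -
    obtain c where c: "\<forall>b\<in>C. c b \<in> F" "x = (\<Sum>b\<in>C. c b * b)"
      using C(1) \<open>x \<in> D\<close> by (auto simp: spans_def)
    have "x = (\<Sum>i<n. c (g i) * g i)"
      unfolding c(2) using sum.reindex_bij_betw[OF g, of "\<lambda>b. c b * b"] by simp
    moreover have "\<forall>i<n. c (g i) \<in> F" using c(1) g by (auto simp: bij_betw_def)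
    ultimately show ?thesis by (intro exI[of _ "\<lambda>i. c (g i)"]) simp
  qed
  then obtain co where co: "\<And>x i. x \<in> D \<Longrightarrow> i < n \<Longrightarrow> co x i \<in> F"
    "\<And>x. x \<in> D \<Longrightarrow> x = (\<Sum>i<n. co x i * g i)"
    by metis
  have unique: "c i = co x i"
    if c: "\<And>i. i < n \<Longrightarrow> c i \<in> F" "x = (\<Sum>i<n. c i * g i)" "x \<in> D" "i < n" for c x i
  proof -
    define d where "d b = (let i = inv_into {..<n} g b in c i - co x i)" for b
    have d: "d (g i) = c i - co x i" if "i < n" for i
      unfolding d_def using g that by (simp add: bij_betw_inv_into_left)
    have "(\<Sum>b\<in>C. d b * b) = (\<Sum>i<n. (c i - co x i) * g i)"
      using sum.reindex_bij_betw[OF g, of "\<lambda>b. d b * b"] d by simp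
    also have "\<dots> = 0"
      using c(2) co(2)[OF c(3)] by (simp add: left_diff_distrib sum_subtractf)
    finally have 0: "(\<Sum>b\<in>C. d b * b) = 0" .
    have img: "C = g ` {..<n}" using g by (simp add: bij_betw_def)
    have "d (g i) = 0"
    proof (rule C(2)[OF _ 0])
      fix b assume "b \<in> C"
      then obtain k where k: "k < n" "b = g k" using img by auto
      show "d b \<in> F" unfolding k(2) d[OF k(1)] using c(1) co(1)[OF c(3)] k(1) by (intro F.diff_mem)
    qed (use img c(4) in simp)
    then show ?thesis using d[OF c(4)] by simp
  qed
  have Rep_Abs: "Rep_center (Abs_center c) = c" if "c \<in> F" for c
    using that central by (intro Abs_center_inverse) auto
  \<comment> \<open>Column \<open>j\<close> holds the coordinates of \<open>x * g j\<close>, so this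
    is the matrix of left multiplication by \<open>x\<close>.\<close>
  define M where "M x = mat n n (\<lambda>(i, j). Abs_center (co (x * g j) i))" for x
  have M_carrier: "M x \<in> carrier_mat n n" for x by (simp add: M_def)
  have M_mult: "M (x * y) = M x * M y" if xy: "x \<in> D" "y \<in> D" for x y
  proof (rule eq_matI)
    fix i j assume "i < dim_row (M x * M y)" "j < dim_col (M x * M y)"
    then have ij: "i < n" "j < n" by (auto simp: M_def)
    have xg: "x * g k \<in> D" "y * g k \<in> D" "x * y * g k \<in> D" if "k < n" for k
      using xy gD that by (auto intro!: mult_mem)
    have "x * y * g j = x * (\<Sum>k<n. co (y * g j) k * g k)"
      using co(2)[OF xg(2)[OF ij(2)]] by (simp add: mult.assoc)
    also have "\<dots> = (\<Sum>k<n. co (y * g j) k * (x * g k))"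
      unfolding sum_distrib_left
      using F_commute[OF co(1)[OF xg(2)[OF ij(2)]] xy(1)]
      by (intro sum.cong) (auto simp: mult.assoc[symmetric])
    also have "\<dots> = (\<Sum>k<n. \<Sum>i<n. co (x * g k) i * co (y * g j) k * g i)"
    proof (rule sum.cong)
      fix k assume k: "k \<in> {..<n}"
      have "co (y * g j) k * (x * g k) = co (y * g j) k * (\<Sum>i<n. co (x * g k) i * g i)"
        using co(2)[OF xg(1)] k by auto
      also have "\<dots> = (\<Sum>i<n. co (x * g k) i * co (y * g j) k * g i)"
        unfolding sum_distrib_left using k
        by (intro sum.cong) (auto simp: mult.assoc[symmetric]
            F_commute[OF co(1)[OF xg(2)[OF ij(2)]] F_D[OF co(1)[OF xg(1)]]])
      finally show "co (y * g j) k * (x * g k) = (\<Sum>i<n. co (x * g k) i * co (y * g j) k * g i)" .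
    qed simp
    also have "\<dots> = (\<Sum>i<n. (\<Sum>k<n. co (x * g k) i * co (y * g j) k) * g i)"
      by (subst sum.swap) (simp add: sum_distrib_right)
    finally have "(\<Sum>k<n. co (x * g k) i * co (y * g j) k) = co (x * y * g j) i"
      by (intro unique[OF _ _ xg(3)[OF ij(2)] ij(1)])
        (use co(1) xg ij in \<open>auto intro!: F.sum_mem F.mult_mem\<close>)
    moreover have "Rep_center ((M x * M y) $$ (i, j)) = (\<Sum>k<n. co (x * g k) i * co (y * g j) k)"
      using ij co(1) xg
      by (simp add: M_def scalar_prod_def Rep_center_sum times_center.rep_eq Rep_Abs lessThan_atLeast0)
    moreover have "Rep_center (M (x * y) $$ (i, j)) = co (x * y * g j) i"
      using ij co(1) xg by (simp add: M_def Rep_Abs)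
    ultimately show "M (x * y) $$ (i, j) = (M x * M y) $$ (i, j)"
      by (simp flip: Rep_center_inject)
  qed (auto simp: M_def)
  have M_F: "M c = Abs_center c \<cdot>\<^sub>m 1\<^sub>m n" if c: "c \<in> F" for c
  proof (rule eq_matI)
    fix i j assume "i < dim_row (Abs_center c \<cdot>\<^sub>m 1\<^sub>m n)" "j < dim_col (Abs_center c \<cdot>\<^sub>m 1\<^sub>m n)"
    then have ij: "i < n" "j < n" by auto
    have "(if i = j then c else 0) = co (c * g j) i"
      by (rule unique[where c = "\<lambda>i. if i = j then c else 0"])
        (use c F.zero_mem ij gD F_D in \<open>auto simp: if_distrib[of "\<lambda>z. z * _"] intro!: mult_mem cong: if_cong\<close>)
    moreover have "Abs_center 0 = (0 :: 'r center)" by (simp add: zero_center_def)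
    ultimately show "M c $$ (i, j) = (Abs_center c \<cdot>\<^sub>m 1\<^sub>m n) $$ (i, j)"
      using ij by (simp add: M_def flip: \<open>(if i = j then c else 0) = co (c * g j) i\<close>)
  qed (auto simp: M_def)
  define d where "d x = det (M x)" for x
  have d_mult: "d (x * y) = d x * d y" if "x \<in> D" "y \<in> D" for x y
    unfolding d_def M_mult[OF that] by (rule det_mult[OF M_carrier M_carrier])
  have d_F: "d c = Abs_center c ^ n" if "c \<in> F" for c
    unfolding d_def M_F[OF that] by simp
  have n: "0 < n"
  proof (rule ccontr)
    assume "\<not> 0 < n"
    then show False using co(2)[OF unit_mem] unit_nonzero by simp
  qed
  \<comment> \<open>The norm of \<open>e\<close> is this idempotent, which need not be the unit of
    the type. The norm of the commutator is evaluated by regrouping it as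
    \<open>d (u * minv u) * d (v * minv v)\<close>.\<close>
  define E where "E = Abs_center e"
  have E_power: "E ^ k = E" if "0 < k" for k
    using that unit_power[OF that] by (simp add: E_def Rep_center_power Rep_Abs F.unit_mem flip: Rep_center_inject)
  have d_e: "d e = E" using d_F[OF F.unit_mem] E_power[OF n] by (simp add: E_def)
  have inv: "minv u \<in> D" "minv v \<in> D" using uv minv by auto
  have xD: "x \<in> D" unfolding x using uv inv by (intro mult_mem)
  have "d x = d u * d v * d (minv u) * d (minv v)"
    unfolding x using uv inv by (simp add: d_mult mult_mem)
  also have "\<dots> = d (u * minv u) * d (v * minv v)"
    using uv inv by (simp add: d_mult mult_ac)
  also have "\<dots> = E" using uv minv d_e E_power[of 2] by (simp add: power2_eq_square)
  finally have dx: "d x = E" .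
  have "d (x ^ k) = E" if "0 < k" for k
    using that
  proof (induction k rule: nat_induct_non_zero)
    case (Suc k)
    then show ?case
      using d_mult[OF xD power_mem[OF xD, of k]] dx E_power[of 2] by (simp add: power2_eq_square)
  qed (simp add: dx)
  then have "Abs_center (x ^ m) ^ n = E" using d_F[OF xm] m by simp
  then have "(x ^ m) ^ n = e"
    using xm by (metis E_def F.unit_mem Rep_Abs Rep_center_power)
  then show ?thesis
    using m n by (intro exI[of _ "m * n"]) (simp add: power_mult)
qed

end

section \<open>Valuation rings of the center\<close>

text \<open>\<open>polys R f n\<close> consists of the values at \<open>f\<close> of the polynomials of degree at most \<open>n\<close> over \<open>R\<close>, in
  Horner form.\<close>

primrec polys :: "'r::ring_1 set \<Rightarrow> 'r \<Rightarrow> nat \<Rightarrow> 'r set" where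
  "polys R f 0 = R"
| "polys R f (Suc n) = {r + f * x | r x. r \<in> R \<and> x \<in> polys R f n}"

lemma polys_SucI: "r \<in> R \<Longrightarrow> x \<in> polys R f n \<Longrightarrow> r + f * x \<in> polys R f (Suc n)"
  by auto

lemma polys_SucE:
  assumes "x \<in> polys R f (Suc n)"
  obtains r y where "r \<in> R" "y \<in> polys R f n" "x = r + f * y"
  using assms by auto

lemma finite_polys: "finite R \<Longrightarrow> finite (polys R f n)"
proof (induction n)
  case (Suc n)
  have "polys R f (Suc n) = (\<lambda>(r, x). r + f * x) ` (R \<times> polys R f n)" by auto
  then show ?case using Suc by simp
qed simp

lemma polys_mono_ring: "R \<subseteq> R' \<Longrightarrow> polys R f n \<subseteq> polys R' f n"
  by (induction n) auto

section \<open>Linear spans over a subring and Nakayama's lemma\<close>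

inductive_set lspan :: "'r::ring_1 set \<Rightarrow> 'r set \<Rightarrow> 'r set" for R B where
  zero: "0 \<in> lspan R B"
| step: "c \<in> R \<Longrightarrow> b \<in> B \<Longrightarrow> x \<in> lspan R B \<Longrightarrow> c * b + x \<in> lspan R B"

lemma lspan_add: "x \<in> lspan R B \<Longrightarrow> y \<in> lspan R B \<Longrightarrow> x + y \<in> lspan R B"
  by (induction rule: lspan.induct) (auto simp: add.assoc intro: lspan.step)

lemma lspan_mono: "B \<subseteq> C \<Longrightarrow> x \<in> lspan R B \<Longrightarrow> x \<in> lspan R C"
  by (erule lspan.induct) (auto intro: lspan.intros)

lemma lspan_sum:
  "finite A \<Longrightarrow> A \<subseteq> B \<Longrightarrow> (\<And>b. b \<in> A \<Longrightarrow> c b \<in> R) \<Longrightarrow> (\<Sum>b\<in>A. c b * b) \<in> lspan R B"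
  by (induction A rule: finite_induct) (auto intro: lspan.intros)

lemma lspan_closed:
  assumes "x \<in> lspan R B" "0 \<in> M" "\<And>c b. c \<in> R \<Longrightarrow> b \<in> B \<Longrightarrow> c * b \<in> M"
    and "\<And>x y. x \<in> M \<Longrightarrow> y \<in> M \<Longrightarrow> x + y \<in> M"
  shows "x \<in> M"
  using assms(1) by (induction rule: lspan.induct) (auto intro: assms(2-))

lemma lspan_insertE:
  assumes "rng_subset R e" "x \<in> lspan R (insert b B)"
  obtains c y where "c \<in> R" "y \<in> lspan R B" "x = c * b + y"
proof -
  interpret rng_subset R e by (rule assms(1))
  have "\<exists>c\<in>R. \<exists>y\<in>lspan R B. x = c * b + y"
    using assms(2)
  proof (induction rule: lspan.induct)
    case zero
    show ?case using zero_mem lspan.zero by (intro bexI[of _ 0] bexI[of _ 0]) auto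
  next
    case (step d h x)
    then obtain c y where cy: "c \<in> R" "y \<in> lspan R B" "x = c * b + y" by auto
    show ?case
    proof (cases "h = b")
      case True
      have "d * h + x = (d + c) * b + y" using True cy by (simp add: algebra_simps)
      then show ?thesis using cy step add_mem by blast
    next
      case False
      then have "d * h + y \<in> lspan R B" using cy step by (auto intro: lspan.step)
      moreover have "d * h + x = c * b + (d * h + y)" using cy by (simp add: algebra_simps)
      ultimately show ?thesis using cy by blast
    qed
  qed
  then show thesis using that by blast
qed

lemma finite_lspan:
  assumes "rng_subset R e" "finite R" "finite B"
  shows "finite (lspan R B)"
  using assms(3)
proof (induction B rule: finite_induct)
  case empty
  have "lspan R {} \<subseteq> {0}" by (auto elim: lspan.cases)
  then show ?case by (rule finite_subset) simp
next
  case (insert b B)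
  have "lspan R (insert b B) \<subseteq> (\<lambda>(c, y). c * b + y) ` (R \<times> lspan R B)"
    by (auto elim!: lspan_insertE[OF assms(1)])
  then show ?case by (rule finite_subset) (use insert assms in auto)
qed

context rng_subset
begin

lemma lspan_mem: "b \<in> B \<Longrightarrow> e * b = b \<Longrightarrow> b \<in> lspan R B"
  using lspan.step[OF unit_mem _ lspan.zero, of b B] by simp

lemma lspan_scale: "r \<in> R \<Longrightarrow> x \<in> lspan R B \<Longrightarrow> r * x \<in> lspan R B"
  by (rotate_tac, induction rule: lspan.induct)
    (auto simp: distrib_left mult.assoc[symmetric] mult_mem intro: lspan.intros)

lemma lspan_uminus: "x \<in> lspan R B \<Longrightarrow> - x \<in> lspan R B"
proof (induction rule: lspan.induct)
  case (step c b x)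
  have "- (c * b + x) = - c * b + - x" by simp
  then show ?case using step uminus_mem by (metis lspan.step)
qed (simp add: lspan.zero)

lemma lspan_mult:
  assumes comm: "\<And>r b. r \<in> R \<Longrightarrow> b \<in> B \<Longrightarrow> r * b = b * r"
    and prod: "\<And>b c. b \<in> B \<Longrightarrow> c \<in> B \<Longrightarrow> b * c \<in> lspan R B"
    and "x \<in> lspan R B" "y \<in> lspan R B"
  shows "x * y \<in> lspan R B"
  using assms(3)
proof (induction rule: lspan.induct)
  case (step c b x)
  have "b * y \<in> lspan R B"
    using assms(4)
  proof (induction rule: lspan.induct)
    case (step d h z)
    have "b * (d * h + z) = d * (b * h) + b * z"
      using comm[of d b] \<open>b \<in> B\<close> step by (simp add: distrib_left mult.assoc[symmetric])
    then show ?case using step prod \<open>b \<in> B\<close> by (auto intro: lspan_add lspan_scale)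
  qed (simp add: lspan.zero)
  then show ?case
    using step by (auto simp: distrib_right mult.assoc intro: lspan_add lspan_scale)
qed (simp add: lspan.zero)

end

text \<open>In the equation for a generator \<open>b\<close>, the total coefficient of
  \<open>b\<close> is \<open>e + s * - c\<close>, which is a unit. Solving for \<open>b\<close> and
  substituting removes it from the other equations, so induction on the number of generators
  applies. The assumption \<open>units\<close> puts \<open>s\<close> into the Jacobson radical of
  \<open>R\<close>.\<close>

lemma (in division_subset) nakayama:
  assumes R: "rng_subset R e" "R \<subseteq> F" and s: "s \<in> R"
    and units: "\<And>r. r \<in> R \<Longrightarrow> \<exists>v\<in>R. (e + s * r) * v = e"
    and N: "0 \<in> N" "\<And>x y. x \<in> N \<Longrightarrow> y \<in> N \<Longrightarrow> x + y \<in> N" "\<And>r x. r \<in> R \<Longrightarrow> x \<in> N \<Longrightarrow> r * x \<in> N"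
    and "finite B" "B \<subseteq> D" "\<And>b. b \<in> B \<Longrightarrow> \<exists>n\<in>N. \<exists>y\<in>lspan R B. b = n + s * y"
  shows "B \<subseteq> N"
  using assms(8-)
proof (induction B rule: finite_induct)
  case (insert b B)
  interpret R: rng_subset R e by (rule R(1))
  obtain n x where nx: "n \<in> N" "x \<in> lspan R (insert b B)" "b = n + s * x"
    using insert.prems(2)[of b] by auto
  obtain c y where cy: "c \<in> R" "y \<in> lspan R B" "x = c * b + y"
    using lspan_insertE[OF R(1) nx(2)] by blast
  obtain v where v: "v \<in> R" "(e + s * - c) * v = e"
    using units[OF R.uminus_mem[OF cy(1)]] by auto
  have bD: "b \<in> D" using insert.prems by simp
  have vF: "v \<in> F" "e + s * - c \<in> F"
    by (rule subsetD[OF R(2)], intro v(1) R.add_mem R.unit_mem R.mult_mem s R.uminus_mem cy(1))+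
  have "(e + s * - c) * b = n + s * y"
    using nx(3) cy(3) unit_left[OF bD] by (simp add: algebra_simps)
  then have "v * ((e + s * - c) * b) = v * n + v * s * y"
    by (simp add: distrib_left mult.assoc)
  moreover have "v * ((e + s * - c) * b) = b"
    using v(2) F_commute[OF vF(1) F_D[OF vF(2)]] unit_left[OF bD] by (simp add: mult.assoc[symmetric])
  ultimately have b: "b = v * n + v * s * y" by simp
  have B: "B \<subseteq> N"
  proof (rule insert.IH)
    fix b' assume b': "b' \<in> B"
    then obtain n' x' where nx': "n' \<in> N" "x' \<in> lspan R (insert b B)" "b' = n' + s * x'"
      using insert.prems(2)[of b'] by auto
    obtain c' y' where cy': "c' \<in> R" "y' \<in> lspan R B" "x' = c' * b + y'"
      using lspan_insertE[OF R(1) nx'(2)] by blast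
    have "b' = (n' + s * c' * v * n) + s * (c' * v * s * y + y')"
      unfolding nx'(3) cy'(3) by (subst b) (simp add: algebra_simps)
    moreover have "n' + s * c' * v * n \<in> N" "c' * v * s * y + y' \<in> lspan R B"
      using nx' nx(1) cy cy' v(1) s by (auto intro!: N(2,3) lspan_add R.lspan_scale R.mult_mem)
    ultimately show "\<exists>n\<in>N. \<exists>y\<in>lspan R B. b' = n + s * y" by blast
  qed (use insert.prems in auto)
  have "y \<in> N" using cy(2) by (rule lspan_closed) (use N B in auto)
  then have "b \<in> N" by (subst b) (use v s nx in \<open>auto intro!: N R.mult_mem\<close>)
  then show ?case using B by simp
qed simp

section \<open>Subrings of the center and their simple extensions\<close>

locale scalar_ring = division_subset D e + R: rng_subset R e
  for D :: "'r::ring_1 set" and e R +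
  assumes R_F: "R \<subseteq> F"
begin

lemma R_mem_F: "r \<in> R \<Longrightarrow> r \<in> F"
  using R_F by auto

lemma polys_F: "f \<in> F \<Longrightarrow> polys R f n \<subseteq> F"
proof (induction n)
  case (Suc n)
  interpret F: rng_subset F e by (rule F_rng)
  show ?case using Suc R_F by (auto intro!: F.add_mem F.mult_mem)
qed (simp add: R_F)

lemma polys_Suc: "polys R f n \<subseteq> polys R f (Suc n)"
proof (induction n)
  case 0
  show ?case using R.zero_mem by force
next
  case (Suc n)
  then show ?case by (auto simp del: polys.simps(2) elim!: polys_SucE intro!: polys_SucI)
qed

lemma polys_mono: "m \<le> n \<Longrightarrow> x \<in> polys R f m \<Longrightarrow> x \<in> polys R f n"
  using lift_Suc_mono_le[of "polys R f", OF polys_Suc] by blast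

lemma polys_R: "r \<in> R \<Longrightarrow> r \<in> polys R f n"
  using polys_mono[of 0 n r f] by simp

lemma polys_add: "x \<in> polys R f n \<Longrightarrow> y \<in> polys R f n \<Longrightarrow> x + y \<in> polys R f n"
proof (induction n arbitrary: x y)
  case (Suc n)
  then obtain r x' q y' where "r \<in> R" "x' \<in> polys R f n" "x = r + f * x'"
    "q \<in> R" "y' \<in> polys R f n" "y = q + f * y'" by auto
  moreover have "x + y = (r + q) + f * (x' + y')" using calculation by (simp add: algebra_simps)
  ultimately show ?case using Suc.IH R.add_mem polys_SucI by metis
qed (simp add: R.add_mem)

lemma polys_shift: "x \<in> polys R f n \<Longrightarrow> f * x \<in> polys R f (Suc n)"
  using R.zero_mem by force

lemma polys_shift_power: "x \<in> polys R f n \<Longrightarrow> f ^ k * x \<in> polys R f (k + n)"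
  by (induction k) (auto simp: mult.assoc intro: polys_shift simp del: polys.simps)

lemma polys_scale: "f \<in> F \<Longrightarrow> r \<in> R \<Longrightarrow> x \<in> polys R f n \<Longrightarrow> r * x \<in> polys R f n"
proof (induction n arbitrary: x)
  case (Suc n)
  then obtain q x' where x: "q \<in> R" "x' \<in> polys R f n" "x = q + f * x'" by auto
  have "r * x = r * q + f * (r * x')"
    using F_commute[OF R_mem_F F_D, OF Suc.prems(2,1)] by (simp add: x(3) distrib_left mult.assoc[symmetric])
  then show ?case using Suc.IH[OF Suc.prems(1,2) x(2)] R.mult_mem[OF Suc.prems(2) x(1)] polys_SucI by metis
qed (simp add: R.mult_mem)

lemma polys_mult: "f \<in> F \<Longrightarrow> x \<in> polys R f m \<Longrightarrow> y \<in> polys R f n \<Longrightarrow> x * y \<in> polys R f (m + n)"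
proof (induction m arbitrary: x)
  case (Suc m)
  then obtain r x' where x: "r \<in> R" "x' \<in> polys R f m" "x = r + f * x'" by auto
  have "r * y \<in> polys R f (Suc m + n)"
    using polys_scale[OF Suc.prems(1) x(1) Suc.prems(3)] by (rule polys_mono[rotated]) simp
  moreover have "f * (x' * y) \<in> polys R f (Suc m + n)"
    using polys_shift[OF Suc.IH[OF Suc.prems(1) x(2) Suc.prems(3)]] by simp
  ultimately show ?case unfolding x(3) distrib_right mult.assoc by (rule polys_add)
qed (simp add: polys_scale)

lemma polys_uminus: "f \<in> F \<Longrightarrow> x \<in> polys R f n \<Longrightarrow> - x \<in> polys R f n"
proof -
  assume f: "f \<in> F" and x: "x \<in> polys R f n"
  have "- e * x \<in> polys R f n" by (intro polys_scale f x R.uminus_mem R.unit_mem)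
  then show ?thesis using polys_F[OF f] x F_D unit_left by fastforce
qed

text \<open>This is the ring \<open>R[f]\<close>, as an increasing union over the degree.\<close>

definition adj :: "'r \<Rightarrow> 'r set"
  where "adj f = (\<Union>n. polys R f n)"

lemma adj_rng: assumes f: "f \<in> F" shows "rng_subset (adj f) e"
proof
  fix x y assume "x \<in> adj f" "y \<in> adj f"
  then obtain m n where mn: "x \<in> polys R f m" "y \<in> polys R f n" by (auto simp: adj_def)
  then have "x \<in> polys R f (m + n)" "y \<in> polys R f (m + n)"
    using polys_mono[of m "m + n" x f] polys_mono[of n "m + n" y f] by auto
  then show "x + y \<in> adj f" unfolding adj_def using polys_add by blast
  show "x * y \<in> adj f" unfolding adj_def using polys_mult[OF f mn] by blast
next
  fix x assume "x \<in> adj f"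
  then obtain n where n: "x \<in> polys R f n" by (auto simp: adj_def)
  then show "- x \<in> adj f" unfolding adj_def using polys_uminus[OF f n] by blast
  have "x \<in> D" using n polys_F[OF f] F_D by blast
  then show "e * x = x" "x * e = x" by (auto simp: unit_left unit_right)
next
  show "e \<in> adj f" unfolding adj_def using polys_R[OF R.unit_mem] by blast
qed

lemma adj_F: "f \<in> F \<Longrightarrow> adj f \<subseteq> F"
  using polys_F by (auto simp: adj_def)

lemma adj_R: "R \<subseteq> adj f"
  unfolding adj_def using polys_R by blast

lemma adj_self: "f \<in> F \<Longrightarrow> f \<in> adj f"
proof -
  assume f: "f \<in> F"
  have "f * e \<in> polys R f (Suc 0)" by (rule polys_shift) (simp add: R.unit_mem)
  then show ?thesis using f F_D[OF f] unfolding adj_def by (metis UN_I UNIV_I unit_right)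
qed

text \<open>Horner form exposes the constant term; here the leading term is split off, which is the
  one that \<open>valuation_step\<close> removes.\<close>

lemma polys_top:
  assumes f: "f \<in> F" and "x \<in> polys R f (Suc n)"
  shows "\<exists>y\<in>polys R f n. \<exists>r\<in>R. x = y + r * f ^ Suc n"
  using assms(2)
proof (induction n arbitrary: x)
  case 0
  then obtain r y where "r \<in> R" "y \<in> R" "x = r + f * y" by auto
  then show ?case using F_commute[OF R_mem_F F_D[OF f]] by auto
next
  case (Suc n)
  then obtain r0 x' where x: "r0 \<in> R" "x' \<in> polys R f (Suc n)" "x = r0 + f * x'" by auto
  obtain y r where y: "y \<in> polys R f n" "r \<in> R" "x' = y + r * f ^ Suc n" using Suc.IH[OF x(2)] by auto
  have "f * (r * f ^ Suc n) = (f * r) * f ^ Suc n" by (simp only: mult.assoc)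
  also have "f * r = r * f" using F_commute[OF R_mem_F F_D, OF y(2) f] by simp
  finally have "f * (r * f ^ Suc n) = r * f ^ Suc (Suc n)" by (simp only: mult.assoc power_Suc)
  then have "x = (r0 + f * y) + r * f ^ Suc (Suc n)"
    unfolding x(3) y(3) by (simp only: distrib_left add.assoc)
  moreover have "r0 + f * y \<in> polys R f (Suc n)" using x y by auto
  ultimately show ?case using y(2) by blast
qed

text \<open>Multiplication by \<open>f ^ k\<close> reverses the coefficients of a polynomial of
  degree at most \<open>k\<close> in the inverse of \<open>f\<close>.\<close>

lemma polys_reverse:
  assumes f: "f \<in> F" and g: "g \<in> F" and fg: "f * g = e" and "y \<in> polys R g k"
  shows "f ^ k * y \<in> polys R f k"
  using assms(4)
proof (induction k arbitrary: y)
  case (Suc k)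
  then obtain r y' where y: "r \<in> R" "y' \<in> polys R g k" "y = r + g * y'" by auto
  have "y' \<in> D" using y(2) polys_F[OF g] F_D by blast
  then have "f ^ Suc k * y = f ^ Suc k * r + f ^ k * y'"
    using fg unfolding y(3) power_Suc2 by (simp add: distrib_left mult.assoc) (simp add: unit_left flip: mult.assoc)
  moreover have "f ^ Suc k * r \<in> polys R f (Suc k)"
    using polys_shift_power[of r f 0 "Suc k"] y(1) by simp
  moreover have "f ^ k * y' \<in> polys R f (Suc k)"
    using Suc.IH[OF y(2)] polys_Suc by blast
  ultimately show ?case using polys_add by metis
qed simp

text \<open>Write \<open>t = q + g * y\<close>. Then \<open>s * (g * y) = e - s * q\<close> is a
  unit of \<open>R\<close> with inverse \<open>v\<close>, so \<open>e = v * s * (g * y)\<close>.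
  Multiplication by \<open>f ^ m\<close> expresses \<open>f ^ m\<close> as a polynomial of lower
  degree in \<open>f\<close>, and this eliminates the leading term of the representation of
  \<open>t\<close> in \<open>f\<close>.\<close>

lemma valuation_step:
  assumes s: "s \<in> R" and t: "s * t = e" "t \<notin> R"
    and units: "\<And>r. r \<in> R \<Longrightarrow> \<exists>v\<in>R. (e + s * r) * v = e"
    and f: "f \<in> F" and g: "g \<in> F" and fg: "f * g = e"
    and tf: "t \<in> polys R f n" and tg: "t \<in> polys R g m" and mn: "m \<le> n"
  shows "0 < n \<and> t \<in> polys R f (n - 1)"
proof -
  obtain m' n' where mn': "m = Suc m'" "n = Suc n'" "m' \<le> n'"
    using t(2) tg mn by (cases m; cases n) auto
  obtain q y where y: "q \<in> R" "y \<in> polys R g m'" "t = q + g * y"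
    using tg mn' by auto
  obtain v where v: "v \<in> R" "(e + s * - q) * v = e"
    using units[OF R.uminus_mem[OF y(1)]] by auto
  have D: "v \<in> D" "s \<in> D" "g \<in> D" "y \<in> D" "f \<in> D" "q \<in> D"
    using v s g y f polys_F[OF g] R_mem_F F_D by blast+
  have "e + s * - q = s * (g * y)" using t(1) y(3) by (simp add: algebra_simps)
  then have e: "e = v * s * (g * y)"
    using v F_commute[OF R_mem_F[OF v(1)], of "s * (g * y)"] D by (simp add: mult_mem mult.assoc)
  define w where "w = v * s * (f ^ m' * y)"
  have w: "w \<in> polys R f m'"
    unfolding w_def by (rule polys_scale[OF f R.mult_mem[OF v(1) s] polys_reverse[OF f g fg y(2)]])
  have "f ^ m = f ^ m * e" using unit_right[OF power_mem[OF D(5), of m]] mn' by simp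
  also have "\<dots> = f ^ m' * (f * (v * s)) * (g * y)"
    by (subst e) (simp only: mn'(1) power_Suc2 mult.assoc)
  also have "f * (v * s) = (v * s) * f"
    using F_commute[OF f, of "v * s"] D by (simp add: mult_mem)
  also have "f ^ m' * (v * s * f) * (g * y) = f ^ m' * (v * s) * ((f * g) * y)"
    by (simp add: mult.assoc)
  also have "\<dots> = f ^ m' * (v * s) * y"
    using fg D by (simp add: unit_left)
  also have "f ^ m' * (v * s) = (v * s) * f ^ m'"
    using F_commute[OF R_mem_F[OF R.mult_mem[OF v(1) s]], of f] D by (simp add: power_commuting_commutes)
  finally have fm: "f ^ m = w" by (simp add: w_def mult.assoc)
  obtain x r where x: "x \<in> polys R f n'" "r \<in> R" "t = x + r * f ^ n"
    using polys_top[OF f, of t n'] tf mn' by auto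
  have "f ^ n = f ^ (n' - m') * w"
    using mn' by (simp flip: fm power_add del: power_Suc)
  moreover have "r * (f ^ (n' - m') * w) \<in> polys R f n'"
    using polys_shift_power[OF w, of "n' - m'"] mn'(3) by (intro polys_scale[OF f x(2)]) simp
  ultimately have "t \<in> polys R f n'" using x polys_add by simp
  then show ?thesis using mn' by simp
qed

text \<open>\<open>valuation_step\<close> lowers the larger of the two degrees. As \<open>f\<close>
  and \<open>g\<close> play symmetric roles, induction on the sum of the degrees rules out such a
  pair of representations.\<close>

lemma valuation_contradiction:
  assumes s: "s \<in> R" and t: "s * t = e" "t \<notin> R"
    and units: "\<And>r. r \<in> R \<Longrightarrow> \<exists>v\<in>R. (e + s * r) * v = e"
    and "f \<in> F" "g \<in> F" "f * g = e" "t \<in> polys R f n" "t \<in> polys R g m"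
  shows False
  using assms(5-)
proof (induction "n + m" arbitrary: f g n m rule: less_induct)
  case less
  have gf: "g * f = e" using less.prems F_commute F_D by metis
  show False
  proof (cases "m \<le> n")
    case True
    then show False
      using valuation_step[OF s t units less.prems True] less.hyps[of "n - 1" m f g] less.prems by simp
  next
    case False
    then show False
      using valuation_step[OF s t units less.prems(2,1) gf less.prems(5,4)] less.hyps[of n "m - 1" f g] less.prems
      by simp
  qed
qed

end

section \<open>Valuation rings as maximal subrings\<close>

context division_subset
begin

text \<open>Zorn's lemma gives a subring \<open>R\<close> of \<open>F\<close> that is maximal among
  those containing \<open>A\<close> but not the inverse of \<open>s\<close>. Adjoining any
  \<open>f\<close> outside \<open>R\<close> must produce that inverse, and if this happened for both
  \<open>f\<close> and \<open>minv f\<close>, \<open>valuation_contradiction\<close> would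
  apply.\<close>

lemma ex_valuation_ring:
  assumes A: "rng_subset A e" "A \<subseteq> F" and s: "s \<in> A" "s \<noteq> 0" and t: "minv s \<notin> A"
  obtains R where "rng_subset R e" "R \<subseteq> F" "A \<subseteq> R" "minv s \<notin> R"
    "\<And>r. r \<in> R \<Longrightarrow> \<exists>v\<in>R. (e + s * r) * v = e"
    "\<And>f. f \<in> F \<Longrightarrow> f \<noteq> 0 \<Longrightarrow> f \<in> R \<or> minv f \<in> R"
proof -
  define \<A> where "\<A> = {R. rng_subset R e \<and> R \<subseteq> F \<and> A \<subseteq> R \<and> minv s \<notin> R}"
  have "\<exists>M\<in>\<A>. \<forall>X\<in>\<A>. M \<subseteq> X \<longrightarrow> X = M"
  proof (rule subset_Zorn_nonempty)
    show "\<A> \<noteq> {}" using A t by (auto simp: \<A>_def)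
  next
    fix \<C> assume ne: "\<C> \<noteq> {}" and ch: "subset.chain \<A> \<C>"
    have C: "R \<in> \<C> \<Longrightarrow> rng_subset R e \<and> R \<subseteq> F \<and> A \<subseteq> R \<and> minv s \<notin> R" for R
      using ch by (auto simp: subset.chain_def \<A>_def)
    have "rng_subset (\<Union>\<C>) e"
    proof
      fix x y assume "x \<in> \<Union>\<C>" "y \<in> \<Union>\<C>"
      then obtain X Y where "X \<in> \<C>" "Y \<in> \<C>" "x \<in> X" "y \<in> Y" by auto
      then obtain Z where "Z \<in> \<C>" "x \<in> Z" "y \<in> Z"
        using ch by (auto simp: subset.chain_def) (metis psubsetE subsetD)
      then show "x + y \<in> \<Union>\<C>" "x * y \<in> \<Union>\<C>"
        using C[of Z] rng_subset.add_mem rng_subset.mult_mem by blast+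
    next
      fix x assume "x \<in> \<Union>\<C>"
      then obtain X where "X \<in> \<C>" "x \<in> X" by auto
      then show "- x \<in> \<Union>\<C>" "e * x = x" "x * e = x"
        using C[of X] rng_subset.uminus_mem rng_subset.unit_left rng_subset.unit_right by blast+
    next
      show "e \<in> \<Union>\<C>" using ne C rng_subset.unit_mem by blast
    qed
    then show "\<Union>\<C> \<in> \<A>" using C ne unfolding \<A>_def by blast
  qed
  then obtain R where R: "R \<in> \<A>" and max: "\<And>X. X \<in> \<A> \<Longrightarrow> R \<subseteq> X \<Longrightarrow> X = R" by blast
  have R': "rng_subset R e" "R \<subseteq> F" "A \<subseteq> R" "minv s \<notin> R" using R by (auto simp: \<A>_def)
  interpret R: rng_subset R e by (rule R'(1))
  interpret scalar_ring D e R by unfold_locales (rule R'(2))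
  define t where "t = minv s"
  have sR: "s \<in> R" using s R' by auto
  have sF: "s \<in> F" using sR R' by auto
  have st: "s * t = e" "t \<in> D" unfolding t_def using minv F_D[OF sF] s(2) by auto
  have tR: "t \<notin> R" using R' by (simp add: t_def)
  have ex: "\<exists>n. t \<in> polys R f n" if "f \<in> F" "f \<notin> R" for f
  proof (rule ccontr)
    assume "\<not> ?thesis"
    then have "adj f \<in> \<A>"
      using adj_rng[OF that(1)] adj_F[OF that(1)] adj_R[of f] R'(3) by (auto simp: \<A>_def adj_def t_def)
    then have "adj f = R" by (rule max) (rule adj_R)
    then show False using adj_self[OF that(1)] that by simp
  qed
  have units: "\<exists>v\<in>R. (e + s * r) * v = e" if r: "r \<in> R" for r
  proof -
    define w where "w = e + s * r"
    have wR: "w \<in> R" unfolding w_def by (intro R.add_mem R.mult_mem R.unit_mem sR r)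
    have wF: "w \<in> F" using wR R' by auto
    have w0: "w \<noteq> 0"
    proof
      assume "w = 0"
      then have "s * - r = e" by (simp add: w_def add_eq_0_iff)
      then have "- r = t"
        using minv_unique[OF F_D[OF sF], of "- r"] R.uminus_mem[OF r] R_mem_F F_D by (auto simp: t_def)
      then show False using tR R.uminus_mem[OF r] by simp
    qed
    define v where "v = minv w"
    have v: "v \<in> F" "w * v = e" unfolding v_def using F_minv[OF wF w0] minv[OF F_D[OF wF] w0] by auto
    \<comment> \<open>If \<open>v\<close> were outside \<open>R\<close>, then \<open>t\<close> would
      be a polynomial in \<open>v\<close>, and multiplication by a power \<open>w ^ n\<close> would
      clear denominators, so \<open>w ^ n * t\<close> would lie in \<open>R\<close>. Since
      \<open>w = e + s * r\<close> and \<open>s * t = e\<close>, this product differs from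
      \<open>t\<close> by an element of \<open>R\<close>, which would force \<open>t\<close> into
      \<open>R\<close>.\<close>
    have "v \<in> R"
    proof (rule ccontr)
      assume "v \<notin> R"
      then obtain n where n: "t \<in> polys R v n" using ex v by blast
      have "w ^ n * x \<in> R" if "x \<in> polys R v n" for x
        using that
      proof (induction n arbitrary: x)
        case (Suc n)
        then obtain q y where y: "q \<in> R" "y \<in> polys R v n" "x = q + v * y" by auto
        have "y \<in> D" using y(2) polys_F[OF v(1)] F_D by blast
        then have "w ^ n * w * (v * y) = w ^ n * y"
          using v(2) by (simp add: mult.assoc) (simp add: unit_left flip: mult.assoc)
        then have "w ^ Suc n * x = q * w ^ Suc n + w ^ n * y"
          unfolding y(3) power_Suc2 distrib_left
          using power_commuting_commutes[of w q "Suc n"] F_commute[OF R_mem_F[OF y(1)] F_D[OF wF]]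
          by (simp add: power_commutes)
        then show ?case using R.add_mem[OF R.mult_power_mem[OF y(1) wR, of "Suc n"] Suc.IH[OF y(2)]] by simp
      qed simp
      then have "w ^ n * t \<in> R" using n by blast
      moreover have "\<exists>q\<in>R. w ^ k * t = t + q" for k
      proof (induction k)
        case (Suc k)
        then obtain q where q: "q \<in> R" "w ^ k * t = t + q" by auto
        have "w ^ Suc k * t = w * (t + q)" using q by (simp add: mult.assoc)
        also have "\<dots> = t + (s * t) * r + w * q"
          using F_commute[OF R_mem_F[OF r] st(2)] st(2)
          by (simp add: w_def algebra_simps unit_left)
        also have "\<dots> = t + (r + w * q)"
          using st r R_mem_F F_D by (simp add: unit_left)
        finally show ?case using R.add_mem R.mult_mem r q wR by blast
      qed (use R.zero_mem in auto)
      ultimately obtain q where "q \<in> R" "t + q \<in> R" by metis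
      then have "t \<in> R" using R.diff_mem[of "t + q" q] by simp
      then show False using tR by simp
    qed
    then show ?thesis using v by (auto simp: w_def)
  qed
  have "f \<in> R \<or> minv f \<in> R" if f: "f \<in> F" "f \<noteq> 0" for f
  proof (rule ccontr)
    assume "\<not> ?thesis"
    then obtain n m where "t \<in> polys R f n" "t \<in> polys R (minv f) m"
      using ex f F_minv by blast
    then show False
      using valuation_contradiction[OF sR st(1) tR units f(1) F_minv[OF f]] minv[OF F_D[OF f(1)] f(2)]
      by blast
  qed
  then show thesis using that R' units by blast
qed

text \<open>If \<open>c\<close> is outside \<open>R\<close>, then \<open>minv c\<close> is in
  \<open>R\<close> by the valuation property, and multiplying the previous denominator by
  \<open>minv c\<close> handles \<open>c\<close> too.\<close>

lemma common_denominator: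
  assumes R: "rng_subset R e" "R \<subseteq> F"
    and val: "\<And>f. f \<in> F \<Longrightarrow> f \<noteq> 0 \<Longrightarrow> f \<in> R \<or> minv f \<in> R"
    and "finite C" "C \<subseteq> F"
  shows "\<exists>r\<in>R. r \<noteq> 0 \<and> (\<forall>c\<in>C. r * c \<in> R)"
  using assms(4,5)
proof (induction C rule: finite_induct)
  case empty
  show ?case using rng_subset.unit_mem[OF R(1)] unit_nonzero by auto
next
  case (insert c C)
  interpret R: rng_subset R e by (rule R(1))
  obtain r where r: "r \<in> R" "r \<noteq> 0" "\<forall>c\<in>C. r * c \<in> R" using insert by auto
  show ?case
  proof (cases "c \<in> R")
    case True
    then show ?thesis using r R.mult_mem by auto
  next
    case False
    then have c: "c \<in> F" "c \<noteq> 0" "minv c \<in> R" using insert.prems val R.zero_mem by auto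
    have D: "r \<in> D" "c \<in> D" "minv c \<in> D" using r c R F_D by auto
    have "minv c * r \<in> R" "minv c * r \<noteq> 0"
      using r c D R.mult_mem mult_nonzero minv_nonzero by auto
    moreover have "minv c * r * c = minv c * c * r"
      using F_commute[OF c(1) D(1)] by (simp add: mult.assoc)
    then have "minv c * r * c = r" using D c minv by (simp add: unit_left)
    moreover have "minv c * r * d \<in> R" if "d \<in> C" for d
      using r that c R.mult_mem by (simp add: mult.assoc)
    ultimately show ?thesis using r(1) by (intro bexI[of _ "minv c * r"]) auto
  qed
qed

end

section \<open>Congruence subgroups\<close>

context division_subset
begin

text \<open>Two of the infinitely many positive powers coincide, and the smaller one can be
  cancelled.\<close>

lemma power_eq_unit_of_finite:
  assumes "x \<in> D" "x \<noteq> 0" "finite W" "\<And>k. 0 < k \<Longrightarrow> x ^ k \<in> W"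
  shows "\<exists>k>0. x ^ k = e"
proof -
  have "finite (range (\<lambda>k. x ^ Suc k))"
    by (rule finite_subset[OF _ assms(3)]) (use assms(4) in blast)
  then have "\<not> inj (\<lambda>k. x ^ Suc k)"
    using finite_imageD by blast
  then obtain i j where "i < j" "x ^ Suc i = x ^ Suc j"
    unfolding inj_on_def by (metis linorder_neqE_nat)
  moreover have "x ^ Suc i * x ^ (j - i) = x ^ Suc j"
    using \<open>i < j\<close> by (simp flip: power_add del: power_Suc)
  ultimately have "x ^ Suc i * e = x ^ Suc i * x ^ (j - i)"
    using unit_right[OF power_mem[OF assms(1)], of "Suc i"] by simp
  moreover have "x ^ Suc i \<in> D" "x ^ (j - i) \<in> D" using \<open>i < j\<close> by (intro power_mem[OF assms(1)]; simp)+
  ultimately have "e = x ^ (j - i)"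
    by (intro left_cancel[OF _ unit_mem _ power_nonzero[OF assms(1,2)], of "Suc i"])
  then show ?thesis using \<open>i < j\<close> by (intro exI[of _ "j - i"]) auto
qed

text \<open>Every nonzero element has a positive power equal to \<open>e\<close>, so its inverse is
  a power of it, up to the factor \<open>e\<close> for exponent 0. The subring is thus a finite
  division ring, and Wedderburn's theorem applies.\<close>

lemma finite_subring_commutative:
  assumes E: "rng_subset E e" "E \<subseteq> D" "finite E" and "x \<in> E" "y \<in> E"
  shows "x * y = y * x"
proof -
  interpret E: rng_subset E e by (rule E(1))
  interpret E: division_subset E e
  proof
    fix x assume x: "x \<in> E" "x \<noteq> 0"
    obtain k where k: "0 < k" "x ^ k = e"
      using power_eq_unit_of_finite[OF subsetD[OF E(2) x(1)] x(2) E(3) E.power_mem[OF x(1)]] by blast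
    have "e * x ^ (k - 1) \<in> E" by (rule E.mult_power_mem[OF E.unit_mem x(1)])
    moreover have "x * (e * x ^ (k - 1)) = e" "e * x ^ (k - 1) * x = e"
      using k x by (cases k; simp add: E.unit_right E.unit_left E.unit_mem mult.assoc flip: mult.assoc[of x e] power_commutes)+
    ultimately show "\<exists>y\<in>E. x * y = e \<and> y * x = e" by blast
  qed (rule unit_nonzero)
  show ?thesis by (rule E.finite_commutative[OF E(3) assms(4,5)])
qed

definition Z_ring :: "'r set"
  where "Z_ring = range (\<lambda>z. of_int z * e)"

lemma Z_ring: "rng_subset Z_ring e"
proof
  fix x y assume "x \<in> Z_ring" "y \<in> Z_ring"
  then obtain z w where zw: "x = of_int z * e" "y = of_int w * e" by (auto simp: Z_ring_def)
  have "x + y = of_int (z + w) * e" by (simp add: zw distrib_right)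
  then show "x + y \<in> Z_ring" unfolding Z_ring_def by blast
  have "x * y = of_int (z * w) * e"
    using mult_of_int_commute[of w e] unit_left[OF unit_mem] by (simp add: zw mult.assoc flip: mult.assoc[of e])
  then show "x * y \<in> Z_ring" unfolding Z_ring_def by blast
next
  fix x assume "x \<in> Z_ring"
  then obtain z where z: "x = of_int z * e" by (auto simp: Z_ring_def)
  have "- x = of_int (- z) * e" by (simp add: z)
  then show "- x \<in> Z_ring" unfolding Z_ring_def by blast
  have "x \<in> D" unfolding z by (rule of_int_mem[OF unit_mem])
  then show "e * x = x" "x * e = x" by (auto simp: unit_left unit_right)
next
  have "e = of_int 1 * e" by simp
  then show "e \<in> Z_ring" unfolding Z_ring_def by blast
qed

lemma Z_ring_subset: "rng_subset R e \<Longrightarrow> Z_ring \<subseteq> R"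
  unfolding Z_ring_def using rng_subset.of_int_mem rng_subset.unit_mem by blast

lemma finite_Z_ring:
  assumes "0 < N" "of_nat N * e = 0"
  shows "finite Z_ring"
proof -
  have "of_int z * e = of_int (z mod int N) * e" for z
  proof -
    have "of_int z * e = of_int (int N * (z div int N) + z mod int N) * e" by simp
    also have "\<dots> = of_int (z div int N) * (of_nat N * e) + of_int (z mod int N) * e"
      by (simp only: of_int_add of_int_mult of_int_of_nat_eq distrib_right)
        (metis mult.assoc mult_of_nat_commute)
    finally show ?thesis using assms(2) by simp
  qed
  moreover have "z mod int N \<in> {0..<int N}" for z using assms(1) by simp
  ultimately have "Z_ring \<subseteq> (\<lambda>z. of_int z * e) ` {0..<int N}"
    unfolding Z_ring_def by blast
  then show ?thesis by (rule finite_subset) simp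
qed

end

text \<open>\<open>L\<close> plays the role of an order over \<open>R\<close>, possibly without a
  unit. The last two assumptions are what Nakayama's lemma supplies for a finitely generated
  \<open>L\<close>. The square of \<open>s\<close> in \<open>U\<close> matters for
  \<open>s = e + e\<close>: with \<open>s\<close> alone, \<open>- e = e + s * - e\<close> could be
  an element of order two.\<close>

locale congruence_lattice = scalar_ring D e R
  for D :: "'r::ring_1 set" and e R +
  fixes s :: 'r and L :: "'r set"
  assumes s_mem: "s \<in> R" and s_nonzero: "s \<noteq> 0"
    and units: "r \<in> R \<Longrightarrow> \<exists>v\<in>R. (e + s * r) * v = e"
    and L_D: "L \<subseteq> D" and L_zero: "0 \<in> L"
    and L_add: "u \<in> L \<Longrightarrow> v \<in> L \<Longrightarrow> u + v \<in> L"
    and L_uminus: "u \<in> L \<Longrightarrow> - u \<in> L"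
    and L_scale: "r \<in> R \<Longrightarrow> u \<in> L \<Longrightarrow> r * u \<in> L"
    and L_mult: "u \<in> L \<Longrightarrow> v \<in> L \<Longrightarrow> u * v \<in> L"
    and not_unit: "u \<in> L \<Longrightarrow> s * u \<noteq> e"
    and quasi_inverse: "u \<in> L \<Longrightarrow> \<exists>w\<in>L. u = (e + s * s * u) * w"
begin

definition U :: "'r set"
  where "U = {e + s * s * u | u. u \<in> L}"

lemma s_F: "s \<in> F"
  using s_mem R_mem_F by blast

lemma L_mem_D: "u \<in> L \<Longrightarrow> u \<in> D"
  using L_D by blast

lemma ss_mem: "s * s \<in> R"
  by (intro R.mult_mem s_mem)

lemma ss_nonzero: "s * s \<noteq> 0"
  using mult_nonzero s_nonzero s_F F_D by blast

lemma L_ss: "u \<in> L \<Longrightarrow> s * s * u \<in> L"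
  by (rule L_scale[OF ss_mem])

lemma U_I: "u \<in> L \<Longrightarrow> e + s * s * u \<in> U"
  by (auto simp: U_def)

lemma U_D: "x \<in> U \<Longrightarrow> x \<in> D"
  by (auto simp: U_def add_mem unit_mem L_mem_D[OF L_ss])

text \<open>If \<open>u = x * w\<close> for \<open>x = e + s * s * u\<close>, then
  \<open>e - s * s * w\<close> is inverse to \<open>x\<close>.\<close>

lemma U_minv:
  assumes "x \<in> U"
  shows "x \<noteq> 0" "minv x \<in> U"
proof -
  obtain u where u: "u \<in> L" "x = e + s * s * u" using assms by (auto simp: U_def)
  obtain w where w: "w \<in> L" "u = x * w" using quasi_inverse[OF u(1)] unfolding u(2)[symmetric] by blast
  have D: "u \<in> D" "w \<in> D" "x \<in> D" "s \<in> D"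
    by (rule L_mem_D[OF u(1)] L_mem_D[OF w(1)] U_D[OF assms] F_D[OF s_F])+
  have "x * (s * s * w) = s * s * u"
    using F_commute[OF R_mem_F[OF ss_mem] D(3)] w(2) by (metis mult.assoc)
  then have inv: "x * (e + s * s * - w) = e"
    using D u(2) by (simp add: distrib_left unit_right right_diff_distrib)
  then show "x \<noteq> 0" using unit_nonzero by auto
  have mem: "e + s * s * - w \<in> U" by (intro U_I L_uminus w(1))
  then show "minv x \<in> U" using minv_unique[OF D(3) U_D[OF mem] inv] by simp
qed

lemma U_mult: "x \<in> U \<Longrightarrow> y \<in> U \<Longrightarrow> x * y \<in> U"
proof -
  assume "x \<in> U" "y \<in> U"
  then obtain u v where uv: "u \<in> L" "x = e + s * s * u" "v \<in> L" "y = e + s * s * v"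
    by (auto simp: U_def)
  have D: "s * s * u \<in> D" "s * s * v \<in> D" using L_ss L_mem_D uv by auto
  have "x * y = e + (s * s * u + s * s * v + s * s * u * (s * s * v))"
    using D unit_mem unfolding uv(2,4) distrib_left distrib_right
    by (simp only: unit_left unit_right add_ac)
  also have "\<dots> = e + s * s * (u + v + u * (s * s * v))"
    by (simp only: distrib_left mult.assoc)
  finally have "x * y = e + s * s * (u + v + u * (s * s * v))" .
  then show "x * y \<in> U" using uv by (simp add: U_I L_add L_mult L_ss)
qed

lemma U_power: "x \<in> U \<Longrightarrow> 0 < n \<Longrightarrow> x ^ n \<in> U"
  by (rotate_tac, induction n rule: nat_induct_non_zero) (auto simp: U_mult)

lemma U_conj:
  assumes "a \<in> D" "a \<noteq> 0" "\<And>u. u \<in> L \<Longrightarrow> conj_by a u \<in> L" "x \<in> U"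
  shows "conj_by a x \<in> U"
proof -
  obtain u where u: "u \<in> L" "x = e + s * s * u" using assms by (auto simp: U_def)
  have "conj_by a x = a * e * minv a + a * (s * s) * u * minv a"
    by (simp add: u(2) distrib_left distrib_right mult.assoc)
  also have "a * (s * s) = s * s * a"
    using F_commute[OF R_mem_F[OF ss_mem] assms(1)] by simp
  finally have "conj_by a x = e + s * s * conj_by a u"
    using assms(1,2) by (simp add: mult.assoc minv unit_left)
  then show ?thesis using U_I assms(3) u(1) by simp
qed

text \<open>If \<open>x = e + y\<close> has finite order, its powers span a finite ring over the
  prime ring, and \<open>y\<close> lies in it. A nonzero \<open>y\<close> would then have a power
  equal to \<open>e\<close>; but powers of \<open>y\<close> are multiples of \<open>s\<close> in
  \<open>L\<close>, contradicting \<open>not_unit\<close>.\<close>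

lemma torsion_free_pos_char:
  assumes N: "0 < N" "of_nat N * e = 0" and x: "x \<in> U" and l: "0 < l" "x ^ l = e"
  shows "x = e"
proof (rule ccontr)
  assume "x \<noteq> e"
  obtain u where u: "u \<in> L" "x = e + s * s * u" using x by (auto simp: U_def)
  define y where "y = s * s * u"
  have y: "y \<in> L" "y \<in> D" "y \<noteq> 0"
    using L_ss[OF u(1)] L_mem_D \<open>x \<noteq> e\<close> u(2) by (auto simp: y_def)
  interpret Z: rng_subset Z_ring e by (rule Z_ring)
  \<comment> \<open>The exponents run from 1 to \<open>l\<close>, because \<open>x ^ 0\<close> may
    lie outside \<open>D\<close>.\<close>
  define W where "W = lspan Z_ring ((\<lambda>i. x ^ i) ` {1..l})"
  have pD: "x ^ i \<in> D" if "0 < i" for i by (rule power_mem[OF U_D[OF x] that])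
  have pW: "x ^ i \<in> W" if "0 < i" for i
  proof -
    have "x ^ (l * k + j) = x ^ j" if "0 < j" for k j
      using l pD[OF that] unit_power[of k] by (cases "k = 0") (auto simp: power_add power_mult unit_left)
    from this[of "Suc ((i - 1) mod l)" "(i - 1) div l"]
    have "x ^ i = x ^ Suc ((i - 1) mod l)"
      using that by (simp del: power_Suc)
    moreover have "Suc ((i - 1) mod l) \<in> {1..l}" using l by (simp add: Suc_le_eq)
    ultimately have "x ^ i \<in> (\<lambda>i. x ^ i) ` {1..l}" by (metis imageI)
    then show ?thesis unfolding W_def using unit_left[OF pD[OF that]] by (rule Z.lspan_mem)
  qed
  have comm: "r * b = b * r" if "r \<in> Z_ring" "b \<in> D" for r b
    using F_commute[OF _ that(2), of r] Z_ring_subset[OF F_rng] that(1) by blast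
  have W_mult: "p * q \<in> W" if "p \<in> W" "q \<in> W" for p q
    unfolding W_def
  proof (rule Z.lspan_mult)
    show "r * b = b * r" if "r \<in> Z_ring" "b \<in> (\<lambda>i. x ^ i) ` {1..l}" for r b
      using that pD by (intro comm) auto
    show "b * c \<in> lspan Z_ring ((\<lambda>i. x ^ i) ` {1..l})"
      if bc: "b \<in> (\<lambda>i. x ^ i) ` {1..l}" "c \<in> (\<lambda>i. x ^ i) ` {1..l}" for b c
    proof -
      obtain i j where "b = x ^ i" "c = x ^ j" "0 < i" using bc by auto
      then show ?thesis using pW[of "i + j"] by (simp add: W_def power_add)
    qed
  qed (use that in \<open>auto simp: W_def\<close>)
  have "y \<in> W"
  proof -
    have "y = x ^ 1 + - (x ^ l)" using l u(2) by (simp add: y_def)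
    then show ?thesis
      using lspan_add[OF pW[unfolded W_def] Z.lspan_uminus[OF pW[unfolded W_def]], of 1 l] l(1)
      by (simp add: W_def)
  qed
  have "y ^ k \<in> W" if "0 < k" for k
    using that(1) by (induction k rule: nat_induct_non_zero) (auto simp: W_mult \<open>y \<in> W\<close>)
  moreover have "finite W"
    unfolding W_def by (intro finite_lspan[OF Z_ring finite_Z_ring[OF N]]) simp
  ultimately obtain k where k: "0 < k" "y ^ k = e"
    using power_eq_unit_of_finite[OF y(2,3)] by blast
  have "s * u * y ^ n \<in> L" for n
    by (induction n) (use L_scale[OF s_mem u(1)] L_mult y(1) in
        \<open>auto simp: power_Suc2 mult.assoc[symmetric] simp del: power_Suc\<close>)
  moreover have "y ^ k = s * (s * u * y ^ (k - 1))"
    using k(1) by (cases k) (auto simp: y_def mult.assoc)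
  ultimately show False using k(2) not_unit by metis
qed

text \<open>These are the first two terms of the binomial expansion, with the higher terms collected
  in a remainder divisible by \<open>s * s\<close>.\<close>

lemma power_one_plus:
  assumes u: "u \<in> L" and q: "0 < q"
  shows "\<exists>w\<in>L. (e + s * s * u) ^ q = e + (s * s * u) * (of_nat q * e + s * s * w)"
  using q
proof (induction q rule: nat_induct_non_zero)
  case 1
  show ?case using L_zero L_mem_D[OF L_ss[OF u]] by (intro bexI[of _ 0]) (auto simp: unit_right)
next
  case (Suc q)
  then obtain w where w: "w \<in> L"
    "(e + s * s * u) ^ q = e + (s * s * u) * (of_nat q * e + s * s * w)" by auto
  define y z where "y = s * s * u" and "z = s * s"
  have D: "y \<in> D" "u \<in> D" "w \<in> D" "z \<in> D" "z * w \<in> D"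
    using L_mem_D u w L_ss R_mem_F[OF ss_mem] F_D by (auto simp: y_def z_def)
  define w' where "w' = of_nat q * u + w + w * y"
  have w': "w' \<in> L"
  proof -
    have "of_nat k * u \<in> L" for k
      by (induction k) (auto simp: L_zero L_add u distrib_right)
    then show ?thesis
      unfolding w'_def y_def by (intro L_add[OF L_add] L_mult[OF w(1) L_ss[OF u]] w(1))
  qed
  have "(e + y) ^ Suc q = (e + y) ^ q * (e + y)" by (rule power_Suc2)
  also have "\<dots> = (e + y * (of_nat q * e + z * w)) * (e + y)"
    using w(2) by (simp add: y_def z_def)
  also have "\<dots> = e + y + y * (of_nat q * e + z * w) + y * (of_nat q * y + z * w * y)"
    using D unit_mem
    by (simp add: distrib_left distrib_right mult.assoc unit_left unit_right of_nat_mem add.assoc)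
  also have "\<dots> = e + y * (of_nat (Suc q) * e + (of_nat q * y + z * w + z * w * y))"
    using D by (simp add: distrib_left distrib_right unit_right add_ac)
  also have "of_nat q * y + z * w + z * w * y = z * w'"
    unfolding w'_def distrib_left
    by (simp add: mult.assoc y_def z_def) (metis mult.assoc mult_of_nat_commute)
  finally show ?case using w' by (auto simp: y_def z_def)
qed

text \<open>An even exponent above 2 reduces first to exponent 2, applied to the power of
  \<open>x\<close> with half the exponent, and then to half the exponent. Exponent 2 gives
  \<open>y * (s + y) = 0\<close>, and \<open>s + y = 0\<close> would make
  \<open>s * - u = e\<close>. For odd \<open>l\<close>, expansion gives
  \<open>y * (of_nat l * e + s * s * w) = 0\<close>; as \<open>of_nat l * e\<close> is
  \<open>e\<close> plus a multiple of \<open>s\<close>, hence a unit of \<open>R\<close>, the second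
  factor cannot vanish by \<open>not_unit\<close>.\<close>

lemma torsion_free_two:
  assumes s2: "s = e + e" and "x \<in> U" "0 < l" "x ^ l = e"
  shows "x = e"
  using assms(2-)
proof (induction l arbitrary: x rule: less_induct)
  case (less l)
  obtain u where u: "u \<in> L" "x = e + s * s * u" using less.prems by (auto simp: U_def)
  define y where "y = s * s * u"
  have y: "y \<in> D" using L_ss[OF u(1)] L_mem_D by (simp add: y_def)
  have sD: "s \<in> D" using s_F F_D by simp
  show "x = e"
  proof (cases "even l")
    case True
    then obtain k where k: "l = k * 2" by (auto elim: evenE simp: mult.commute)
    have k0: "0 < k" "k < l" using k less.prems by auto
    show ?thesis
    proof (cases "l = 2")
      case True
      have "x * x = e" using less.prems True by (simp add: power2_eq_square)
      moreover have "x * x = e + y * (s + y)"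
        unfolding u(2) y_def[symmetric] using y unit_mem
        by (simp only: s2 distrib_left distrib_right unit_left unit_right add_ac)
      ultimately have "y * (s + y) = 0" by simp
      then consider "y = 0" | "s + y = 0" using no_zero_divisors[of y "s + y"] y sD add_mem by blast
      then show ?thesis
      proof cases
        case 1
        then show ?thesis using u(2) by (simp add: y_def)
      next
        case 2
        then have "s * e = s * (s * - u)"
          using sD by (simp add: y_def unit_right mult.assoc eq_neg_iff_add_eq_0)
        then have "s * - u = e"
          using left_cancel[OF sD unit_mem _ s_nonzero] mult_mem[OF sD uminus_mem[OF L_mem_D[OF u(1)]]] by metis
        then show ?thesis using not_unit[OF L_uminus[OF u(1)]] by simp
      qed
    next
      case False
      have "2 < l" using False k k0 by auto
      have "(x ^ k) ^ 2 = e" using less.prems k by (simp add: power_mult)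
      then have "x ^ k = e" by (rule less.IH[OF \<open>2 < l\<close> U_power[OF less.prems(1) k0(1)] zero_less_numeral])
      then show ?thesis by (rule less.IH[OF k0(2) less.prems(1) k0(1)])
    qed
  next
    case False
    then obtain k where k: "l = 2 * k + 1" by (auto elim: oddE)
    obtain w where w: "w \<in> L" "x ^ l = e + y * (of_nat l * e + s * s * w)"
      using power_one_plus[OF u(1) less.prems(2)] u(2) by (auto simp: y_def)
    have mem: "of_nat l * e + s * s * w \<in> D"
      using L_ss[OF w(1)] L_mem_D unit_mem by (auto intro: add_mem of_nat_mem)
    have "y * (of_nat l * e + s * s * w) = 0" using w(2) less.prems by simp
    then have "y = 0 \<or> of_nat l * e + s * s * w = 0" using no_zero_divisors[OF y mem] by blast
    moreover have False if 0: "of_nat l * e + s * s * w = 0"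
    proof -
      have r: "of_nat k * e \<in> R" by (rule R.of_nat_mem[OF R.unit_mem])
      obtain v where v: "v \<in> R" "(e + s * (of_nat k * e)) * v = e" using units[OF r] by blast
      have "of_nat l * e = e + s * (of_nat k * e)"
        using of_nat_mem[OF unit_mem, of k]
        by (simp add: k s2 distrib_right unit_left) (simp add: algebra_simps mult_2)
      then have "e + s * (of_nat k * e) = - (s * s * w)" using 0 by (simp add: eq_neg_iff_add_eq_0)
      then have "(- (s * s * w)) * v = e" using v(2) by simp
      moreover have "w * v = v * w" using F_commute[OF R_mem_F[OF v(1)] L_mem_D[OF w(1)]] by simp
      ultimately have "s * (s * (v * - w)) = e" by (simp add: mult.assoc)
      then show False using not_unit[of "s * (v * - w)"] L_scale s_mem v(1) L_uminus w(1) by blast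
    qed
    ultimately have "y = 0" by blast
    then show ?thesis using u(2) by (simp add: y_def)
  qed
qed

text \<open>The map \<open>c\<close> preserves \<open>U\<close>, so an iterate that is torsion must
  be \<open>e\<close>, which commutes with \<open>a\<close>. The commutation is then pulled back
  along the orbit to \<open>x = e + s * s * u\<close>, and the central factor \<open>s * s\<close>
  is cancelled.\<close>

lemma commute_of_torsion_free:
  assumes a: "a \<in> D" "a \<noteq> 0" "0 < m" "a ^ m \<in> F"
    and stable: "\<And>u. u \<in> L \<Longrightarrow> conj_by a u \<in> L"
    and tf: "\<And>x l. x \<in> U \<Longrightarrow> 0 < l \<Longrightarrow> x ^ l = e \<Longrightarrow> x = e"
    and tors: "\<And>x. x \<in> D \<Longrightarrow> x \<noteq> 0 \<Longrightarrow>
      \<exists>k. \<exists>l>0. (((\<lambda>y. conj_by a y * minv y) ^^ Suc k) x) ^ l = e"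
    and u: "u \<in> L"
  shows "a * u = u * a"
proof -
  define c where "c y = conj_by a y * minv y" for y
  have cU: "c y \<in> U" if "y \<in> U" for y
    unfolding c_def by (rule U_mult[OF U_conj[OF a(1,2) _ that] U_minv(2)[OF that]]) (rule stable)
  have ciU: "(c ^^ i) y \<in> U" if "y \<in> U" for y i
    by (induction i) (auto simp: that cU)
  \<comment> \<open>When \<open>a\<close> commutes with \<open>c y\<close>, the relation
    \<open>a * y = c y * y * a\<close> iterates to \<open>a ^ m * y = c y ^ m * y * a ^ m\<close>.
    Since \<open>a ^ m\<close> is central, it cancels and leaves \<open>c y ^ m = e\<close>.\<close>
  have step: "a * y = y * a" if y: "y \<in> U" and comm: "a * c y = c y * a" for y
  proof -
    have D: "y \<in> D" "c y \<in> D" using y cU U_D by auto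
    have ay: "a * y = c y * y * a"
    proof -
      have "c y * y * a = a * y * (minv a * (minv y * y) * a)"
        by (simp add: c_def mult.assoc)
      then show ?thesis
        using minv[OF D(1) U_minv(1)[OF y]] minv[OF a(1,2)] D
        by (simp add: unit_right mult.assoc)
    qed
    have "a ^ i * y = c y ^ i * y * a ^ i" for i
    proof (induction i)
      case (Suc i)
      have "a ^ Suc i * y = a * c y ^ i * y * a ^ i" by (simp add: Suc mult.assoc)
      also have "a * c y ^ i = c y ^ i * a" using power_commuting_commutes[of "c y" a i] comm by simp
      also have "c y ^ i * a * y * a ^ i = c y ^ i * (a * y) * a ^ i" by (simp add: mult.assoc)
      finally show ?case by (simp add: ay mult.assoc power_commutes) (simp flip: mult.assoc power_Suc2)
    qed simp
    then have "y * a ^ m = c y ^ m * y * a ^ m"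
      using F_commute[OF a(4) D(1)] by metis
    then have "e * y = c y ^ m * y"
      using right_cancel[OF power_mem[OF a(1,3)] D(1) _ power_nonzero[OF a(1,2)]]
        mult_mem[OF power_mem[OF D(2) a(3)] D(1)] D by (simp add: unit_left)
    then have "c y ^ m = e"
      using right_cancel[OF D(1) unit_mem power_mem[OF D(2) a(3)] U_minv(1)[OF y]] by simp
    then have "c y = e" by (rule tf[OF cU[OF y] a(3)])
    then show ?thesis using ay D by (simp add: unit_left)
  qed
  define x where "x = e + s * s * u"
  have x: "x \<in> U" unfolding x_def by (rule U_I[OF u])
  obtain k l where kl: "0 < l" "((c ^^ Suc k) x) ^ l = e"
    using tors[OF U_D[OF x] U_minv(1)[OF x]] unfolding c_def by blast
  \<comment> \<open>The descent starts from the iterate that equals \<open>e\<close> and reaches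
    \<open>x\<close> at \<open>i = Suc k\<close>; for larger \<open>i\<close> the truncated
    difference stays 0.\<close>
  have "a * (c ^^ (Suc k - i)) x = (c ^^ (Suc k - i)) x * a" for i
  proof (induction i)
    case 0
    show ?case using tf[OF ciU[OF x] kl] a by (simp add: unit_left unit_right del: funpow.simps)
  next
    case (Suc i)
    show ?case
    proof (cases "Suc i \<le> Suc k")
      case True
      then have "Suc k - i = Suc (Suc k - Suc i)" by simp
      then have "(c ^^ (Suc k - i)) x = c ((c ^^ (Suc k - Suc i)) x)" by simp
      then show ?thesis using step[OF ciU[OF x]] Suc by simp
    qed (use Suc in simp)
  qed
  from this[of "Suc k"] have "a * x = x * a" by simp
  then have "a * (s * s) * u = s * s * (u * a)"
    using a by (simp add: x_def distrib_left distrib_right unit_left unit_right mult.assoc)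
  moreover have "a * (s * s) = s * s * a" using F_commute[OF R_mem_F[OF ss_mem] a(1)] by simp
  ultimately have "s * s * (a * u) = s * s * (u * a)" by (simp add: mult.assoc)
  then show ?thesis
    using left_cancel[OF F_D[OF R_mem_F[OF ss_mem]] _ _ ss_nonzero] mult_mem a L_mem_D[OF u] by blast
qed

end

section \<open>Construction of a stable lattice, and the case of an integral center\<close>

context division_subset
begin

lemma ex_structure_constants:
  assumes "spans B"
  obtains k where "\<And>x b. x \<in> D \<Longrightarrow> b \<in> B \<Longrightarrow> k x b \<in> F"
    "\<And>x. x \<in> D \<Longrightarrow> x = (\<Sum>b\<in>B. k x b * b)"
proof -
  have "\<forall>x\<in>D. \<exists>c. (\<forall>b\<in>B. c b \<in> F) \<and> x = (\<Sum>b\<in>B. c b * b)"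
    using assms by (simp add: spans_def)
  then show thesis using that by metis
qed

text \<open>The lattice is generated by the finitely many conjugates of \<open>B\<close> under
  powers of \<open>a\<close>, scaled by a common denominator of their structure constants. Finite
  generation makes Nakayama's lemma available for the last two assumptions of the locale.\<close>

lemma ex_congruence_lattice:
  assumes R: "rng_subset R e" "R \<subseteq> F" and s: "s \<in> R" "s \<noteq> 0"
    and units: "\<And>r. r \<in> R \<Longrightarrow> \<exists>v\<in>R. (e + s * r) * v = e"
    and val: "\<And>f. f \<in> F \<Longrightarrow> f \<noteq> 0 \<Longrightarrow> f \<in> R \<or> minv f \<in> R"
    and B: "spans B"
    and a: "a \<in> D" "a \<noteq> 0" "0 < m" "a ^ m \<in> F"
  obtains L where "congruence_lattice D e R s L"
    "\<And>u. u \<in> L \<Longrightarrow> conj_by a u \<in> L"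
    "(\<And>u. u \<in> L \<Longrightarrow> a * u = u * a) \<Longrightarrow> a \<in> F"
proof -
  interpret R: rng_subset R e by (rule R(1))
  interpret scalar_ring D e R by unfold_locales (rule R(2))
  have finB: "finite B" and BD: "B \<subseteq> D" using B by (auto simp: spans_def)
  have sF: "s \<in> F" using s(1) by (rule R_mem_F)
  have aD: "a ^ i \<in> D" "a ^ i \<noteq> 0" if "0 < i" for i
    using power_mem[OF a(1) that] power_nonzero[OF a(1,2)] by auto
  \<comment> \<open>Conjugation by \<open>a ^ m\<close> is trivial, so this set is stable under
    conjugation by \<open>a\<close> and contains \<open>B\<close>. The exponents avoid 0, since
    \<open>a ^ 0\<close> may lie outside \<open>D\<close>.\<close>
  define G0 where "G0 = (\<lambda>(i, b). conj_by (a ^ i) b) ` ({1..m} \<times> B)"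
  have finG: "finite G0" unfolding G0_def using finB by simp
  have conj_m: "conj_by (a ^ m) x = x" if "x \<in> D" for x
    using conj_eq_self_iff[OF aD[OF a(3)] that] F_commute[OF a(4) that] by simp
  have B_G0: "B \<subseteq> G0"
  proof
    fix b assume b: "b \<in> B"
    then have "b = conj_by (a ^ m) b" using conj_m BD by auto
    then show "b \<in> G0" unfolding G0_def using a(3) b by (intro image_eqI[of _ _ "(m, b)"]) auto
  qed
  have G0_D: "g \<in> D" if g: "g \<in> G0" for g
  proof -
    obtain i b where ib: "i \<in> {1..m}" "b \<in> B" "g = conj_by (a ^ i) b" using g by (auto simp: G0_def)
    show ?thesis unfolding ib(3) using aD[of i] BD ib(1,2) by (intro conj_mem) auto
  qed
  have G0_conj: "conj_by a g \<in> G0" if g: "g \<in> G0" for g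
  proof -
    obtain i b where ib: "i \<in> {1..m}" "b \<in> B" "g = conj_by (a ^ i) b" using g by (auto simp: G0_def)
    have "0 < i" using ib by simp
    have "conj_by a g = conj_by (a ^ Suc i) b"
      unfolding ib(3) using conj_conj[OF a(1,2) aD[OF \<open>0 < i\<close>]] by simp
    moreover have "conj_by (a ^ Suc m) b = conj_by (a ^ 1) b"
      using conj_conj[OF a(1,2) aD[OF a(3)], of b] conj_m[of b] BD ib(2) by auto
    ultimately show ?thesis unfolding G0_def using ib
      by (cases "i = m")
        (auto intro: image_eqI[of _ _ "(1, b)"] image_eqI[of _ _ "(Suc i, b)"] simp del: power_Suc)
  qed
  obtain k where k: "\<And>x b. x \<in> D \<Longrightarrow> b \<in> B \<Longrightarrow> k x b \<in> F"
    "\<And>x. x \<in> D \<Longrightarrow> x = (\<Sum>b\<in>B. k x b * b)"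
    using ex_structure_constants[OF B] by blast
  define C where "C = (\<lambda>(g, h, b). k (g * h) b) ` (G0 \<times> G0 \<times> B)"
  have finC: "finite C" unfolding C_def using finG finB by simp
  have CF: "C \<subseteq> F" unfolding C_def by (auto simp: k(1) mult_mem G0_D)
  have "\<exists>r\<in>R. r \<noteq> 0 \<and> (\<forall>c\<in>C. r * c \<in> R)"
    by (rule common_denominator[OF R _ finC CF]) (rule val)
  then obtain r where r: "r \<in> R" "r \<noteq> 0" "\<And>c. c \<in> C \<Longrightarrow> r * c \<in> R" by blast
  have rF: "r \<in> F" using r(1) by (rule R_mem_F)
  \<comment> \<open>Scaling makes products of generators integral: \<open>(r * g) * (r * h)\<close>
    is the sum of \<open>(r * k (g * h) b) * (r * b)\<close>, where each first factor lies in
    \<open>R\<close> and each \<open>r * b\<close> is again a generator.\<close>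
  define G where "G = (*) r ` G0"
  define L where "L = lspan R G"
  have G_D: "G \<subseteq> D" unfolding G_def using mult_mem[OF F_D[OF rF] G0_D] by auto
  have finGG: "finite G" unfolding G_def using finG by simp
  have G_L: "g \<in> L" if "g \<in> G" for g
    unfolding L_def using that unit_left[OF subsetD[OF G_D that]] by (rule R.lspan_mem)
  have comm: "q * x = x * q" if "q \<in> R" "x \<in> D" for q x
    using F_commute[OF R_mem_F[OF that(1)] that(2)] .
  have G_mult: "g * h \<in> L" if gh: "g \<in> G" "h \<in> G" for g h
  proof -
    obtain g0 h0 where g0: "g0 \<in> G0" "g = r * g0" and h0: "h0 \<in> G0" "h = r * h0"
      using gh by (auto simp: G_def)
    have "g * h = r * (g0 * r) * h0" by (simp add: g0 h0 mult.assoc)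
    also have "g0 * r = r * g0" using comm[OF r(1) G0_D[OF g0(1)]] by simp
    also have "r * (r * g0) * h0 = r * r * (\<Sum>b\<in>B. k (g0 * h0) b * b)"
      using k(2)[OF mult_mem[OF G0_D[OF g0(1)] G0_D[OF h0(1)]]] by (simp add: mult.assoc)
    also have "\<dots> = (\<Sum>b\<in>B. (r * k (g0 * h0) b) * (r * b))"
      unfolding sum_distrib_left
    proof (rule sum.cong)
      fix b assume b: "b \<in> B"
      have "k (g0 * h0) b \<in> D"
        using k(1)[OF mult_mem[OF G0_D[OF g0(1)] G0_D[OF h0(1)]] b] F_D by blast
      then have "r * k (g0 * h0) b = k (g0 * h0) b * r" by (rule comm[OF r(1)])
      moreover have "r * r * (k (g0 * h0) b * b) = r * (r * k (g0 * h0) b) * b" by (simp only: mult.assoc)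
      ultimately have "r * r * (k (g0 * h0) b * b) = r * (k (g0 * h0) b * r) * b" by simp
      then show "r * r * (k (g0 * h0) b * b) = r * k (g0 * h0) b * (r * b)" by (simp add: mult.assoc)
    qed simp
    also have "\<dots> \<in> L"
    proof -
      have "(r * k (g0 * h0) b) * (r * b) \<in> L" if b: "b \<in> B" for b
      proof -
        have "k (g0 * h0) b \<in> C"
          unfolding C_def using g0 h0 b by (intro image_eqI[of _ _ "(g0, h0, b)"]) auto
        then have "r * k (g0 * h0) b \<in> R" by (rule r(3))
        moreover have "r * b \<in> L" using B_G0 b by (intro G_L) (auto simp: G_def)
        ultimately show ?thesis unfolding L_def by (rule R.lspan_scale)
      qed
      then show ?thesis using finB
        by (induction B rule: infinite_finite_induct) (auto simp: L_def intro: lspan.zero lspan_add)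
    qed
    finally show ?thesis .
  qed
  have L_D: "L \<subseteq> D"
  proof
    fix x assume "x \<in> L"
    then show "x \<in> D" unfolding L_def
      by (rule lspan_closed) (use zero_mem add_mem mult_mem R_mem_F F_D G_D in auto)
  qed
  have L_mult: "x * y \<in> L" if "x \<in> L" "y \<in> L" for x y
    unfolding L_def by (rule R.lspan_mult) (use comm G_D G_mult that in \<open>auto simp: L_def\<close>)
  have L_conj: "conj_by a u \<in> L" if "u \<in> L" for u
    using that unfolding L_def
  proof (induction rule: lspan.induct)
    case (step c g x)
    obtain g0 where g0: "g0 \<in> G0" "g = r * g0" using step by (auto simp: G_def)
    have "conj_by a g = r * conj_by a g0"
      using comm[OF r(1) a(1)] by (simp add: g0(2) mult.assoc[symmetric])
    then have "conj_by a g \<in> G" using G0_conj[OF g0(1)] by (auto simp: G_def)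
    moreover have "conj_by a (c * g + x) = c * conj_by a g + conj_by a x"
      using comm[OF step(1) a(1)] by (simp add: distrib_left distrib_right mult.assoc[symmetric])
    ultimately show ?case using step lspan.step by metis
  qed (simp add: lspan.zero)
  have L_scale: "q * x \<in> L" if "q \<in> R" "x \<in> L" for q x
    using that unfolding L_def by (rule R.lspan_scale)
  have L_closed: "0 \<in> L" "\<And>x y. x \<in> L \<Longrightarrow> y \<in> L \<Longrightarrow> x + y \<in> L" "\<And>x. x \<in> L \<Longrightarrow> - x \<in> L"
    unfolding L_def using lspan.zero lspan_add R.lspan_uminus by blast+
  \<comment> \<open>If \<open>s * u = e\<close>, then every generator \<open>g\<close> equals
    \<open>s * (u * g)\<close>, so Nakayama's lemma with the zero submodule gives
    \<open>L = 0\<close>.\<close>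
  have not_unit: "s * u \<noteq> e" if u: "u \<in> L" for u
  proof
    assume su: "s * u = e"
    have "G \<subseteq> {0}"
    proof (rule nakayama[OF R s(1) units _ _ _ finGG G_D])
      fix g assume g: "g \<in> G"
      have "g = 0 + s * (u * g)"
        using su unit_left[OF subsetD[OF G_D g]] by (simp flip: mult.assoc)
      then show "\<exists>n\<in>{0}. \<exists>y\<in>lspan R G. g = n + s * y"
        using L_mult[OF u G_L[OF g]] unfolding L_def by blast
    qed auto
    then have "q * g = 0" if "g \<in> G" for q g using that by auto
    moreover have "u \<in> lspan R G" using u by (simp add: L_def)
    ultimately have "u \<in> {0}" by (intro lspan_closed[of u R G "{0}"]) simp_all
    then show False using su unit_nonzero by simp
  qed
  \<comment> \<open>Left multiplication by \<open>e + s * s * u\<close> maps \<open>L\<close> onto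
    itself: its image is a submodule \<open>N\<close>, and each generator is in \<open>N\<close> up
    to an \<open>s\<close>-multiple of an element of \<open>L\<close>.\<close>
  have quasi: "\<exists>w\<in>L. u = (e + s * s * u) * w" if u: "u \<in> L" for u
  proof -
    define N where "N = (\<lambda>w. (e + s * s * u) * w) ` L"
    have xD: "e + s * s * u \<in> D"
      using u L_D sF F_D unit_mem by (intro add_mem mult_mem) auto
    have "G \<subseteq> N"
    proof (rule nakayama[OF R s(1) units _ _ _ finGG G_D])
      show "0 \<in> N" unfolding N_def using L_closed(1) by (intro image_eqI[of _ _ 0]) auto
      show "x + y \<in> N" if "x \<in> N" "y \<in> N" for x y
        using that L_closed(2) unfolding N_def by (auto simp flip: distrib_left)
      show "q * x \<in> N" if q: "q \<in> R" and x: "x \<in> N" for q x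
      proof -
        obtain w where w: "w \<in> L" "x = (e + s * s * u) * w" using x by (auto simp: N_def)
        have "q * x = (e + s * s * u) * (q * w)"
          using comm[OF q xD] by (simp only: w(2) mult.assoc[symmetric])
        then show ?thesis using L_scale[OF q w(1)] by (auto simp: N_def)
      qed
      fix g assume g: "g \<in> G"
      have "g = (e + s * s * u) * g + s * (- (s * (u * g)))"
        using g G_D by (auto simp: unit_left distrib_right mult.assoc)
      moreover have "- (s * (u * g)) \<in> lspan R G"
        using L_closed(3)[OF L_scale[OF s(1) L_mult[OF u G_L[OF g]]]] by (simp add: L_def)
      ultimately show "\<exists>n\<in>N. \<exists>y\<in>lspan R G. g = n + s * y"
        unfolding N_def using G_L[OF g] by blast
    qed
    have "u \<in> lspan R G" using u by (simp add: L_def)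
    then have "u \<in> N"
    proof (rule lspan_closed)
      show "0 \<in> N" unfolding N_def using L_closed(1) by (intro image_eqI[of _ _ 0]) auto
      show "x + y \<in> N" if "x \<in> N" "y \<in> N" for x y
        using that L_closed(2) unfolding N_def by (auto simp flip: distrib_left)
      show "q * g \<in> N" if q: "q \<in> R" and g: "g \<in> G" for q g
      proof -
        obtain w where w: "w \<in> L" "g = (e + s * s * u) * w" using g \<open>G \<subseteq> N\<close> by (auto simp: N_def)
        have "q * g = (e + s * s * u) * (q * w)"
          using comm[OF q xD] by (simp only: w(2) mult.assoc[symmetric])
        then show ?thesis using L_scale[OF q w(1)] by (auto simp: N_def)
      qed
    qed
    then show ?thesis by (auto simp: N_def)
  qed
  have "congruence_lattice D e R s L"
    by unfold_locales
      (rule s units L_D L_closed L_scale L_mult not_unit quasi; assumption)+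
  moreover have "a \<in> F" if ac: "\<And>u. u \<in> L \<Longrightarrow> a * u = u * a"
  proof -
    have ab: "a * b = b * a" if b: "b \<in> B" for b
    proof -
      have bD: "b \<in> D" using b BD by auto
      have "r * b \<in> L" using B_G0 b by (intro G_L) (auto simp: G_def)
      then have "a * (r * b) = r * b * a" by (rule ac)
      then have "r * (a * b) = r * (b * a)"
        using comm[OF r(1) a(1)] by (simp add: mult.assoc) (simp flip: mult.assoc)
      then show ?thesis
        using left_cancel[OF F_D[OF rF] mult_mem[OF a(1) bD] mult_mem[OF bD a(1)] r(2)] by simp
    qed
    have "a * x = x * a" if x: "x \<in> D" for x
    proof -
      have "a * (k x b * b) = k x b * b * a" if b: "b \<in> B" for b
        using F_commute[OF k(1)[OF x b] a(1)] ab[OF b] by (metis mult.assoc)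
      then have "a * (\<Sum>b\<in>B. k x b * b) = (\<Sum>b\<in>B. k x b * b) * a"
        unfolding sum_distrib_left sum_distrib_right by (rule sum.cong[OF refl])
      then show ?thesis using k(2)[OF x] by simp
    qed
    then show ?thesis using a(1) by (simp add: cent_def)
  qed
  ultimately show thesis using that L_conj by blast
qed

text \<open>The assumption makes each element of \<open>F\<close> integral over the finite prime
  ring, so finitely many of them lie in a finite subring \<open>K\<close>. If \<open>K\<close>
  contains the structure constants of \<open>B\<close> and the coordinates of \<open>x\<close>,
  \<open>y\<close> and \<open>e\<close>, the \<open>K\<close>-span of \<open>B\<close> is a finite
  ring containing \<open>x\<close> and \<open>y\<close>, hence commutative.\<close>

lemma commutative_of_integral:
  assumes B: "spans B" and N: "0 < N" "of_nat N * e = 0"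
    and int: "\<And>f. f \<in> F \<Longrightarrow> f \<noteq> 0 \<Longrightarrow> \<exists>n. f \<in> polys Z_ring (minv f) n"
    and x: "x \<in> D" and y: "y \<in> D"
  shows "x * y = y * x"
proof -
  have finB: "finite B" and BD: "B \<subseteq> D" using B by (auto simp: spans_def)
  have ex: "\<exists>K. rng_subset K e \<and> K \<subseteq> F \<and> finite K \<and> C \<subseteq> K" if "finite C" "C \<subseteq> F" for C
    using that
  proof (induction C rule: finite_induct)
    case empty
    show ?case using Z_ring finite_Z_ring[OF N] Z_ring_subset[OF F_rng] by blast
  next
    case (insert f C)
    then obtain K where K: "rng_subset K e" "K \<subseteq> F" "finite K" "C \<subseteq> K" by auto
    show ?case
    proof (cases "f = 0")
      case True
      then show ?thesis using K rng_subset.zero_mem[OF K(1)] by auto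
    next
      case False
      interpret K: rng_subset K e by (rule K(1))
      interpret scalar_ring D e K by unfold_locales (rule K(2))
      have f: "f \<in> F" using insert by auto
      obtain n where "f \<in> polys Z_ring (minv f) n" using int[OF f False] by auto
      then have fn: "f \<in> polys K (minv f) n" using polys_mono_ring[OF Z_ring_subset[OF K(1)]] by blast
      \<comment> \<open>Multiplying \<open>f\<close>, written as a polynomial in
        \<open>minv f\<close>, by \<open>f ^ n\<close> gives an integral equation for
        \<open>f\<close>. By it, all polynomials in \<open>f\<close> reduce to degree at most
        \<open>n\<close>, and \<open>K[f]\<close> is finite.\<close>
      have top: "f ^ Suc n \<in> polys K f n"
        using polys_reverse[OF f F_minv[OF f False] minv_right[OF F_D[OF f] False] fn]
        by (simp add: power_commutes)
      have "polys K f k \<subseteq> polys K f n" for k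
      proof (induction k)
        case (Suc k)
        show ?case
        proof
          fix z assume "z \<in> polys K f (Suc k)"
          then obtain r w where w: "r \<in> K" "w \<in> polys K f k" "z = r + f * w" by (rule polys_SucE)
          then have "f * w \<in> polys K f (Suc n)" using Suc polys_shift by blast
          then obtain v q where v: "v \<in> polys K f n" "q \<in> K" "f * w = v + q * f ^ Suc n"
            using polys_top[OF f] by blast
          then show "z \<in> polys K f n"
            unfolding w(3) v(3) by (intro polys_add polys_R[OF w(1)] v(1) polys_scale[OF f v(2) top])
        qed
      qed (use polys_R in auto)
      then have "adj f \<subseteq> polys K f n" by (auto simp: adj_def)
      then have "finite (adj f)" using finite_polys[OF K(3)] finite_subset by blast
      moreover have "insert f C \<subseteq> adj f" using adj_self[OF f] adj_R[of f] K(4) by auto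
      ultimately show ?thesis using adj_rng[OF f] adj_F[OF f] by blast
    qed
  qed
  obtain k where k: "\<And>x b. x \<in> D \<Longrightarrow> b \<in> B \<Longrightarrow> k x b \<in> F"
    "\<And>x. x \<in> D \<Longrightarrow> x = (\<Sum>b\<in>B. k x b * b)"
    using ex_structure_constants[OF B] by blast
  define X where "X = {x, y, e} \<union> (\<lambda>(b, c). b * c) ` (B \<times> B)"
  have XD: "X \<subseteq> D" unfolding X_def using x y unit_mem mult_mem BD by auto
  have "finite X" unfolding X_def using finB by simp
  then have "finite ((\<lambda>(x, b). k x b) ` (X \<times> B))" using finB by simp
  moreover have "(\<lambda>(x, b). k x b) ` (X \<times> B) \<subseteq> F" using k(1) XD by auto
  ultimately obtain K where K: "rng_subset K e" "K \<subseteq> F" "finite K" "(\<lambda>(x, b). k x b) ` (X \<times> B) \<subseteq> K"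
    using ex by meson
  interpret K: rng_subset K e by (rule K(1))
  define E where "E = lspan K B"
  have X_E: "z \<in> E" if "z \<in> X" for z
  proof -
    have "(\<Sum>b\<in>B. k z b * b) \<in> E"
      unfolding E_def using K(4) that by (intro lspan_sum finB) auto
    then show ?thesis using k(2)[of z] that XD by auto
  qed
  have E_D: "E \<subseteq> D"
  proof
    fix z assume "z \<in> E"
    then show "z \<in> D" unfolding E_def
      by (rule lspan_closed) (use K(2) BD in \<open>auto simp: zero_mem add_mem mult_mem F_D subset_iff\<close>)
  qed
  have E_mult: "z * w \<in> E" if "z \<in> E" "w \<in> E" for z w
    unfolding E_def
  proof (rule K.lspan_mult)
    show "r * b = b * r" if "r \<in> K" "b \<in> B" for r b
      using F_commute[of r b] that K(2) BD by auto
    show "b * c \<in> lspan K B" if "b \<in> B" "c \<in> B" for b c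
      using X_E[of "b * c"] that by (auto simp: X_def E_def)
  qed (use that in \<open>auto simp: E_def\<close>)
  have "rng_subset E e"
  proof
    show "e \<in> E" by (rule X_E) (simp add: X_def)
    show "e * z = z" "z * e = z" if "z \<in> E" for z using that E_D unit_left unit_right by auto
  qed (use lspan_add K.lspan_uminus E_mult in \<open>auto simp: E_def\<close>)
  moreover have "finite E" unfolding E_def by (rule finite_lspan[OF K(1,3) finB])
  moreover have "x \<in> E" "y \<in> E" by (auto intro!: X_E simp: X_def)
  ultimately show ?thesis using finite_subring_commutative E_D by blast
qed

theorem central_of_radical_commutators:
  assumes central: "\<And>z w. z \<in> F \<Longrightarrow> z * w = w * z"
    and B: "spans B"
    and a: "a \<in> D" "a \<noteq> 0" "0 < m" "a ^ m \<in> F"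
    and rad: "\<And>x. x \<in> D \<Longrightarrow> x \<noteq> 0 \<Longrightarrow>
      \<exists>k. \<exists>l>0. (((\<lambda>y. conj_by a y * minv y) ^^ Suc k) x) ^ l \<in> F"
  shows "a \<in> F"
proof -
  interpret Z: rng_subset Z_ring e by (rule Z_ring)
  interpret Z: scalar_ring D e Z_ring by unfold_locales (rule Z_ring_subset[OF F_rng])
  define c where "c y = conj_by a y * minv y" for y
  have c_mem: "c y \<in> D \<and> c y \<noteq> 0" if "y \<in> D" "y \<noteq> 0" for y
    unfolding c_def using that a minv minv_nonzero conj_mem conj_nonzero
    by (simp add: mult_mem mult_nonzero)
  have tors: "\<exists>k. \<exists>l>0. (((\<lambda>y. conj_by a y * minv y) ^^ Suc k) x) ^ l = e" if x: "x \<in> D" "x \<noteq> 0" for x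
  proof -
    obtain k l where kl: "0 < l" "((c ^^ Suc k) x) ^ l \<in> F" using rad[OF x] unfolding c_def by blast
    have "(c ^^ k) x \<in> D \<and> (c ^^ k) x \<noteq> 0" by (induction k) (use x c_mem in auto)
    then have "\<exists>l>0. ((c ^^ Suc k) x) ^ l = e"
      by (intro commutator_power_central[OF central B a(1,2) _ _ _ kl]) (auto simp: c_def)
    then show ?thesis unfolding c_def by blast
  qed
  \<comment> \<open>The base ring \<open>A\<close> will be the prime ring with
    \<open>s = e + e\<close>, or in positive characteristic the ring generated by \<open>s\<close>
    over the prime ring. The condition \<open>tf\<close> selects the torsion-freeness lemma for
    \<open>U\<close>.\<close>
  have main: "a \<in> F"
    if s: "s \<in> F" "s \<noteq> 0" "minv s \<notin> A" and A: "rng_subset A e" "A \<subseteq> F" "s \<in> A"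
      and tf: "(\<exists>N>0. of_nat N * e = 0) \<or> s = e + e" for s A
  proof -
    obtain R where R: "rng_subset R e" "R \<subseteq> F" "A \<subseteq> R" "minv s \<notin> R"
      "\<And>r. r \<in> R \<Longrightarrow> \<exists>v\<in>R. (e + s * r) * v = e"
      "\<And>f. f \<in> F \<Longrightarrow> f \<noteq> 0 \<Longrightarrow> f \<in> R \<or> minv f \<in> R"
      using ex_valuation_ring[OF A s(2,3)] by blast
    have sR: "s \<in> R" using A R by auto
    obtain L where L: "congruence_lattice D e R s L"
      "\<And>u. u \<in> L \<Longrightarrow> conj_by a u \<in> L"
      "(\<And>u. u \<in> L \<Longrightarrow> a * u = u * a) \<Longrightarrow> a \<in> F"
      using ex_congruence_lattice[OF R(1,2) sR s(2) R(5,6) B a] by blast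
    interpret L: congruence_lattice D e R s L by (rule L(1))
    have "x = e" if "x \<in> L.U" "0 < l" "x ^ l = e" for x l
      using tf L.torsion_free_pos_char L.torsion_free_two that by blast
    then show ?thesis
      using L.commute_of_torsion_free[OF a L(2) _ tors] L(3) by blast
  qed
  show ?thesis
  proof (cases "\<exists>N>0. of_nat N * e = 0")
    case True
    then obtain N where N: "0 < N" "of_nat N * e = 0" by blast
    show ?thesis
    proof (cases "\<exists>s\<in>F. s \<noteq> 0 \<and> minv s \<notin> Z.adj s")
      case True
      then obtain s where s: "s \<in> F" "s \<noteq> 0" "minv s \<notin> Z.adj s" by blast
      show ?thesis
        using main[OF s Z.adj_rng[OF s(1)] Z.adj_F[OF s(1)] Z.adj_self[OF s(1)]] N by blast
    next
      case False
      \<comment> \<open>Use the failing condition for \<open>minv f\<close> in place of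
        \<open>s\<close>.\<close>
      have "\<exists>n. f \<in> polys Z_ring (minv f) n" if f: "f \<in> F" "f \<noteq> 0" for f
      proof -
        have "minv (minv f) \<in> Z.adj (minv f)"
          using False F_minv[OF f] minv_nonzero[OF F_D[OF f(1)] f(2)] by blast
        then show ?thesis by (simp add: minv_minv[OF F_D[OF f(1)] f(2)] Z.adj_def)
      qed
      then have "a * x = x * a" if "x \<in> D" for x
        using commutative_of_integral[OF B N _ a(1) that] by blast
      then show ?thesis using a(1) by (simp add: cent_def)
    qed
  next
    case False
    define s where "s = e + e"
    have sZ: "s \<in> Z_ring" unfolding s_def by (intro Z.add_mem Z.unit_mem)
    have "of_nat 2 * e \<noteq> 0" using False by (metis zero_less_numeral of_nat_numeral)
    then have s0: "s \<noteq> 0" by (simp add: s_def mult_2)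
    have sF: "s \<in> F" using sZ Z.R_mem_F by blast
    \<comment> \<open>If the inverse of 2 were an integer \<open>z\<close> in \<open>D\<close>, then
      \<open>2 * z - 1\<close> would vanish in \<open>D\<close>; this integer is odd, hence nonzero,
      and the characteristic would be positive.\<close>
    have "minv s \<notin> Z_ring"
    proof
      assume "minv s \<in> Z_ring"
      then obtain z where z: "minv s = of_int z * e" by (auto simp: Z_ring_def)
      have "s * y = y + y" if "y \<in> D" for y
        using that by (simp add: s_def distrib_right unit_left)
      then have "e = minv s + minv s"
        using minv[OF F_D[OF sF] s0] by metis
      then have "e = of_int (z + z) * e" unfolding z by (simp only: of_int_add distrib_right)
      then have "of_int (z + z) * e - e = 0" by (simp only: right_minus_eq)
      moreover have "of_int (2 * z - 1) * e = of_int (z + z) * e - e"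
        by (simp only: mult_2 of_int_diff of_int_1 left_diff_distrib mult_1_left)
      ultimately have "of_int (2 * z - 1) * e = 0" by simp
      moreover have nz: "2 * z - 1 \<noteq> 0" by presburger
      ultimately have "of_int \<bar>2 * z - 1\<bar> * e = 0"
        unfolding abs_if by (simp only: of_int_minus mult_minus_left neg_equal_0_iff_equal simp_thms split: if_split)
      then have "of_nat (nat \<bar>2 * z - 1\<bar>) * e = 0"
        by (simp only: of_nat_nat abs_ge_zero)
      moreover have "0 < nat \<bar>2 * z - 1\<bar>" using nz by linarith
      ultimately show False using False by blast
    qed
    then show ?thesis using main[OF sF s0 _ Z_ring Z_ring_subset[OF F_rng] sZ] by (simp add: s_def)
  qed
qed

end

section \<open>Embedding an arbitrary division ring\<close>

text \<open>A type cannot depend on the division ring at hand, so this is the product of all rings with elements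
  of type \<open>'a\<close>; every single one is one of the factors. The additional factor \<open>int\<close> ensures \<open>0 \<noteq> 1\<close>.\<close>

typedef (overloaded) ('a, 'b) ring_product =
  "UNIV \<times> (\<Pi>\<^sub>E S \<in> {S :: ('a, 'b) ring_scheme. ring S}. carrier S) :: (int \<times> _) set"
proof
  show "(0, \<lambda>S \<in> {S :: ('a, 'b) ring_scheme. ring S}. \<zero>\<^bsub>S\<^esub>)
      \<in> UNIV \<times> (\<Pi>\<^sub>E S \<in> {S :: ('a, 'b) ring_scheme. ring S}. carrier S)"
    by (auto intro: ring.ring_simprules)
qed

definition int_part :: "('a, 'b) ring_product \<Rightarrow> int"
  where "int_part x = fst (Rep_ring_product x)"

definition component :: "('a, 'b) ring_scheme \<Rightarrow> ('a, 'b) ring_product \<Rightarrow> 'a"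
  where "component S x = snd (Rep_ring_product x) S"

definition tuple :: "int \<Rightarrow> (('a, 'b) ring_scheme \<Rightarrow> 'a) \<Rightarrow> ('a, 'b) ring_product"
  where "tuple k f = Abs_ring_product (k, \<lambda>S \<in> {S. ring S}. f S)"

lemma component_closed: "ring S \<Longrightarrow> component S x \<in> carrier S"
  using Rep_ring_product[of x] by (auto simp: component_def mem_Times_iff dest: PiE_mem)

lemma ring_product_eqI:
  assumes "int_part x = int_part y" "\<And>S. ring S \<Longrightarrow> component S x = component S y"
  shows "x = y"
proof -
  have "snd (Rep_ring_product x) = snd (Rep_ring_product y)"
    using Rep_ring_product[of x] Rep_ring_product[of y] assms(2)
    by (intro PiE_ext[of _ "{S. ring S}" carrier]) (auto simp: component_def mem_Times_iff)
  then show ?thesis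
    using assms(1) by (simp add: int_part_def prod_eq_iff flip: Rep_ring_product_inject)
qed

lemma tuple:
  assumes "\<And>S. ring S \<Longrightarrow> f S \<in> carrier S"
  shows int_part_tuple: "int_part (tuple k f) = k"
    and component_tuple: "ring S \<Longrightarrow> component S (tuple k f) = f S"
proof -
  have "(k, \<lambda>S \<in> {S. ring S}. f S) \<in> UNIV \<times> (\<Pi>\<^sub>E S \<in> {S. ring S}. carrier S)"
    using assms by auto
  then have "Rep_ring_product (tuple k f) = (k, \<lambda>S \<in> {S. ring S}. f S)"
    unfolding tuple_def by (rule Abs_ring_product_inverse)
  then show "int_part (tuple k f) = k" "ring S \<Longrightarrow> component S (tuple k f) = f S"
    by (simp_all add: int_part_def component_def)
qed

instantiation ring_product :: (type, type) ring_1
begin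

definition "0 = tuple 0 (\<lambda>S. \<zero>\<^bsub>S\<^esub>)"
definition "1 = tuple 1 (\<lambda>S. \<one>\<^bsub>S\<^esub>)"
definition "x + y = tuple (int_part x + int_part y) (\<lambda>S. component S x \<oplus>\<^bsub>S\<^esub> component S y)"
definition "x * y = tuple (int_part x * int_part y) (\<lambda>S. component S x \<otimes>\<^bsub>S\<^esub> component S y)"
definition "- x = tuple (- int_part x) (\<lambda>S. \<ominus>\<^bsub>S\<^esub> component S x)"
definition "x - y = tuple (int_part x - int_part y) (\<lambda>S. component S x \<ominus>\<^bsub>S\<^esub> component S y)"

lemma ring_product_components:
  shows "int_part 0 = 0" "int_part 1 = 1" "int_part (x + y) = int_part x + int_part y"
    "int_part (x * y) = int_part x * int_part y" "int_part (- x) = - int_part x"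
    "int_part (x - y) = int_part x - int_part y"
    and "ring S \<Longrightarrow> component S 0 = \<zero>\<^bsub>S\<^esub>" "ring S \<Longrightarrow> component S 1 = \<one>\<^bsub>S\<^esub>"
    "ring S \<Longrightarrow> component S (x + y) = component S x \<oplus>\<^bsub>S\<^esub> component S y"
    "ring S \<Longrightarrow> component S (x * y) = component S x \<otimes>\<^bsub>S\<^esub> component S y"
    "ring S \<Longrightarrow> component S (- x) = \<ominus>\<^bsub>S\<^esub> component S x"
    "ring S \<Longrightarrow> component S (x - y) = component S x \<ominus>\<^bsub>S\<^esub> component S y"
  unfolding zero_ring_product_def one_ring_product_def plus_ring_product_def
    times_ring_product_def uminus_ring_product_def minus_ring_product_def
  by (subst int_part_tuple component_tuple;
      auto intro: ring.ring_simprules component_closed)+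

instance
proof
  fix x y z :: "('a, 'b) ring_product"
  note [simp] = ring_product_components component_closed
  show "x * y * z = x * (y * z)"
    by (rule ring_product_eqI) (auto simp: ring.ring_simprules mult.assoc)
  show "1 * x = x" "x * 1 = x"
    by (rule ring_product_eqI; auto simp: ring.ring_simprules monoid.r_one[OF ring.axioms(2)])+
  show "x + y + z = x + (y + z)"
    by (rule ring_product_eqI) (auto simp: ring.ring_simprules)
  show "x + y = y + x"
    by (rule ring_product_eqI) (auto simp: ring.ring_simprules)
  show "0 + x = x"
    by (rule ring_product_eqI) (auto simp: ring.ring_simprules)
  show "- x + x = 0"
    by (rule ring_product_eqI) (auto simp: ring.ring_simprules)
  show "x - y = x + - y"
    by (rule ring_product_eqI) (auto simp: a_minus_def)
  show "(x + y) * z = x * z + y * z" "x * (y + z) = x * y + x * z"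
    by (rule ring_product_eqI; auto simp: ring.ring_simprules algebra_simps)+
  have "int_part (0 :: ('a, 'b) ring_product) \<noteq> int_part 1" by simp
  then show "(0 :: ('a, 'b) ring_product) \<noteq> 1" by metis
qed

end

definition emb :: "('a, 'b) ring_scheme \<Rightarrow> 'a \<Rightarrow> ('a, 'b) ring_product"
  where "emb R a = tuple 0 (\<lambda>S. if S = R then a else \<zero>\<^bsub>S\<^esub>)"

context ring
begin

lemma emb_components:
  assumes "a \<in> carrier R"
  shows "int_part (emb R a) = 0"
    and "ring S \<Longrightarrow> component S (emb R a) = (if S = R then a else \<zero>\<^bsub>S\<^esub>)"
proof -
  have *: "ring S \<Longrightarrow> (if S = R then a else \<zero>\<^bsub>S\<^esub>) \<in> carrier S" for S
    using assms by (auto intro: ring.ring_simprules)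
  show "int_part (emb R a) = 0"
    unfolding emb_def by (rule int_part_tuple) (rule *)
  show "ring S \<Longrightarrow> component S (emb R a) = (if S = R then a else \<zero>\<^bsub>S\<^esub>)"
    unfolding emb_def by (rule component_tuple) (rule *)
qed

lemma emb_inject: "a \<in> carrier R \<Longrightarrow> b \<in> carrier R \<Longrightarrow> emb R a = emb R b \<longleftrightarrow> a = b"
  using emb_components(2)[OF _ ring_axioms] by metis

lemma emb_add: "a \<in> carrier R \<Longrightarrow> b \<in> carrier R \<Longrightarrow> emb R (a \<oplus> b) = emb R a + emb R b"
  by (rule ring_product_eqI)
    (auto simp: emb_components ring_product_components ring.ring_simprules)

lemma emb_mult: "a \<in> carrier R \<Longrightarrow> b \<in> carrier R \<Longrightarrow> emb R (a \<otimes> b) = emb R a * emb R b"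
  by (rule ring_product_eqI)
    (auto simp: emb_components ring_product_components ring.ring_simprules)

lemma emb_uminus: "a \<in> carrier R \<Longrightarrow> emb R (\<ominus> a) = - emb R a"
proof (rule ring_product_eqI)
  fix S :: "('a, 'b) ring_scheme" assume a: "a \<in> carrier R" and "ring S"
  then interpret S: ring S by simp
  show "component S (emb R (\<ominus> a)) = component S (- emb R a)"
    using a \<open>ring S\<close> by (auto simp: emb_components ring_product_components)
qed (simp add: emb_components ring_product_components)

lemma emb_zero: "emb R \<zero> = 0"
  by (rule ring_product_eqI) (auto simp: emb_components ring_product_components)

lemma emb_power: "a \<in> carrier R \<Longrightarrow> 0 < n \<Longrightarrow> emb R (a [^] (n :: nat)) = emb R a ^ n"
  by (rotate_tac, induction n rule: nat_induct_non_zero) (auto simp: emb_mult power_Suc2 simp del: power_Suc)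

text \<open>All components of \<open>emb R z\<close> other than the one at \<open>R\<close> are
  zero, so it commutes with every element of the product. This supplies the assumption
  \<open>central\<close> of the results on the norm.\<close>

lemma emb_central:
  assumes "z \<in> ring_center R"
  shows "emb R z * w = w * emb R z"
proof (rule ring_product_eqI)
  have z: "z \<in> carrier R" using assms by (simp add: ring_center_def)
  show "int_part (emb R z * w) = int_part (w * emb R z)" by (simp add: ring_product_components)
  fix S :: "('a, 'b) ring_scheme" assume S: "ring S"
  then show "component S (emb R z * w) = component S (w * emb R z)"
    using component_closed[OF S, of w] assms z
    by (auto simp: emb_components ring_product_components ring.ring_simprules ring_center_def)
qed

end

lemma (in rng_subset) lspan_sum_form:
  assumes "finite B" "x \<in> lspan R B"
  shows "\<exists>c. (\<forall>b\<in>B. c b \<in> R) \<and> x = (\<Sum>b\<in>B. c b * b)"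
  using assms(2)
proof (induction rule: lspan.induct)
  case zero
  show ?case by (intro exI[of _ "\<lambda>_. 0"]) (simp add: zero_mem)
next
  case (step d b x)
  then obtain c where c: "\<forall>b\<in>B. c b \<in> R" "x = (\<Sum>b\<in>B. c b * b)" by auto
  have "(\<Sum>b'\<in>B. (c(b := d + c b)) b' * b') = (\<Sum>b'\<in>B. c b' * b' + (if b' = b then d * b' else 0))"
    by (intro sum.cong) (auto simp: distrib_right)
  also have "\<dots> = d * b + x"
    using assms(1) step(2) c(2) by (simp add: sum.distrib)
  finally show ?case
    using c(1) step(1,2) add_mem by (intro exI[of _ "c(b := d + c b)"]) auto
qed

section \<open>Transfer of the centrality criterion to record-based division rings\<close>

context skew_field
begin

lemma inv_nonzero:
  assumes "x \<in> carrier R" "x \<noteq> \<zero>"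
  shows "inv x \<in> carrier R" "inv x \<noteq> \<zero>" "x \<otimes> inv x = \<one>" "inv x \<otimes> x = \<one>"
proof -
  have u: "x \<in> Units R" using assms skew_field_Units by simp
  then show "inv x \<in> carrier R" "x \<otimes> inv x = \<one>" "inv x \<otimes> x = \<one>" by simp_all
  have "inv x \<in> Units R" using u by (rule Units_inv_Units)
  then show "inv x \<noteq> \<zero>" using skew_field_Units by simp
qed

lemma one_nonzero: "\<one> \<noteq> \<zero>"
  using skew_field_Units Units_one_closed by auto

lemma emb_division_subset: "division_subset (emb R ` carrier R) (emb R \<one>)"
proof
  fix x y assume "x \<in> emb R ` carrier R" "y \<in> emb R ` carrier R"
  then show "x + y \<in> emb R ` carrier R" "x * y \<in> emb R ` carrier R"
    by (auto simp flip: emb_add emb_mult)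
next
  fix x assume x: "x \<in> emb R ` carrier R"
  then show "- x \<in> emb R ` carrier R" "emb R \<one> * x = x" "x * emb R \<one> = x"
    by (auto simp flip: emb_uminus emb_mult)
  assume "x \<noteq> 0"
  then obtain a where a: "a \<in> carrier R" "x = emb R a" "a \<noteq> \<zero>" using x emb_zero by auto
  have "emb R a * emb R (inv a) = emb R \<one>" "emb R (inv a) * emb R a = emb R \<one>"
    using a inv_nonzero[OF a(1,3)] by (simp_all flip: emb_mult)
  then show "\<exists>y\<in>emb R ` carrier R. x * y = emb R \<one> \<and> y * x = emb R \<one>"
    using a inv_nonzero(1)[OF a(1,3)] by blast
qed (use one_nonzero emb_inject emb_zero in force)+

sublocale emb: division_subset "emb R ` carrier R" "emb R \<one>"
  by (rule emb_division_subset)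

lemma F_eq: "emb.F = emb R ` ring_center R"
proof
  show "emb.F \<subseteq> emb R ` ring_center R"
  proof
    fix z assume "z \<in> emb.F"
    then obtain a where a: "a \<in> carrier R" "z = emb R a"
      and comm: "\<And>x. x \<in> carrier R \<Longrightarrow> emb R a * emb R x = emb R x * emb R a"
      by (auto simp: emb.cent_def)
    have "a \<otimes> x = x \<otimes> a" if "x \<in> carrier R" for x
      using comm[OF that] a(1) that emb_inject[of "a \<otimes> x" "x \<otimes> a"] by (simp flip: emb_mult)
    then show "z \<in> emb R ` ring_center R" using a by (auto simp: ring_center_def)
  qed
  show "emb R ` ring_center R \<subseteq> emb.F"
    by (auto simp: emb.cent_def ring_center_def simp flip: emb_mult)
qed

lemma emb_nonzero: "x \<in> carrier R \<Longrightarrow> emb R x \<noteq> 0 \<longleftrightarrow> x \<noteq> \<zero>"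
  using emb_inject[of x \<zero>] emb_zero by auto

lemma emb_inv:
  assumes "x \<in> carrier R" "x \<noteq> \<zero>"
  shows "emb R (inv x) = emb.minv (emb R x)"
  by (rule emb.minv_unique) (use assms inv_nonzero[OF assms] in \<open>auto simp flip: emb_mult\<close>)

lemma ring_center_closed: "ring_center R \<subseteq> carrier R"
  by (auto simp: ring_center_def)

text \<open>The inductive definition of \<open>dimension\<close> adds one line at a time; each
  vector that is added contributes its image to the spanning set.\<close>

lemma emb_spans:
  assumes "centrally_finite R"
  shows "\<exists>B. emb.spans B"
proof -
  have span: "\<exists>B. finite B \<and> B \<subseteq> emb R ` carrier R \<and> emb R ` E \<subseteq> lspan emb.F B"
    if "dimension n (ring_center R) E" for n E
    using that
  proof (induction n "ring_center R" E rule: dimension.induct)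
    case zero_dim
    show ?case by (intro exI[of _ "{}"]) (auto simp: emb_zero lspan.zero)
  next
    case (Suc_dim v E n)
    then obtain B where B: "finite B" "B \<subseteq> emb R ` carrier R" "emb R ` E \<subseteq> lspan emb.F B" by blast
    have E: "E \<subseteq> carrier R"
      using \<open>dimension n (ring_center R) E\<close>
    proof (induction n "ring_center R" E rule: dimension.induct)
      case (Suc_dim v E n)
      then show ?case
        using ring_center_closed by (auto simp: line_extension_def set_add_def' r_coset_def)
    qed simp
    have "emb R ` line_extension (ring_center R) v E \<subseteq> lspan emb.F (insert (emb R v) B)"
    proof
      fix y assume "y \<in> emb R ` line_extension (ring_center R) v E"
      then obtain c x where c: "c \<in> ring_center R" "x \<in> E" "y = emb R (c \<otimes> v \<oplus> x)"
        by (auto simp: line_extension_def set_add_def' r_coset_def)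
      have "y = emb R c * emb R v + emb R x"
        using c E Suc_dim(1) ring_center_closed by (auto simp: emb_add emb_mult subset_iff)
      moreover have "emb R c \<in> emb.F" using c(1) F_eq by auto
      moreover have "emb R x \<in> lspan emb.F (insert (emb R v) B)"
        using B(3) c(2) lspan_mono[of B "insert (emb R v) B"] by blast
      ultimately show "y \<in> lspan emb.F (insert (emb R v) B)" by (auto intro: lspan.step)
    qed
    then show ?case using B Suc_dim(1) by (intro exI[of _ "insert (emb R v) B"]) auto
  qed
  obtain n where n: "dimension n (ring_center R) (carrier R)"
    using assms by (auto simp: centrally_finite_def finite_dimension_def over_def)
  then obtain B where B: "finite B" "B \<subseteq> emb R ` carrier R" "emb R ` carrier R \<subseteq> lspan emb.F B"
    using span[OF n] by metis
  have "\<exists>c. (\<forall>b\<in>B. c b \<in> emb.F) \<and> x = (\<Sum>b\<in>B. c b * b)" if "x \<in> emb R ` carrier R" for x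
    by (rule rng_subset.lspan_sum_form[OF emb.F_rng B(1) subsetD[OF B(3) that]])
  then have "emb.spans B" unfolding emb.spans_def using B(1,2) by blast
  then show ?thesis by blast
qed

text \<open>The injection \<open>emb\<close> carries the center onto \<open>emb.F\<close> and
  intertwines the two commutator maps on nonzero elements, so the criterion for subsets of a ring
  type applies to the image.\<close>

theorem central_of_radical_commutators:
  assumes fin: "centrally_finite R"
    and a: "a \<in> carrier R" "a \<noteq> \<zero>" "0 < m" "a [^] (m :: nat) \<in> ring_center R"
    and rad: "\<And>x. x \<in> carrier R \<Longrightarrow> x \<noteq> \<zero> \<Longrightarrow>
      \<exists>k. \<exists>l>0. (((\<lambda>y. a \<otimes> y \<otimes> inv a \<otimes> inv y) ^^ Suc k) x) [^] (l :: nat) \<in> ring_center R"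
  shows "a \<in> ring_center R"
proof -
  obtain B where B: "emb.spans B" using emb_spans[OF fin] by blast
  define c where "c y = a \<otimes> y \<otimes> inv a \<otimes> inv y" for y
  have c: "c y \<in> carrier R \<and> c y \<noteq> \<zero> \<and> emb R (c y) = emb.conj_by (emb R a) (emb R y) * emb.minv (emb R y)"
    if y: "y \<in> carrier R" "y \<noteq> \<zero>" for y
  proof -
    have "emb R (c y) = emb.conj_by (emb R a) (emb R y) * emb.minv (emb R y)"
      using a y inv_nonzero by (simp add: c_def emb_mult emb_inv)
    moreover have "emb.conj_by (emb R a) (emb R y) * emb.minv (emb R y) \<noteq> 0"
      using a y emb_nonzero by (intro emb.mult_nonzero emb.conj_mem emb.conj_nonzero emb.minv_mem emb.minv_nonzero) auto
    moreover have "c y \<in> carrier R" using a y inv_nonzero by (simp add: c_def)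
    ultimately show ?thesis using emb_zero by auto
  qed
  have "emb R a \<in> emb.F"
  proof (rule emb.central_of_radical_commutators[OF _ B _ _ a(3)])
    show "z * w = w * z" if "z \<in> emb.F" for z w
      using that F_eq emb_central by auto
    show "emb R a \<in> emb R ` carrier R" "emb R a \<noteq> 0" using a emb_nonzero by auto
    show "emb R a ^ m \<in> emb.F" using a F_eq by (auto simp flip: emb_power)
    fix x assume "x \<in> emb R ` carrier R" "x \<noteq> 0"
    then obtain x0 where x0: "x0 \<in> carrier R" "x0 \<noteq> \<zero>" "x = emb R x0" using emb_nonzero by auto
    have iter: "(c ^^ k) x0 \<in> carrier R \<and> (c ^^ k) x0 \<noteq> \<zero> \<and>
      emb R ((c ^^ k) x0) = ((\<lambda>y. emb.conj_by (emb R a) y * emb.minv y) ^^ k) x" for k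
      by (induction k) (use x0 c in auto)
    obtain k and l :: nat where kl: "0 < l" "((c ^^ Suc k) x0) [^] l \<in> ring_center R"
      using rad[OF x0(1,2)] unfolding c_def by blast
    have "emb R (((c ^^ Suc k) x0) [^] l) = (((\<lambda>y. emb.conj_by (emb R a) y * emb.minv y) ^^ Suc k) x) ^ l"
      using iter[of "Suc k"] kl(1) by (simp add: emb_power del: funpow.simps)
    then have "(((\<lambda>y. emb.conj_by (emb R a) y * emb.minv y) ^^ Suc k) x) ^ l \<in> emb.F"
      using kl(2) F_eq by (metis imageI)
    then show "\<exists>k. \<exists>l>0. (((\<lambda>y. emb.conj_by (emb R a) y * emb.minv y) ^^ Suc k) x) ^ l \<in> emb.F"
      using kl(1) by blast
  qed
  then obtain a' where "a' \<in> ring_center R" "emb R a = emb R a'" using F_eq by auto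
  then show ?thesis using emb_inject a(1) ring_center_closed by auto
qed

end

section \<open>Ascendant subgroups\<close>

text \<open>Well-founded induction on the stage containing the element. At a successor stage one
  commutator with \<open>a\<close> moves the element to the preceding stage, and at a limit stage
  the element already lies in an earlier one.\<close>

lemma ascendant_eventually_commutator:
  assumes "group X" and asc: "ascendant TYPE('i) G X" and a: "a \<in> G" and x: "x \<in> carrier X"
  shows "\<exists>k. ((\<lambda>y. a \<otimes>\<^bsub>X\<^esub> y \<otimes>\<^bsub>X\<^esub> inv\<^bsub>X\<^esub> a \<otimes>\<^bsub>X\<^esub> inv\<^bsub>X\<^esub> y) ^^ Suc k) x \<in> G"
proof -
  interpret group X by fact
  obtain r :: "'i rel" and z \<gamma> Hs where
    wo: "Well_order r" and z: "z \<in> Field r" "\<And>\<alpha>. \<alpha> \<in> Field r \<Longrightarrow> (z, \<alpha>) \<in> r"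
    and \<gamma>: "\<gamma> \<in> Field r"
    and sub: "\<And>\<alpha>. \<alpha> \<in> Field r \<Longrightarrow> subgroup (Hs \<alpha>) X"
    and Hz: "Hs z = G" and H\<gamma>: "Hs \<gamma> = carrier X"
    and succ: "\<And>\<alpha> \<beta>. wo_successor r \<alpha> \<beta> \<Longrightarrow> Hs \<alpha> \<lhd> X\<lparr>carrier := Hs \<beta>\<rparr>"
    and lim: "\<And>\<mu>. wo_limit r \<mu> \<Longrightarrow> Hs \<mu> = (\<Union>\<alpha> \<in> underS r \<mu>. Hs \<alpha>)"
    using asc unfolding ascendant_def ascendant_series_def by blast
  have wf: "wf (r - Id)" using wo by (simp add: well_order_on_def)
  have under: "(\<beta>, \<alpha>) \<in> r - Id \<and> \<beta> \<in> Field r" if "\<beta> \<in> underS r \<alpha>" for \<alpha> \<beta>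
    using that by (auto simp: underS_def Field_def)
  have stages: "\<alpha> = z \<or> (\<exists>\<beta>. wo_successor r \<beta> \<alpha>) \<or> wo_limit r \<alpha>" if "\<alpha> \<in> Field r" for \<alpha>
    using z(2)[OF that] by (auto simp: wo_limit_def underS_def)
  define c where "c y = a \<otimes>\<^bsub>X\<^esub> y \<otimes>\<^bsub>X\<^esub> inv\<^bsub>X\<^esub> a \<otimes>\<^bsub>X\<^esub> inv\<^bsub>X\<^esub> y" for y
  have a_mem: "\<alpha> \<in> Field r \<longrightarrow> a \<in> Hs \<alpha>" for \<alpha>
  proof (induction \<alpha> rule: wf_induct_rule[OF wf])
    case (1 \<alpha>)
    show ?case
    proof
      assume "\<alpha> \<in> Field r"
      then consider "\<alpha> = z" | \<beta> where "wo_successor r \<beta> \<alpha>" | "wo_limit r \<alpha>" using stages by blast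
      then show "a \<in> Hs \<alpha>"
      proof cases
        case 2
        then have "\<beta> \<in> underS r \<alpha>" by (simp add: wo_successor_def)
        then have "a \<in> Hs \<beta>" using under 1 by blast
        then show ?thesis using normal_imp_subgroup[OF succ[OF 2]] subgroup.mem_carrier by fastforce
      next
        case 3
        then obtain \<beta> where "\<beta> \<in> underS r \<alpha>" by (auto simp: wo_limit_def)
        then show ?thesis using under 1 lim[OF 3] by blast
      qed (use a Hz in simp)
    qed
  qed
  have "\<alpha> \<in> Field r \<longrightarrow> (\<forall>y\<in>Hs \<alpha>. \<exists>k. (c ^^ k) y \<in> G)" for \<alpha>
  proof (induction \<alpha> rule: wf_induct_rule[OF wf])
    case (1 \<alpha>)
    show ?case
    proof (intro impI ballI)
      fix y assume \<alpha>: "\<alpha> \<in> Field r" and y: "y \<in> Hs \<alpha>"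
      consider "\<alpha> = z" | \<beta> where "wo_successor r \<beta> \<alpha>" | "wo_limit r \<alpha>" using stages[OF \<alpha>] by blast
      then show "\<exists>k. (c ^^ k) y \<in> G"
      proof cases
        case 1
        then show ?thesis using y Hz by (intro exI[of _ 0]) simp
      next
        case 2
        then have \<beta>: "\<beta> \<in> underS r \<alpha>" by (simp add: wo_successor_def)
        then have \<beta>F: "\<beta> \<in> Field r" using under by blast
        interpret N: normal "Hs \<beta>" "X\<lparr>carrier := Hs \<alpha>\<rparr>" by (rule succ[OF 2])
        interpret H: subgroup "Hs \<beta>" X by (rule sub[OF \<beta>F])
        have a\<beta>: "a \<in> Hs \<beta>" using a_mem \<beta>F by blast
        \<comment> \<open>Write \<open>c y\<close> as \<open>a\<close> times the conjugate by
          \<open>y\<close> of the inverse of \<open>a\<close>. Both factors lie in the normal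
          subgroup \<open>Hs \<beta>\<close>, because \<open>a\<close> belongs to all
          stages.\<close>
        have "y \<otimes>\<^bsub>X\<^esub> inv\<^bsub>X\<^esub> a \<otimes>\<^bsub>X\<^esub> inv\<^bsub>X\<^esub> y \<in> Hs \<beta>"
          using N.inv_op_closed2[of y "inv\<^bsub>X\<^esub> a"] y a\<beta> m_inv_consistent[OF sub[OF \<alpha>] y] by simp
        moreover have "y \<in> carrier X" "a \<in> carrier X"
          using y a\<beta> subgroup.mem_carrier[OF sub[OF \<alpha>]] by auto
        ultimately have "c y \<in> Hs \<beta>"
          using a\<beta> H.m_closed[of a] by (simp add: c_def m_assoc)
        then obtain k where "(c ^^ k) (c y) \<in> G" using "1" under[OF \<beta>] by blast
        then show ?thesis by (intro exI[of _ "Suc k"]) (simp add: funpow_swap1)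
      next
        case 3
        then obtain \<beta> where "\<beta> \<in> underS r \<alpha>" "y \<in> Hs \<beta>" using y lim by blast
        then show ?thesis using "1" under by blast
      qed
    qed
  qed
  then obtain k where k: "(c ^^ k) x \<in> G" using \<gamma> H\<gamma> x by blast
  interpret G: subgroup G X using sub[OF z(1)] Hz by simp
  \<comment> \<open>One further step stays in \<open>G\<close> and makes the iteration count
    positive, so that the element obtained is a commutator.\<close>
  have "c y \<in> G" if "y \<in> G" for y
    unfolding c_def using a that by (intro G.m_closed G.m_inv_closed)
  from this[OF k] have "c ((c ^^ k) x) \<in> G" .
  then have "(c ^^ Suc k) x \<in> G" by simp
  moreover have "c = (\<lambda>y. a \<otimes>\<^bsub>X\<^esub> y \<otimes>\<^bsub>X\<^esub> inv\<^bsub>X\<^esub> a \<otimes>\<^bsub>X\<^esub> inv\<^bsub>X\<^esub> y)"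
    by (simp add: c_def fun_eq_iff)
  ultimately show ?thesis by (intro exI[of _ k]) (simp only:)
qed

section \<open>Generated division subrings and the reduction to two generators\<close>

context skew_field
begin

lemma division_subringI:
  assumes "subring K R" "\<And>x. x \<in> K \<Longrightarrow> x \<noteq> \<zero> \<Longrightarrow> inv x \<in> K"
  shows "division_subring K R"
proof -
  interpret K: subring K R by fact
  have "Units (R\<lparr>carrier := K\<rparr>) = K - {\<zero>}"
  proof (intro equalityI subsetI)
    fix x assume "x \<in> Units (R\<lparr>carrier := K\<rparr>)"
    then obtain y where "x \<in> K" "y \<in> K" "y \<otimes> x = \<one>" by (auto simp: Units_def)
    moreover have "y \<in> carrier R" using \<open>y \<in> K\<close> K.subset by auto
    ultimately show "x \<in> K - {\<zero>}" using one_nonzero by auto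
  next
    fix x assume x: "x \<in> K - {\<zero>}"
    then have "x \<in> carrier R" "x \<noteq> \<zero>" using K.subset by auto
    then show "x \<in> Units (R\<lparr>carrier := K\<rparr>)"
      using assms(2)[of x] x inv_nonzero(3,4) by (auto simp: Units_def intro!: bexI[of _ "inv x"])
  qed
  then show ?thesis by unfold_locales
qed

text \<open>By uniqueness of inverses in \<open>R\<close>, the inverse formed in the subring is the
  ambient one.\<close>

lemma division_subring_inv:
  assumes "division_subring K R" "x \<in> K" "x \<noteq> \<zero>"
  shows "inv x \<in> K" "inv\<^bsub>R\<lparr>carrier := K\<rparr>\<^esub> x = inv x"
proof -
  interpret K: division_subring K R by fact
  interpret RK: ring "R\<lparr>carrier := K\<rparr>" by (rule subring_is_ring[OF K.subring_axioms])
  have u: "x \<in> Units (R\<lparr>carrier := K\<rparr>)" using K.division_subring_Units assms by simp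
  have y: "inv\<^bsub>R\<lparr>carrier := K\<rparr>\<^esub> x \<in> K" "inv\<^bsub>R\<lparr>carrier := K\<rparr>\<^esub> x \<otimes> x = \<one>"
    using RK.Units_inv_closed[OF u] RK.Units_l_inv[OF u] by simp_all
  have x: "x \<in> carrier R" using assms K.subset by auto
  have "inv\<^bsub>R\<lparr>carrier := K\<rparr>\<^esub> x = inv x"
    using inv_unique[OF y(2) inv_nonzero(3)[OF x assms(3)] x] y(1) inv_nonzero[OF x assms(3)] K.subset by auto
  then show "inv\<^bsub>R\<lparr>carrier := K\<rparr>\<^esub> x = inv x" "inv x \<in> K" using y(1) by simp_all
qed

lemma division_subring_skew_field:
  assumes "division_subring K R"
  shows "skew_field (R\<lparr>carrier := K\<rparr>)"
proof -
  interpret K: division_subring K R by fact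
  interpret RK: ring "R\<lparr>carrier := K\<rparr>" by (rule subring_is_ring[OF K.subring_axioms])
  show ?thesis by unfold_locales (use K.division_subring_Units in simp)
qed

text \<open>Division subrings are closed under the inverses of \<open>R\<close>, so the intersection
  is one again; the family is nonempty because it contains \<open>carrier R\<close>.\<close>

lemma generated_division_subring:
  assumes "S \<subseteq> carrier R"
  shows "division_subring (generated_division_subring R S) R"
    and "S \<subseteq> generated_division_subring R S"
proof -
  let ?\<K> = "{K. division_subring K R \<and> S \<subseteq> K}"
  have "division_subring (carrier R) R"
    by (rule division_subringI[OF carrier_is_subring]) (rule inv_nonzero)
  then have ne: "?\<K> \<noteq> {}" using assms by blast
  show "division_subring (generated_division_subring R S) R"
    unfolding generated_division_subring_def
  proof (rule division_subringI)
    show "subring (\<Inter>?\<K>) R"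
      by (rule subring_Inter) (use ne in \<open>auto simp: division_subring_def\<close>)
    show "inv x \<in> \<Inter>?\<K>" if x: "x \<in> \<Inter>?\<K>" "x \<noteq> \<zero>" for x
    proof
      fix K assume K: "K \<in> ?\<K>"
      then show "inv x \<in> K" using InterD[OF x(1) K] x(2) by (auto intro: division_subring_inv(1))
    qed
  qed
  show "S \<subseteq> generated_division_subring R S"
    by (auto simp: generated_division_subring_def)
qed

lemma group_mult_of: "group (mult_of R)"
proof -
  have "mult_of R = units_of R"
    by (simp add: mult_of_def units_of_def skew_field_Units)
  then show ?thesis using units_group by simp
qed

end

theorem theorem4p4:
  fixes D :: "('a, 'b) ring_scheme" and G :: "'a set"
  assumes "skew_field D"
    and "weakly_locally_finite D"
    and "ascendant TYPE('i) G (mult_of D)"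
    and "radical_over D G (ring_center D)"
  shows "G \<subseteq> ring_center D"
proof
  fix a assume aG: "a \<in> G"
  interpret D: skew_field D by fact
  interpret X: group "mult_of D" by (rule D.group_mult_of)
  have "subgroup G (mult_of D)"
    using assms(3) unfolding ascendant_def ascendant_series_def by blast
  then have a: "a \<in> carrier D" "a \<noteq> \<zero>\<^bsub>D\<^esub>" using aG subgroup.mem_carrier by fastforce+
  have inv_X: "inv\<^bsub>mult_of D\<^esub> y = inv\<^bsub>D\<^esub> y" if "y \<in> carrier D" "y \<noteq> \<zero>\<^bsub>D\<^esub>" for y
    by (rule X.inv_equality) (use that D.inv_nonzero in auto)
  show "a \<in> ring_center D"
  proof (rule ccontr)
    assume "a \<notin> ring_center D"
    then obtain b where b: "b \<in> carrier D" "a \<otimes>\<^bsub>D\<^esub> b \<noteq> b \<otimes>\<^bsub>D\<^esub> a"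
      using a by (auto simp: ring_center_def)
    \<comment> \<open>Two generators suffice to retain the failure of commutation, and weak local
      finiteness makes this division subring centrally finite.\<close>
    define K where "K = generated_division_subring D {a, b}"
    define E where "E = D\<lparr>carrier := K\<rparr>"
    have K: "division_subring K D" "{a, b} \<subseteq> K"
      unfolding K_def using D.generated_division_subring[of "{a, b}"] a b by auto
    interpret K: division_subring K D by fact
    interpret E: skew_field E unfolding E_def by (rule D.division_subring_skew_field[OF K(1)])
    have E: "carrier E = K" "\<zero>\<^bsub>E\<^esub> = \<zero>\<^bsub>D\<^esub>" "\<And>x y. x \<otimes>\<^bsub>E\<^esub> y = x \<otimes>\<^bsub>D\<^esub> y"
      "\<And>x n. x [^]\<^bsub>E\<^esub> (n :: nat) = x [^]\<^bsub>D\<^esub> n"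
      by (simp_all add: E_def flip: D.nat_pow_consistent)
    have inv_E: "inv\<^bsub>E\<^esub> y = inv\<^bsub>D\<^esub> y" if "y \<in> K" "y \<noteq> \<zero>\<^bsub>D\<^esub>" for y
      unfolding E_def by (rule D.division_subring_inv(2)[OF K(1) that])
    \<comment> \<open>Elements of the large center that lie in \<open>K\<close> are central there,
      so powers witnessing radicality over the center of \<open>D\<close> also work over the center
      of \<open>E\<close>.\<close>
    have cent: "z \<in> ring_center E" if "z \<in> ring_center D" "z \<in> K" for z
      using that K.subset by (auto simp: ring_center_def E)
    have rad: "\<exists>m>0. x [^]\<^bsub>E\<^esub> (m :: nat) \<in> ring_center E" if xG: "x \<in> G" and xK: "x \<in> K" for x
    proof -
      obtain m :: nat where m: "m > 0" "x [^]\<^bsub>D\<^esub> m \<in> ring_center D"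
        using assms(4) xG unfolding radical_over_def by blast
      have "x [^]\<^bsub>E\<^esub> m \<in> K" using E.nat_pow_closed[of x m] xK by (simp add: E(1))
      then have "x [^]\<^bsub>E\<^esub> m \<in> ring_center E" using cent m(2) by (simp add: E(4))
      then show ?thesis using m(1) by blast
    qed
    obtain m :: nat where m: "0 < m" "a [^]\<^bsub>E\<^esub> m \<in> ring_center E" using rad aG K(2) by blast
    have "a \<in> ring_center E"
    proof (rule E.central_of_radical_commutators[OF _ _ _ m])
      show "centrally_finite E"
        using assms(2) a b unfolding weakly_locally_finite_def E_def K_def by simp
      show "a \<in> carrier E" "a \<noteq> \<zero>\<^bsub>E\<^esub>" using K(2) a E by auto
      fix x assume x: "x \<in> carrier E" "x \<noteq> \<zero>\<^bsub>E\<^esub>"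
      define c where "c y = a \<otimes>\<^bsub>E\<^esub> y \<otimes>\<^bsub>E\<^esub> inv\<^bsub>E\<^esub> a \<otimes>\<^bsub>E\<^esub> inv\<^bsub>E\<^esub> y" for y
      define d where "d y = a \<otimes>\<^bsub>mult_of D\<^esub> y \<otimes>\<^bsub>mult_of D\<^esub> inv\<^bsub>mult_of D\<^esub> a
        \<otimes>\<^bsub>mult_of D\<^esub> inv\<^bsub>mult_of D\<^esub> y" for y
      \<comment> \<open>The commutator maps of \<open>E\<close> and of the group
        \<open>mult_of D\<close> agree on nonzero elements of \<open>K\<close>. The orbit therefore
        remains in \<open>K\<close>, although the ascendant series is a series of
        \<open>mult_of D\<close>.\<close>
      have cd: "c y \<in> K \<and> c y \<noteq> \<zero>\<^bsub>D\<^esub> \<and> d y = c y" if y: "y \<in> K" "y \<noteq> \<zero>\<^bsub>D\<^esub>" for y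
      proof -
        have yD: "y \<in> carrier D" using y K.subset by auto
        have "d y = c y"
          using inv_X[OF a] inv_X[OF yD y(2)] inv_E[OF _ a(2)] inv_E[OF y] K(2) by (simp add: c_def d_def E)
        moreover have "d y \<in> carrier (mult_of D)"
          unfolding d_def using a yD y by (intro X.m_closed X.inv_closed) auto
        moreover have "c y \<in> carrier E"
          unfolding c_def using y K(2) a E(1,2) E.inv_nonzero(1) by (intro E.m_closed) auto
        ultimately show ?thesis using E(1) by simp
      qed
      have iter: "(c ^^ k) x \<in> K \<and> (c ^^ k) x \<noteq> \<zero>\<^bsub>D\<^esub> \<and> (d ^^ k) x = (c ^^ k) x" for k
        by (induction k) (use x E cd in auto)
      have "x \<in> carrier (mult_of D)" using x E K.subset by auto
      then obtain k where "(d ^^ Suc k) x \<in> G"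
        using ascendant_eventually_commutator[OF X.group_axioms assms(3) aG] unfolding d_def by blast
      then have "(c ^^ Suc k) x \<in> G" "(c ^^ Suc k) x \<in> K" using iter[of "Suc k"] by simp_all
      then show "\<exists>k. \<exists>l>0. ((\<lambda>y. a \<otimes>\<^bsub>E\<^esub> y \<otimes>\<^bsub>E\<^esub> inv\<^bsub>E\<^esub> a \<otimes>\<^bsub>E\<^esub> inv\<^bsub>E\<^esub> y) ^^ Suc k) x
          [^]\<^bsub>E\<^esub> (l :: nat) \<in> ring_center E"
        using rad unfolding c_def by blast
    qed
    then show False using b K(2) by (auto simp: ring_center_def E)
  qed
qed

end
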